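(* Let $\sigma_1,\sigma_2,\sigma_3$ be non-trivial (two-variable) operator means on $B(\mathcal H)_+$, and suppose that either all of them are arithmetic, or at most one of them is not strictly concave. Then there exists a unique probability vector $(p_1,p_2,p_3)\in(0,1)^3$ such that for any $A,B,C\in B(\mathcal H)_+$ the sequences $A_n,B_n,C_n$ defined by $(A_0,B_0,C_0)=(A,B,C)$ and $$(A_{n+1},B_{n+1},C_{n+1})=(B_n\,\sigma_1\,C_n,\; C_n\,\sigma_2\,A_n,\; A_n\,\sigma_3\,B_n)$$ converge weakly (in the weak operator topology) to a common limit $S$, and $$p_1A_n+p_2B_n+p_3C_n\downarrow S .$$
   Context: $\mathcal H$ is a nonzero Hilbert space, $B(\mathcal H)_+$ is the set of positive (semidefinite) bounded operators on $\mathcal H$, and $A>0$ means $A$ is positive and invertible. $A_n\downarrow A$ means that $(A_n)$ is decreasing and converges strongly to $A$. A (two-variable) operator mean is a binary operation $\sigma$ on $B(\mathcal H)_+$ satisfying: (monotonicity) $A\le C,\ B\le D$ imply $A\sigma B\le C\sigma D$; (transformer inequality) $T(A\sigma B)T\le (TAT)\sigma(TBT)$ for every positive operator $T$; (downward continuity) $A_n\downarrow A,\ B_n\downarrow B$ imply $A_n\sigma B_n\downarrow A\sigma B$; (normalization) $I\sigma I=I$. By the Kubo–Ando theory, which is in force throughout, each operator mean $\sigma$ has a unique representing function $f_\sigma$, a positive operator monotone function on $(0,\infty)$ with $f_\sigma(1)=1$, such that $A\sigma B=A^{1/2}f_\sigma(A^{-1/2}BA^{-1/2})A^{1/2}$ for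 $A>0$, $B\ge0$; and $A\sigma B$ is the strong limit of $(A+\varepsilon I)\sigma(B+\varepsilon I)$ as $\varepsilon\downarrow 0$ for general $A,B$. Scalars $a\ge0$ are identified with $aI$. $\sigma$ is non-trivial if it is neither $(A,B)\mapsto A$ nor $(A,B)\mapsto B$. The weight of a non-trivial $\sigma$ is $f_\sigma'(1)\in(0,1)$. $\sigma$ is arithmetic if $A\sigma B=(1-r)A+rB$ for all $A,B$, for some $r\in[0,1]$. A non-trivial $\sigma$ with weight $r$ is strictly concave if, for scalars $\alpha,\beta\ge0$, $\alpha\sigma\beta=(1-r)\alpha+r\beta$ implies $\alpha=\beta$ (equivalently, $\sigma$ is not arithmetic). A probability vector is a vector with nonnegative entries summing to $1$. *)

theory Defs
  imports
    "HOL-Analysis.Analysis"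
    "HOL-Computational_Algebra.Polynomial"
    "Jordan_Normal_Form.Schur_Decomposition"
begin

section \<open>Complex Hilbert spaces\<close>

text \<open>The library only has real inner product spaces. Completeness and the normed real vector space
  structure come from the class \<open>banach\<close>; the inner product is linear in its first argument.\<close>

class complex_hilbert_space = banach +
  fixes scaleC :: "complex \<Rightarrow> 'a \<Rightarrow> 'a"  (infixr \<open>*\<^sub>C\<close> 75)
    and cinner :: "'a \<Rightarrow> 'a \<Rightarrow> complex"
  assumes scaleC_add_right: "c *\<^sub>C (x + y) = c *\<^sub>C x + c *\<^sub>C y"
    and scaleC_add_left: "(c + d) *\<^sub>C x = c *\<^sub>C x + d *\<^sub>C x"
    and scaleC_scaleC: "c *\<^sub>C d *\<^sub>C x = (c * d) *\<^sub>C x"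
    and scaleR_scaleC: "r *\<^sub>R x = complex_of_real r *\<^sub>C x"
    and cinner_add_left: "cinner (x + y) z = cinner x z + cinner y z"
    and cinner_scaleC_left: "cinner (c *\<^sub>C x) y = c * cinner x y"
    and cinner_commute: "cinner x y = cnj (cinner y x)"
    and cinner_self: "cinner x x = complex_of_real ((norm x)\<^sup>2)"

section \<open>Positive operators\<close>

text \<open>Elements of \<open>'a \<Rightarrow>\<^sub>L 'a\<close> are bounded and real-linear, so complex linearity is required
  explicitly. Since the scalars are complex, nonnegativity of the quadratic form implies that the
  operator is self-adjoint.\<close>

type_synonym 'a op = "'a \<Rightarrow>\<^sub>L 'a"

definition pos_op :: "'a::complex_hilbert_space op set" where
  "pos_op = {A :: 'a op. (\<forall>c x. A (c *\<^sub>C x) = c *\<^sub>C A x) \<and> (\<forall>x. cinner (A x) x \<in> \<real>\<^sub>\<ge>\<^sub>0)}"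

definition op_le :: "'a::complex_hilbert_space op \<Rightarrow> 'a op \<Rightarrow> bool"  (infix \<open>\<preceq>\<close> 50) where
  "A \<preceq> B \<longleftrightarrow> B - A \<in> pos_op"

definition op_invertible :: "'a::complex_hilbert_space op \<Rightarrow> bool" where
  "op_invertible A \<longleftrightarrow> (\<exists>B. A o\<^sub>L B = id_blinfun \<and> B o\<^sub>L A = id_blinfun)"

definition scalar_op :: "real \<Rightarrow> 'a::complex_hilbert_space op" where
  "scalar_op t = t *\<^sub>R id_blinfun"

definition decreases_to :: "(nat \<Rightarrow> 'a::complex_hilbert_space op) \<Rightarrow> 'a op \<Rightarrow> bool"
    (infix \<open>\<down>\<close> 50) where
  "An \<down> A \<longleftrightarrow> (\<forall>m n. m \<le> n \<longrightarrow> An n \<preceq> An m) \<and> (\<forall>x. (\<lambda>n. An n x) \<longlonglongrightarrow> A x)"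

definition converges_weakly :: "(nat \<Rightarrow> 'a::complex_hilbert_space op) \<Rightarrow> 'a op \<Rightarrow> bool" where
  "converges_weakly An A \<longleftrightarrow> (\<forall>x y. (\<lambda>n. cinner (An n x) y) \<longlonglongrightarrow> cinner (A x) y)"

section \<open>Continuous functional calculus\<close>

text \<open>Only used for positive operators, whose spectrum consists of real numbers.\<close>

definition op_spectrum :: "'a::complex_hilbert_space op \<Rightarrow> real set" where
  "op_spectrum X = {t. \<not> op_invertible (scalar_op t - X)}"

definition poly_op :: "real poly \<Rightarrow> 'a::complex_hilbert_space op \<Rightarrow> 'a op" where
  "poly_op p X = (\<Sum>i\<le>degree p. coeff p i *\<^sub>R ((\<lambda>Y. X o\<^sub>L Y) ^^ i) id_blinfun)"

text \<open>The norm limit of \<open>p\<^sub>n(X)\<close> for polynomials \<open>p\<^sub>n\<close> that converge to \<open>f\<close> uniformly on the spectrum.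
  It exists and is unique if \<open>X\<close> is positive and \<open>f\<close> is continuous on the spectrum.\<close>

definition cfc :: "(real \<Rightarrow> real) \<Rightarrow> 'a::complex_hilbert_space op \<Rightarrow> 'a op" where
  "cfc f X = (THE Y. \<exists>p. uniform_limit (op_spectrum X) (\<lambda>n. poly (p n)) f sequentially
                        \<and> (\<lambda>n. poly_op (p n) X) \<longlonglongrightarrow> Y)"

section \<open>Operator monotone functions\<close>

definition psd_mat :: "nat \<Rightarrow> complex mat \<Rightarrow> bool" where
  "psd_mat n M \<longleftrightarrow> M \<in> carrier_mat n n \<and> (\<forall>v\<in>carrier_vec n. (M *\<^sub>v v) \<bullet>c v \<in> \<real>\<^sub>\<ge>\<^sub>0)"

definition unitary_mat :: "nat \<Rightarrow> complex mat \<Rightarrow> bool" where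
  "unitary_mat n U \<longleftrightarrow> U \<in> carrier_mat n n \<and> mat_adjoint U * U = 1\<^sub>m n \<and> U * mat_adjoint U = 1\<^sub>m n"

definition spectral_mat :: "nat \<Rightarrow> complex mat \<Rightarrow> (nat \<Rightarrow> real) \<Rightarrow> complex mat" where
  "spectral_mat n U d = U * mat_diag n (\<lambda>i. complex_of_real (d i)) * mat_adjoint U"

text \<open>Every Hermitian matrix has the form \<open>spectral_mat n U d\<close> with \<open>U\<close> unitary, where \<open>d\<close> lists
  its eigenvalues, and applying \<open>f\<close> to it yields \<open>spectral_mat n U (f \<circ> d)\<close>. So the condition says
  that \<open>H \<le> K\<close> implies \<open>f(H) \<le> f(K)\<close> for positive definite complex matrices of every size.\<close>

definition operator_monotone :: "(real \<Rightarrow> real) \<Rightarrow> bool" where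
  "operator_monotone f \<longleftrightarrow>
    (\<forall>n U V d e. unitary_mat n U \<longrightarrow> unitary_mat n V \<longrightarrow> (\<forall>i<n. 0 < d i \<and> 0 < e i) \<longrightarrow>
       psd_mat n (spectral_mat n V e - spectral_mat n U d) \<longrightarrow>
       psd_mat n (spectral_mat n V (f \<circ> e) - spectral_mat n U (f \<circ> d)))"

section \<open>Operator means\<close>

text \<open>A binary operation on \<open>pos_op\<close> is given by a function on all pairs of operators, of which only
  the values on \<open>pos_op\<close> matter.\<close>

definition operator_mean :: "('a::complex_hilbert_space op \<Rightarrow> 'a op \<Rightarrow> 'a op) \<Rightarrow> bool" where
  "operator_mean \<sigma> \<longleftrightarrow>
    (\<forall>A\<in>pos_op. \<forall>B\<in>pos_op. \<sigma> A B \<in> pos_op) \<and>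
    (\<forall>A\<in>pos_op. \<forall>B\<in>pos_op. \<forall>C\<in>pos_op. \<forall>D\<in>pos_op.
       A \<preceq> C \<longrightarrow> B \<preceq> D \<longrightarrow> \<sigma> A B \<preceq> \<sigma> C D) \<and>
    (\<forall>A\<in>pos_op. \<forall>B\<in>pos_op. \<forall>T\<in>pos_op.
       T o\<^sub>L \<sigma> A B o\<^sub>L T \<preceq> \<sigma> (T o\<^sub>L A o\<^sub>L T) (T o\<^sub>L B o\<^sub>L T)) \<and>
    (\<forall>An Bn. \<forall>A\<in>pos_op. \<forall>B\<in>pos_op. (\<forall>n. An n \<in> pos_op \<and> Bn n \<in> pos_op) \<longrightarrow>
       An \<down> A \<longrightarrow> Bn \<down> B \<longrightarrow> (\<lambda>n. \<sigma> (An n) (Bn n)) \<down> \<sigma> A B) \<and>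
    \<sigma> id_blinfun id_blinfun = id_blinfun"

text \<open>The value \<open>f 0\<close>, which is needed when \<open>B\<close> is not invertible, is the limit of \<open>f\<close> at \<open>0\<close>.
  By Kubo and Ando, every operator mean on an infinite-dimensional space has a representing function.
  On a finite-dimensional space the axioms alone do not give one: on a one-dimensional space, the
  maximum of two numbers satisfies \<open>operator_mean\<close>.\<close>

definition representing_function ::
    "('a::complex_hilbert_space op \<Rightarrow> 'a op \<Rightarrow> 'a op) \<Rightarrow> (real \<Rightarrow> real) \<Rightarrow> bool" where
  "representing_function \<sigma> f \<longleftrightarrow>
    (\<forall>t>0. 0 < f t) \<and> operator_monotone f \<and> f 1 = 1 \<and> (f \<longlongrightarrow> f 0) (at_right 0) \<and>
    (\<forall>A\<in>pos_op. \<forall>B\<in>pos_op. op_invertible A \<longrightarrow>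
       (let R = cfc sqrt A; R' = cfc (\<lambda>t. 1 / sqrt t) A
        in \<sigma> A B = R o\<^sub>L cfc f (R' o\<^sub>L B o\<^sub>L R') o\<^sub>L R))"

text \<open>A representing function is unique on \<open>{0..}\<close> (on a nonzero space), so the choice does not
  affect its derivative at \<open>1\<close>.\<close>

definition weight :: "('a::complex_hilbert_space op \<Rightarrow> 'a op \<Rightarrow> 'a op) \<Rightarrow> real" where
  "weight \<sigma> = deriv (SOME f. representing_function \<sigma> f) 1"

definition nontrivial_mean :: "('a::complex_hilbert_space op \<Rightarrow> 'a op \<Rightarrow> 'a op) \<Rightarrow> bool" where
  "nontrivial_mean \<sigma> \<longleftrightarrow>
    \<not> (\<forall>A\<in>pos_op. \<forall>B\<in>pos_op. \<sigma> A B = A) \<and> \<not> (\<forall>A\<in>pos_op. \<forall>B\<in>pos_op. \<sigma> A B = B)"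

definition arithmetic_mean :: "('a::complex_hilbert_space op \<Rightarrow> 'a op \<Rightarrow> 'a op) \<Rightarrow> bool" where
  "arithmetic_mean \<sigma> \<longleftrightarrow>
    (\<exists>r\<in>{0..1}. \<forall>A\<in>pos_op. \<forall>B\<in>pos_op. \<sigma> A B = (1 - r) *\<^sub>R A + r *\<^sub>R B)"

definition strictly_concave :: "('a::complex_hilbert_space op \<Rightarrow> 'a op \<Rightarrow> 'a op) \<Rightarrow> bool" where
  "strictly_concave \<sigma> \<longleftrightarrow>
    nontrivial_mean \<sigma> \<and>
    (\<forall>\<alpha>\<ge>0. \<forall>\<beta>\<ge>0. \<sigma> (scalar_op \<alpha>) (scalar_op \<beta>)
         = scalar_op ((1 - weight \<sigma>) * \<alpha> + weight \<sigma> * \<beta>) \<longrightarrow> \<alpha> = \<beta>)"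

end

theory Submission
  imports Defs
begin

text \<open>
  The quadratic forms of an operator mean of weight \<open>w\<close> satisfy
  \<open>A \<sigma> B \<le> (1 - w) A + w B\<close>, so the weighted sum of the iterates decreases if the weights form the
  stationary distribution of the Markov chain of the three arithmetic means; conversely, decrease
  near equal scalars forces stationarity. The monotone limit exists, hence the
  gaps \<open>(1 - w) A + w B - A \<sigma> B\<close> tend to \<open>0\<close>. If \<open>\<sigma>\<close> is strictly concave, then
  \<open>f t \<le> 1 + w (t - 1) - k (t - 1)\<^sup>2 / (1 + t)\<close> for some \<open>k > 0\<close>, and the gap controls the difference
  of the quadratic forms of \<open>A\<close> and \<open>B\<close>, which therefore tends to \<open>0\<close>. If all three means are arithmetic,
  the squares of the quadratic forms have a decreasing weighted sum instead. Every property of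
  \<open>f\<close> that is needed (concavity, differentiability, the quadratic gap) follows from a single inequality
  between its divided differences, which expresses monotonicity on \<open>2 \<times> 2\<close> matrices that differ by
  a matrix of rank one.
\<close>

section \<open>Representing functions\<close>

text \<open>\<open>A\<close> and \<open>B\<close> need not commute, so a bound on the representing
  function passes to the mean only through affine functions: conjugation by the square root of
  \<open>A\<close> sends \<open>1\<close> and \<open>t\<close> to \<open>A\<close> and
  \<open>B\<close>. The iterates are therefore seen only through their forms at one fixed vector, as
  three real sequences; polarization then yields weak limits. Strict concavity is a hypothesis on
  scalars. Used at \<open>1\<close> and \<open>2\<close>, it gives a gap at \<open>t = 2\<close>,
  which the divided-difference inequality spreads to every \<open>t\<close>. The denominator
  \<open>1 + t\<close> makes the gap homogeneous: with \<open>t = b / a\<close> and a factor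
  \<open>a\<close> it becomes \<open>(b - a)^2 / (a + b)\<close>. The three differences of the forms
  sum to \<open>0\<close>, so two strictly concave means already force all three to vanish. With
  three arithmetic means every gap is \<open>0\<close> and tells nothing; what the squares lose in a
  step is a weighted sum of variances, with positive coefficients because the weights of non-trivial
  means lie strictly between \<open>0\<close> and \<open>1\<close>.\<close>

lemma mat_adjoint_index:
  assumes "A \<in> carrier_mat n m" "i < m" "j < n"
  shows "mat_adjoint A $$ (i, j) = conjugate (A $$ (j, i))"
  using assms by (simp add: mat_adjoint_def mat_of_rows_def)

section \<open>Positive semidefinite real matrices of size two\<close>

definition mat22 :: "real \<Rightarrow> real \<Rightarrow> real \<Rightarrow> real \<Rightarrow> complex mat" where
  "mat22 p q r s = Matrix.mat 2 2 (\<lambda>(i, j). complex_of_real 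
     (if i = 0 then if j = 0 then p else q else if j = 0 then r else s))"

lemma mat22_carrier: "mat22 p q r s \<in> carrier_mat 2 2"
  by (simp add: mat22_def)

lemma mat22_index [simp]:
  "mat22 p q r s $$ (0, 0) = p" "mat22 p q r s $$ (0, Suc 0) = q"
  "mat22 p q r s $$ (Suc 0, 0) = r" "mat22 p q r s $$ (Suc 0, Suc 0) = s"
  "dim_row (mat22 p q r s) = 2" "dim_col (mat22 p q r s) = 2"
  by (simp_all add: mat22_def)

lemma mat22_eqI:
  assumes "A \<in> carrier_mat 2 2" "A $$ (0, 0) = of_real p" "A $$ (0, Suc 0) = of_real q"
    "A $$ (Suc 0, 0) = of_real r" "A $$ (Suc 0, Suc 0) = of_real s"
  shows "A = mat22 p q r s"
  using assms by (intro eq_matI) (auto simp: less_2_cases_iff)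

lemma mat22_mult:
  "mat22 p q r s * mat22 p' q' r' s' = mat22 (p * p' + q * r') (p * q' + q * s') (r * p' + s * r') (r * q' + s * s')"
proof -
  have "{0..<2} = {0, Suc 0}" by auto
  then have sp: "(mat22 p q r s * mat22 p' q' r' s') $$ (i, j)
      = mat22 p q r s $$ (i, 0) * mat22 p' q' r' s' $$ (0, j)
        + mat22 p q r s $$ (i, Suc 0) * mat22 p' q' r' s' $$ (Suc 0, j)" if "i < 2" "j < 2" for i j
    using that by (simp add: scalar_prod_def)
  show ?thesis
  proof (rule mat22_eqI)
    show "mat22 p q r s * mat22 p' q' r' s' \<in> carrier_mat 2 2"
      by (rule mult_carrier_mat[of _ 2 2]; rule mat22_carrier)
  qed (simp_all add: sp del: index_mult_mat)
qed

lemma mat22_adjoint: "mat_adjoint (mat22 p q r s) = mat22 p r q s"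
proof (rule mat22_eqI)
  show "mat_adjoint (mat22 p q r s) \<in> carrier_mat 2 2"
    unfolding mat_adjoint_def by (rule carrier_matI) simp_all
qed (subst mat_adjoint_index[OF mat22_carrier]; simp)+

lemma mat22_one: "1\<^sub>m 2 = mat22 1 0 0 1"
  by (rule mat22_eqI) auto

lemma mat22_diag: "mat_diag 2 (\<lambda>i. complex_of_real (d i)) = mat22 (d 0) 0 0 (d 1)"
  by (rule mat22_eqI) (auto simp: mat_diag_def)

lemma spectral_mat22:
  "spectral_mat 2 (mat22 p q r s) d =
     mat22 (p * p * d 0 + q * q * d 1) (p * r * d 0 + q * s * d 1) (p * r * d 0 + q * s * d 1) (r * r * d 0 + s * s * d 1)"
  unfolding spectral_mat_def mat22_diag mat22_adjoint mat22_mult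
  by (simp add: algebra_simps)

lemma mat22_minus: "mat22 p q r s - mat22 p' q' r' s' = mat22 (p - p') (q - q') (r - r') (s - s')"
  by (rule mat22_eqI) (auto simp: mat22_carrier intro!: minus_carrier_mat)

lemma mat22_form:
  assumes "v \<in> carrier_vec 2"
  shows "(mat22 p q q s *\<^sub>v v) \<bullet>c v =
    complex_of_real (p * (cmod (vec_index v 0))\<^sup>2 + s * (cmod (vec_index v 1))\<^sup>2 + 2 * q * Re (vec_index v 0 * cnj (vec_index v 1)))"
proof -
  define x y where "x = vec_index v 0" and "y = vec_index v 1"
  have "(mat22 p q q s *\<^sub>v v) \<bullet>c v = (p * x + q * y) * cnj x + (q * x + s * y) * cnj y"
    using assms by (auto simp: scalar_prod_def numeral_2_eq_2 x_def y_def)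
  also have "\<dots> = complex_of_real (p * (cmod x)\<^sup>2 + s * (cmod y)\<^sup>2 + 2 * q * Re (x * cnj y))"
    unfolding cmod_power2 by (simp add: complex_eq_iff power2_eq_square) (simp add: algebra_simps)
  finally show ?thesis unfolding x_def y_def .
qed

lemma psd_mat22I:
  assumes "0 < p" "0 \<le> p * s - q * q"
  shows "psd_mat 2 (mat22 p q q s)"
  unfolding psd_mat_def
proof (intro conjI ballI)
  fix v :: "complex vec" assume v: "v \<in> carrier_vec 2"
  define x where "x = vec_index v 0" define y where "y = vec_index v 1"
  have "p * (p * (cmod x)\<^sup>2 + s * (cmod y)\<^sup>2 + 2 * q * Re (x * cnj y))
      = (cmod (of_real p * x + of_real q * y))\<^sup>2 + (p * s - q * q) * (cmod y)\<^sup>2"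
    unfolding cmod_power2 by (simp add: power2_eq_square algebra_simps)
  also have "\<dots> \<ge> 0" using assms by simp
  finally have "0 \<le> p * (cmod x)\<^sup>2 + s * (cmod y)\<^sup>2 + 2 * q * Re (x * cnj y)"
    using assms(1) by (simp add: zero_le_mult_iff)
  then show "(mat22 p q q s *\<^sub>v v) \<bullet>c v \<in> \<real>\<^sub>\<ge>\<^sub>0"
    unfolding mat22_form[OF v] x_def y_def nonneg_Reals_of_real_iff .
qed (rule mat22_carrier)

lemma psd_mat22D:
  assumes "psd_mat 2 (mat22 p q q s)"
  shows "0 \<le> p" "0 \<le> s" "q * q \<le> p * s"
proof -
  have form: "0 \<le> p * x\<^sup>2 + s * y\<^sup>2 + 2 * q * (x * y)" for x y :: real
  proof -
    define v :: "complex vec" where "v = Matrix.vec 2 (\<lambda>i. complex_of_real (if i = 0 then x else y))"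
    have v: "v \<in> carrier_vec 2" "vec_index v 0 = x" "vec_index v 1 = y" by (auto simp: v_def)
    then have "(mat22 p q q s *\<^sub>v v) \<bullet>c v \<in> \<real>\<^sub>\<ge>\<^sub>0" using assms by (auto simp: psd_mat_def)
    then show ?thesis unfolding mat22_form[OF v(1)] nonneg_Reals_of_real_iff v(2,3)
      by (simp add: power2_eq_square)
  qed
  show p: "0 \<le> p" using form[of 1 0] by simp
  show s: "0 \<le> s" using form[of 0 1] by simp
  show "q * q \<le> p * s"
  proof (cases "p = 0 \<and> s = 0")
    case True
    then show ?thesis using form[of 1 q] form[of 1 "- q"] by auto
  next
    case False
    \<comment> \<open>The vectors \<open>(q, - p)\<close> and \<open>(s, - q)\<close> turn the form
      into \<open>p\<close> and \<open>s\<close> times the determinant.\<close>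
    have "0 \<le> p * (p * s - q * q)" "0 \<le> s * (p * s - q * q)"
      using form[of q "- p"] form[of s "- q"] by (simp_all add: power2_eq_square algebra_simps)
    then show ?thesis using False p s by (auto simp: zero_le_mult_iff)
  qed
qed

lemma operator_monotoneD:
  assumes "operator_monotone f" "unitary_mat n U" "unitary_mat n V" "\<forall>i<n. 0 < d i \<and> 0 < e i"
    "psd_mat n (spectral_mat n V e - spectral_mat n U d)"
  shows "psd_mat n (spectral_mat n V (f \<circ> e) - spectral_mat n U (f \<circ> d))"
  using assms unfolding operator_monotone_def by simp

lemma operator_monotone_mono:
  assumes "operator_monotone f" "0 < s" "s \<le> t"
  shows "f s \<le> f t"
proof (cases "s = t")
  case False
  have u: "unitary_mat 2 (mat22 1 0 0 1)"
    by (simp add: unitary_mat_def mat22_carrier mat22_adjoint mat22_mult mat22_one)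
  have "psd_mat 2 (spectral_mat 2 (mat22 1 0 0 1) (\<lambda>_. t) - spectral_mat 2 (mat22 1 0 0 1) (\<lambda>_. s))"
    unfolding spectral_mat22 mat22_minus by (rule psd_mat22I) (use False assms in simp_all)
  then have "psd_mat 2 (spectral_mat 2 (mat22 1 0 0 1) (f \<circ> (\<lambda>_. t)) - spectral_mat 2 (mat22 1 0 0 1) (f \<circ> (\<lambda>_. s)))"
    by (rule operator_monotoneD[OF assms(1) u u, where d = "\<lambda>_. s" and e = "\<lambda>_. t", rotated])
      (use assms(2,3) in simp)
  from psd_mat22D(1)[OF this[unfolded spectral_mat22 mat22_minus]] show ?thesis by simp
qed simp

text \<open>The matrices have eigenvalues \<open>a, b\<close> and \<open>c, d\<close> and differ by a matrix of rank one; the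
  inequality says that the difference of their images has a nonnegative determinant.\<close>

lemma operator_monotone_cross:
  assumes "operator_monotone f" and less: "0 < a" "a < c" "c < b" "b < d"
  shows "(f d - f a) / (d - a) * ((f b - f c) / (b - c)) \<le> (f c - f a) / (c - a) * ((f d - f b) / (d - b))"
proof -
  \<comment> \<open>The rotation \<open>V\<close>, with sine squared \<open>y\<close>, is chosen so
    that the determinant of the difference,
    \<open>(c - a) * (d - b) - y * (d - c) * (b - a)\<close>, is \<open>0\<close>: the difference
    has rank one and is only just positive semidefinite. The interlacing
    \<open>a < c < b < d\<close> puts \<open>y\<close> between \<open>0\<close> and
    \<open>1\<close>.\<close>
  define y where "y = (c - a) * (d - b) / ((d - c) * (b - a))"
  have y1: "1 - y = (d - a) * (b - c) / ((d - c) * (b - a))"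
  proof -
    have "(d - c) * (b - a) \<noteq> 0" using less by simp
    moreover have "(d - a) * (b - c) = (d - c) * (b - a) - (c - a) * (d - b)"
      by (simp add: algebra_simps)
    ultimately show ?thesis by (simp add: y_def diff_divide_distrib)
  qed
  have "0 \<le> y" "0 \<le> 1 - y" unfolding y1 unfolding y_def
    using less by (auto intro!: divide_nonneg_pos mult_nonneg_nonneg mult_pos_pos)
  define S where "S = sqrt y"
  define K where "K = sqrt (1 - y)"
  have SS: "S * S = y" and KK: "K * K = 1 - y" using \<open>0 \<le> y\<close> \<open>0 \<le> 1 - y\<close> by (auto simp: S_def K_def)
  define U where "U = mat22 1 0 0 1"
  define V where "V = mat22 K (- S) S K"
  have u: "unitary_mat 2 U"
    by (simp add: U_def unitary_mat_def mat22_carrier mat22_adjoint mat22_mult mat22_one)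
  have v: "unitary_mat 2 V"
    by (simp add: V_def unitary_mat_def mat22_carrier mat22_adjoint mat22_mult mat22_one SS KK)
  define D where "D i = (if i = 0 then a else b)" for i :: nat
  define E where "E i = (if i = 0 then c else d)" for i :: nat
  have diff: "spectral_mat 2 V (g \<circ> E) - spectral_mat 2 U (g \<circ> D) =
     mat22 (g c - g a + y * (g d - g c)) (K * S * (g c - g d)) (K * S * (g c - g d)) (g d - g b - y * (g d - g c))" for g
    unfolding U_def V_def spectral_mat22 mat22_minus mult_minus_left mult_minus_right minus_minus SS KK
    by (simp add: D_def E_def algebra_simps)
  have det: "(g c - g a + y * (g d - g c)) * (g d - g b - y * (g d - g c)) - (K * S * (g c - g d)) * (K * S * (g c - g d))
      = (g c - g a) * (g d - g b) - y * ((g d - g c) * (g b - g a))" for g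
  proof -
    have "(K * S * (g c - g d)) * (K * S * (g c - g d)) = (K * K) * (S * S) * (g c - g d)\<^sup>2"
      by (simp add: power2_eq_square)
    then show ?thesis unfolding SS KK by (simp add: power2_eq_square algebra_simps)
  qed
  have "psd_mat 2 (spectral_mat 2 V (id \<circ> E) - spectral_mat 2 U (id \<circ> D))"
    unfolding diff
  proof (rule psd_mat22I)
    show "0 < id c - id a + y * (id d - id c)" using less \<open>0 \<le> y\<close> by (simp add: add_pos_nonneg)
    show "0 \<le> (id c - id a + y * (id d - id c)) * (id d - id b - y * (id d - id c))
        - K * S * (id c - id d) * (K * S * (id c - id d))"
    proof -
      have "y * ((d - c) * (b - a)) = (c - a) * (d - b)" using less by (simp add: y_def)
      then show ?thesis unfolding det by simp
    qed
  qed
  then have "psd_mat 2 (spectral_mat 2 V E - spectral_mat 2 U D)" by simp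
  moreover have "\<forall>i<2. 0 < D i \<and> 0 < E i" using less by (auto simp: D_def E_def)
  ultimately have "psd_mat 2 (spectral_mat 2 V (f \<circ> E) - spectral_mat 2 U (f \<circ> D))"
    by (rule operator_monotoneD[OF assms(1) u v, rotated])
  from psd_mat22D(3)[OF this[unfolded diff]]
  have "0 \<le> (f c - f a) * (f d - f b) - y * ((f d - f c) * (f b - f a))"
    using det[of f] by linarith
  then have "y * ((f d - f c) * (f b - f a)) \<le> (f c - f a) * (f d - f b)" by linarith
  note * = this[unfolded y_def times_divide_eq_left]
  have "0 < (d - c) * (b - a)" using less by simp
  note *[unfolded pos_divide_le_eq[OF this]]
  then have "(c - a) * (d - b) * ((f d - f c) * (f b - f a)) \<le> (f c - f a) * (f d - f b) * ((d - c) * (b - a))" .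
  \<comment> \<open>\<open>e1\<close> and \<open>e2\<close> are one identity among four numbers, for
    the values of \<open>f\<close> and for the points themselves. It splits a product on each side,
    after which a common term cancels.\<close>
  moreover have e1: "(f d - f c) * (f b - f a) = (f c - f a) * (f d - f b) + (f d - f a) * (f b - f c)"
    by (simp add: algebra_simps)
  moreover have e2: "(d - c) * (b - a) = (c - a) * (d - b) + (d - a) * (b - c)"
    by (simp add: algebra_simps)
  moreover have "u * (p + n) \<le> p * (u + v) \<Longrightarrow> n * u \<le> p * v" for u p n v :: real
    by (simp add: algebra_simps)
  ultimately have *: "((f d - f a) * (f b - f c)) * ((c - a) * (d - b)) \<le> ((f c - f a) * (f d - f b)) * ((d - a) * (b - c))"
    by (simp only: e1 e2)
  have P: "0 < (d - a) * (b - c)" and Q: "0 < (c - a) * (d - b)" using less by simp_all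
  have "((f d - f a) * (f b - f c)) / ((d - a) * (b - c)) \<le> ((f c - f a) * (f d - f b)) / ((c - a) * (d - b))"
    unfolding pos_divide_le_eq[OF P] times_divide_eq_left pos_le_divide_eq[OF Q] by (rule *)
  then show ?thesis by simp
qed

section \<open>Concavity and continuity from the divided-difference inequality\<close>

definition slope :: "(real \<Rightarrow> real) \<Rightarrow> real \<Rightarrow> real \<Rightarrow> real" where
  "slope f a b = (f b - f a) / (b - a)"

lemma slope_split:
  assumes "a < b" "b < c"
  shows "(c - a) * slope f a c = (b - a) * slope f a b + (c - b) * slope f b c"
  using assms by (simp add: slope_def)

lemma slope_eq: "a \<noteq> b \<Longrightarrow> f b = f a + slope f a b * (b - a)"
  by (simp add: slope_def)

text \<open>\<open>cross\<close> is what is kept of operator monotonicity on matrices of size two.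
  The value at \<open>0\<close> is tied to \<open>f\<close> by continuity, since spectra may contain
  \<open>0\<close>.\<close>

locale mean_function =
  fixes f :: "real \<Rightarrow> real"
  assumes pos: "0 < t \<Longrightarrow> 0 < f t"
    and one: "f 1 = 1"
    and lim0: "(f \<longlongrightarrow> f 0) (at_right 0)"
    and mono: "0 < s \<Longrightarrow> s \<le> t \<Longrightarrow> f s \<le> f t"
    and cross: "0 < a \<Longrightarrow> a < c \<Longrightarrow> c < b \<Longrightarrow> b < d \<Longrightarrow>
      slope f a d * slope f c b \<le> slope f a c * slope f b d"
begin

lemma slope_nonneg: "0 < a \<Longrightarrow> a < b \<Longrightarrow> 0 \<le> slope f a b"
  using mono[of a b] by (simp add: slope_def)

text \<open>Concavity arises from \<open>cross\<close> with \<open>d\<close> far away: by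
  monotonicity \<open>f d - f b\<close> is at most \<open>f d - f a\<close>, so \<open>cross\<close>
  yields \<open>t * (d - b) <= s * (d - a)\<close> for the slopes \<open>s\<close> on the left and
  \<open>t\<close> on the right. For large \<open>d\<close> this contradicts
  \<open>s < t\<close>.\<close>

lemma slope_decreasing:
  assumes "0 < a" "a < c" "c < b"
  shows "slope f c b \<le> slope f a c"
proof (rule ccontr)
  define s where "s = slope f a c"
  define t where "t = slope f c b"
  assume "\<not> ?thesis"
  then have st: "s < t" by (simp add: s_def t_def)
  have "0 \<le> s" using assms by (simp add: s_def slope_nonneg)
  \<comment> \<open>Beyond \<open>(t * b - s * a) / (t - s)\<close> the final linear inequality in
    \<open>d\<close> fails; the absolute value keeps \<open>d\<close> to the right of
    \<open>b\<close>.\<close>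
  define m where "m = \<bar>t * b - s * a\<bar> / (t - s)"
  define d where "d = b + 1 + m"
  have "0 \<le> m" using st by (simp add: m_def)
  then have d: "b < d" "m < d" using assms by (auto simp: d_def)
  have "f b = f c + t * (b - c)" unfolding t_def using assms by (intro slope_eq) auto
  moreover have "0 < t * (b - c)" using st \<open>0 \<le> s\<close> assms by simp
  moreover have "f a \<le> f c" "f b \<le> f d" using assms d by (auto intro!: mono)
  ultimately have F: "0 < f d - f a" by linarith
  have "slope f a d * t \<le> s * slope f b d" unfolding s_def t_def using assms d by (intro cross)
  also have "\<dots> \<le> s * ((f d - f a) / (d - b))"
    unfolding slope_def using \<open>0 \<le> s\<close> d mono[of a b] assms
    by (intro mult_left_mono divide_right_mono) auto
  finally have "(f d - f a) * t / (d - a) \<le> (f d - f a) * s / (d - b)"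
    by (simp add: slope_def mult.commute)
  then have "(f d - f a) * t * (d - b) \<le> (f d - f a) * s * (d - a)"
    using d assms by (simp add: divide_le_eq le_divide_eq split: if_splits)
  then have "(f d - f a) * (t * (d - b)) \<le> (f d - f a) * (s * (d - a))" by (simp add: ac_simps)
  then have "t * (d - b) \<le> s * (d - a)" using F by (simp only: mult_le_cancel_left_pos)
  then have "(t - s) * d \<le> t * b - s * a" by (simp add: algebra_simps)
  then have "d \<le> (t * b - s * a) / (t - s)" using st by (simp add: le_divide_eq mult.commute)
  also have "\<dots> \<le> m" unfolding m_def using st by (intro divide_right_mono) auto
  finally show False using d by simp
qed

lemma slope_decreasing':
  assumes "0 < a" "a < b" "b \<le> s" "s < t"
  shows "slope f s t \<le> slope f a b"
proof (cases "b = s")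
  case True
  then show ?thesis using assms slope_decreasing[of a b t] by simp
next
  case False
  then show ?thesis using assms slope_decreasing[of a b s] slope_decreasing[of b s t] by simp
qed

lemma slope_le_left: "0 < a \<Longrightarrow> a < b \<Longrightarrow> b < c \<Longrightarrow> slope f a c \<le> slope f a b"
proof -
  assume *: "0 < a" "a < b" "b < c"
  have "(c - a) * slope f a c = (b - a) * slope f a b + (c - b) * slope f b c"
    using * by (intro slope_split)
  also have "\<dots> \<le> (b - a) * slope f a b + (c - b) * slope f a b"
    using * slope_decreasing[of a b c] by (intro add_left_mono mult_left_mono) auto
  also have "\<dots> = (c - a) * slope f a b" by (simp add: algebra_simps)
  finally show ?thesis using * by simp
qed

lemma slope_le_right: "0 < a \<Longrightarrow> a < b \<Longrightarrow> b < c \<Longrightarrow> slope f b c \<le> slope f a c"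
proof -
  assume *: "0 < a" "a < b" "b < c"
  have "(c - a) * slope f b c = (b - a) * slope f b c + (c - b) * slope f b c"
    by (simp add: algebra_simps)
  also have "\<dots> \<le> (b - a) * slope f a b + (c - b) * slope f b c"
    using * slope_decreasing[of a b c] by (intro add_right_mono mult_left_mono) auto
  also have "\<dots> = (c - a) * slope f a c"
    using * by (intro slope_split[symmetric])
  finally show ?thesis using * by simp
qed

text \<open>By concavity all slopes to the right of \<open>x / 2\<close> lie between
  \<open>0\<close> and the slope over \<open>{x / 4..x / 2}\<close>, so \<open>f\<close> is
  Lipschitz around \<open>x\<close>.\<close>

lemma isCont:
  assumes "0 < x"
  shows "isCont f x"
proof -
  define L where "L = slope f (x / 4) (x / 2)"
  have bound: "\<bar>f t - f s\<bar> \<le> L * \<bar>t - s\<bar>" if "x / 2 \<le> s" "s < t" for s t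
  proof -
    have "slope f s t \<le> L" "0 \<le> slope f s t"
      unfolding L_def using that assms by (auto intro: slope_decreasing' slope_nonneg)
    moreover have "f t - f s = slope f s t * (t - s)" using that slope_eq[of s t f] by simp
    ultimately show ?thesis using that by (simp add: abs_mult mult_right_mono)
  qed
  have "\<forall>\<^sub>F t in at x. t \<in> {x / 2<..} - {x}" using assms by (intro eventually_at_in_open) auto
  then have near: "\<forall>\<^sub>F t in at x. \<bar>f t - f x\<bar> \<le> L * \<bar>t - x\<bar>"
  proof eventually_elim
    case (elim t)
    then show ?case using bound[of x t] bound[of t x] assms
      by (cases "t < x") (auto simp: abs_minus_commute)
  qed
  have "((\<lambda>t. L * \<bar>t - x\<bar>) \<longlongrightarrow> L * \<bar>x - x\<bar>) (at x)" by (intro tendsto_intros)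
  then have "((\<lambda>t. L * \<bar>t - x\<bar>) \<longlongrightarrow> 0) (at x)" by simp
  then have "((\<lambda>t. f t - f x) \<longlongrightarrow> 0) (at x)"
    by (rule Lim_null_comparison[rotated]) (use near in simp)
  then show ?thesis unfolding isCont_def by (simp add: LIM_zero_iff)
qed

lemma continuous_on_nonneg: "continuous_on {0..} f"
  unfolding continuous_on_def
proof
  fix x :: real assume "x \<in> {0..}"
  show "(f \<longlongrightarrow> f x) (at x within {0..})"
  proof (cases "x = 0")
    case True
    have "{0..} - {0} = {0<..} - {0::real}" by auto
    then have "at 0 within {0..} = (at_right 0 :: real filter)" by (simp add: at_within_def)
    then show ?thesis using lim0 True by simp
  next
    case False
    then have "isCont f x" using \<open>x \<in> {0..}\<close> by (intro isCont) simp
    then show ?thesis unfolding isCont_def by (rule tendsto_within_subset) simp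
  qed
qed

lemma le_at_zero:
  assumes "\<And>t. 0 < t \<Longrightarrow> f t \<le> g t" "isCont g 0"
  shows "f 0 \<le> g 0"
proof (rule tendsto_le[OF _ _ lim0])
  show "(g \<longlongrightarrow> g 0) (at_right 0)"
    using assms(2) unfolding isCont_def by (rule tendsto_within_subset) simp
  show "\<forall>\<^sub>F x in at_right 0. f x \<le> g x"
    using eventually_at_right_less[of 0] by eventually_elim (rule assms(1))
qed simp

lemma nonneg: "0 \<le> t \<Longrightarrow> 0 \<le> f t"
proof (cases "t = 0")
  case True
  have "\<forall>\<^sub>F x in at_right 0. 0 \<le> f x"
    using eventually_at_right_less[of 0] by eventually_elim (simp add: pos less_imp_le)
  then show ?thesis using True tendsto_lowerbound[OF lim0] by simp
next
  case False
  assume "0 \<le> t"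
  then show ?thesis using False pos[of t] by simp
qed

section \<open>The derivative at 1\<close>

text \<open>By concavity this infimum is the left derivative at \<open>1\<close>. It is available
  before differentiability is known; \<open>deriv_one\<close> shows that it is the derivative, hence
  the weight of the mean.\<close>

definition r :: real where
  "r = (INF a\<in>{0<..<1}. slope f a 1)"

lemma bdd_slopes: "bdd_below ((\<lambda>a. slope f a 1) ` {0<..<1})"
  by (rule bdd_belowI[of _ 0]) (auto intro: slope_nonneg)

lemma r_le_slope: "0 < a \<Longrightarrow> a < 1 \<Longrightarrow> r \<le> slope f a 1"
  unfolding r_def using bdd_slopes by (intro cINF_lower) auto

lemma slope_le_r: "1 < d \<Longrightarrow> slope f 1 d \<le> r"
  unfolding r_def by (rule cINF_greatest) (auto intro: slope_decreasing)

lemma r_nonneg: "0 \<le> r"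
  using slope_le_r[of 2] slope_nonneg[of 1 2] by simp

lemma slope_lt_r: "0 < e \<Longrightarrow> \<exists>a. 0 < a \<and> a < 1 \<and> slope f a 1 < r + e"
proof -
  assume "0 < e"
  then have "(INF a\<in>{0<..<1}. slope f a 1) < r + e" by (simp add: r_def)
  then show ?thesis by (subst (asm) cINF_less_iff) (auto simp: bdd_slopes)
qed

lemma tendsto_slope_right: "0 < x \<Longrightarrow> x \<noteq> a \<Longrightarrow> ((\<lambda>y. slope f a y) \<longlongrightarrow> slope f a x) (at x within S)"
  unfolding slope_def using isCont[of x]
  by (intro tendsto_intros) (auto simp: isCont_def intro: tendsto_within_subset)

lemma tendsto_slope_left: "0 < x \<Longrightarrow> x \<noteq> b \<Longrightarrow> ((\<lambda>y. slope f y b) \<longlongrightarrow> slope f x b) (at x within S)"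
  unfolding slope_def using isCont[of x]
  by (intro tendsto_intros) (auto simp: isCont_def intro: tendsto_within_subset)

text \<open>The inequalities obtained from \<open>cross\<close> when two of the four points merge at \<open>1\<close>.\<close>

lemma cross_middle:
  assumes "0 < a" "a < 1" "1 < d"
  shows "slope f a d * r \<le> slope f a 1 * slope f 1 d"
proof (rule tendsto_lowerbound)
  show "((\<lambda>c. slope f a c * slope f 1 d) \<longlongrightarrow> slope f a 1 * slope f 1 d) (at_left 1)"
    using assms by (intro tendsto_intros tendsto_slope_right) auto
  show "\<forall>\<^sub>F c in at_left 1. slope f a d * r \<le> slope f a c * slope f 1 d"
    using eventually_at_left_real[OF assms(2)]
  proof eventually_elim
    case (elim c)
    have "slope f a d * r \<le> slope f a d * slope f c 1"
      using elim assms by (intro mult_left_mono r_le_slope slope_nonneg) auto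
    also have "\<dots> \<le> slope f a c * slope f 1 d" using elim assms by (intro cross) auto
    finally show ?case .
  qed
qed simp

lemma cross_right:
  assumes "1 < b" "b < d"
  shows "slope f 1 d * slope f 1 b \<le> r * slope f b d"
proof (rule tendsto_upperbound)
  show "((\<lambda>c. slope f 1 d * slope f c b) \<longlongrightarrow> slope f 1 d * slope f 1 b) (at_right 1)"
    using assms by (intro tendsto_intros tendsto_slope_left) auto
  show "\<forall>\<^sub>F c in at_right 1. slope f 1 d * slope f c b \<le> r * slope f b d"
    using eventually_at_right_real[OF assms(1)]
  proof eventually_elim
    case (elim c)
    have "slope f 1 d * slope f c b \<le> slope f 1 c * slope f b d" using elim assms by (intro cross) auto
    also have "\<dots> \<le> r * slope f b d"
      using elim assms by (intro mult_right_mono slope_le_r slope_nonneg) auto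
    finally show ?case .
  qed
qed simp

text \<open>There is no corner at \<open>1\<close>: if every right slope were at most
  \<open>r - e\<close>, then \<open>cross_middle\<close> with \<open>d\<close> tending to
  \<open>1\<close> would give \<open>slope f a 1 * r <= slope f a 1 * (r - e)\<close>. So no left
  slope is positive and \<open>r\<close> is at most \<open>0\<close>, which the nonnegative right
  slopes exclude.\<close>

lemma slope_gt_r:
  assumes "0 < e"
  shows "\<exists>d>1. r - e < slope f 1 d"
proof (rule ccontr)
  assume "\<not> ?thesis"
  then have le: "slope f 1 d \<le> r - e" if "1 < d" for d using that by force
  have "r \<le> r - e" if "0 < a" "a < 1" "slope f a 1 > 0" for a
  proof -
    have "slope f a 1 * r \<le> slope f a 1 * (r - e)"
    proof (rule tendsto_upperbound)
      show "((\<lambda>d. slope f a d * r) \<longlongrightarrow> slope f a 1 * r) (at_right 1)"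
        using that by (intro tendsto_intros tendsto_slope_right) auto
      show "\<forall>\<^sub>F d in at_right 1. slope f a d * r \<le> slope f a 1 * (r - e)"
        using eventually_at_right_less[of 1]
      proof eventually_elim
        case (elim d)
        have "slope f a d * r \<le> slope f a 1 * slope f 1 d" using elim that by (intro cross_middle)
        also have "\<dots> \<le> slope f a 1 * (r - e)" using elim that by (intro mult_left_mono le) auto
        finally show ?case .
      qed
    qed simp
    then show ?thesis using that by simp
  qed
  from this[of "1/2"] have "slope f (1/2) 1 \<le> 0" using assms by (cases "0 < slope f (1/2) 1") auto
  then have "r \<le> 0" using r_le_slope[of "1/2"] by simp
  then show False using le[of 2] slope_nonneg[of 1 2] assms by simp
qed

lemma deriv_one: "(f has_real_derivative r) (at 1)"
  unfolding has_field_derivative_iff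
proof (rule tendstoI)
  fix e :: real assume "0 < e"
  obtain a where a: "0 < a" "a < 1" "slope f a 1 < r + e" using slope_lt_r[OF \<open>0 < e\<close>] by blast
  obtain d where d: "1 < d" "r - e < slope f 1 d" using slope_gt_r[OF \<open>0 < e\<close>] by blast
  have "\<forall>\<^sub>F y in at 1. y \<in> {a<..<d} - {1}"
    using a d by (intro eventually_at_in_open) auto
  then show "\<forall>\<^sub>F y in at 1. dist ((f y - f 1) / (y - 1)) r < e"
  proof eventually_elim
    case (elim y)
    show ?case
    proof (cases "y < 1")
      case True
      have "(f y - f 1) / (y - 1) = slope f y 1"
        unfolding slope_def by (metis minus_diff_eq minus_divide_divide)
      moreover have "slope f y 1 \<le> slope f a 1" using elim True a by (intro slope_le_right) auto
      moreover have "r \<le> slope f y 1" using elim True a by (intro r_le_slope) auto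
      ultimately show ?thesis using a by (simp add: dist_real_def)
    next
      case False
      have "slope f 1 d \<le> slope f 1 y" using elim False d by (intro slope_le_left) auto
      moreover have "slope f 1 y \<le> r" using elim False by (intro slope_le_r) auto
      ultimately show ?thesis using d by (simp add: dist_real_def slope_def)
    qed
  qed
qed

section \<open>The gap below the tangent line at 1\<close>

text \<open>Bounds on slopes become quadratic after multiplication by the distance to
  \<open>1\<close>. The gap cannot outgrow a linear function because \<open>f\<close> is
  nonnegative, hence the denominator \<open>1 + t\<close>; left of \<open>1\<close> it only weakens
  the bound.\<close>

lemma le_tangent_plus:
  assumes "\<And>t. 0 < t \<Longrightarrow> t < 1 \<Longrightarrow> r + (1 - t) * k \<le> slope f t 1"
    "\<And>t. 1 < t \<Longrightarrow> slope f 1 t \<le> r - (t - 1) * k / (1 + t)" "0 \<le> k" "0 \<le> t"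
  shows "f t \<le> 1 + r * (t - 1) - k * ((t - 1)\<^sup>2 / (1 + t))"
proof -
  have *: "f t \<le> 1 + r * (t - 1) - k * ((t - 1)\<^sup>2 / (1 + t))" if "0 < t" for t
  proof -
    consider "t < 1" | "t = 1" | "t > 1" by linarith
    then show ?thesis
    proof cases
      case 1
      have "(1 - t) * (r + (1 - t) * k) \<le> (1 - t) * slope f t 1"
        using 1 that by (intro mult_left_mono assms) auto
      moreover have "f t = 1 - (1 - t) * slope f t 1" using 1 by (simp add: slope_def one)
      moreover have "k * ((t - 1)\<^sup>2 / (1 + t)) \<le> k * ((t - 1)\<^sup>2 / 1)"
        using that assms(3) by (intro mult_left_mono divide_left_mono) auto
      ultimately show ?thesis by (simp add: algebra_simps power2_eq_square)
    next
      case 2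
      then show ?thesis by (simp add: one)
    next
      case 3
      have "(t - 1) * slope f 1 t \<le> (t - 1) * (r - (t - 1) * k / (1 + t))"
        using 3 that by (intro mult_left_mono assms) auto
      also have "\<dots> = r * (t - 1) - k * ((t - 1)\<^sup>2 / (1 + t))"
        by (simp only: right_diff_distrib[of "t - 1" r] power2_eq_square times_divide_eq_right mult_ac)
      moreover have "f t = 1 + (t - 1) * slope f 1 t" using 3 by (simp add: slope_def one)
      ultimately show ?thesis by simp
    qed
  qed
  have "f 0 \<le> 1 + r * (0 - 1) - k * ((0 - 1)\<^sup>2 / (1 + 0))"
    by (rule le_at_zero[OF *]) (auto intro!: continuous_intros)
  with * assms(4) show ?thesis by (cases "t = 0") auto
qed

lemma le_tangent: "0 \<le> t \<Longrightarrow> f t \<le> 1 + r * (t - 1)"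
  using le_tangent_plus[of 0 t] r_le_slope slope_le_r by simp

lemma r_le_one: "r \<le> 1"
  using le_tangent[of 0] nonneg[of 0] by simp

text \<open>With the slopes written as \<open>r + k\<close> and \<open>r - l\<close>,
  \<open>cross_middle\<close> becomes
  \<open>k * l * (d - a) <= r * ((d - 1) * k - (1 - a) * l)\<close>, and its left side is
  nonnegative. So a gap on the right of \<open>1\<close> forces one on the left, in proportion to
  the distances.\<close>

lemma gap_left:
  assumes "0 < r" "0 < a" "a < 1" "1 < d"
  shows "(r - slope f 1 d) * (1 - a) \<le> (slope f a 1 - r) * (d - 1)"
proof -
  define k where "k = slope f a 1 - r"
  define l where "l = r - slope f 1 d"
  have kl: "0 \<le> k" "0 \<le> l" using assms by (auto simp: k_def l_def r_le_slope slope_le_r)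
  have eqs: "slope f a 1 = r + k" "slope f 1 d = r - l" by (auto simp: k_def l_def)
  have "(d - a) * (slope f a d * r) \<le> (d - a) * (slope f a 1 * slope f 1 d)"
    using assms by (intro mult_left_mono cross_middle) auto
  moreover have "(d - a) * slope f a d = (1 - a) * (r + k) + (d - 1) * (r - l)"
    using slope_split[of a 1 d f] assms by (simp add: eqs)
  ultimately have "r * ((1 - a) * (r + k) + (d - 1) * (r - l)) \<le> (d - a) * ((r + k) * (r - l))"
    by (simp add: eqs mult.commute mult.left_commute)
  then have "k * l * (d - a) \<le> r * ((d - 1) * k - (1 - a) * l)" by (simp add: algebra_simps)
  moreover have "0 \<le> k * l * (d - a)" using kl assms by simp
  ultimately have "0 \<le> r * ((d - 1) * k - (1 - a) * l)" by linarith
  then have "0 \<le> (d - 1) * k - (1 - a) * l" using assms by (simp add: zero_le_mult_iff)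
  then show ?thesis by (simp add: k_def l_def mult.commute)
qed

text \<open>The same computation with \<open>cross_right\<close>: the deficit of the slope per unit
  of distance from \<open>1\<close> decreases to the right.\<close>

lemma gap_right:
  assumes "0 < r" "1 < b" "b < d"
  shows "(r - slope f 1 d) * (b - 1) \<le> (r - slope f 1 b) * (d - 1)"
proof -
  define k where "k = r - slope f 1 b"
  define l where "l = r - slope f 1 d"
  have kl: "0 \<le> k" "0 \<le> l" using assms by (auto simp: k_def l_def slope_le_r)
  have eqs: "slope f 1 b = r - k" "slope f 1 d = r - l" by (auto simp: k_def l_def)
  have "(d - b) * (slope f 1 d * slope f 1 b) \<le> (d - b) * (r * slope f b d)"
    using assms by (intro mult_left_mono cross_right) auto
  moreover have "(d - b) * slope f b d = (d - 1) * (r - l) - (b - 1) * (r - k)"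
    using slope_split[of 1 b d f] assms by (simp add: eqs)
  ultimately have "(d - b) * ((r - l) * (r - k)) \<le> r * ((d - 1) * (r - l) - (b - 1) * (r - k))"
    by (simp add: eqs mult.left_commute)
  then have "k * l * (d - b) \<le> r * ((d - 1) * k - (b - 1) * l)" by (simp add: algebra_simps)
  moreover have "0 \<le> k * l * (d - b)" using kl assms by simp
  ultimately have "0 \<le> r * ((d - 1) * k - (b - 1) * l)" by linarith
  then have "0 \<le> (d - 1) * k - (b - 1) * l" using assms by (simp add: zero_le_mult_iff)
  then show ?thesis by (simp add: k_def l_def mult.commute)
qed

text \<open>The gap at \<open>2\<close> is spread to the left of \<open>1\<close> by
  \<open>gap_left\<close>, to the points between \<open>1\<close> and \<open>2\<close> by
  \<open>gap_right\<close>, and beyond \<open>2\<close> by concavity.\<close>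

lemma quadratic_gap:
  assumes "0 < r" "f 2 < 1 + r"
  obtains k where "0 < k" "\<And>t. 0 \<le> t \<Longrightarrow> f t \<le> 1 + r * (t - 1) - k * ((t - 1)\<^sup>2 / (1 + t))"
proof
  define k where "k = r - slope f 1 2"
  show "0 < k" using assms by (simp add: k_def slope_def one)
  show "f t \<le> 1 + r * (t - 1) - k * ((t - 1)\<^sup>2 / (1 + t))" if "0 \<le> t" for t
  proof (rule le_tangent_plus)
    show "r + (1 - t) * k \<le> slope f t 1" if "0 < t" "t < 1" for t
      using gap_left[OF assms(1) that, of 2] by (simp add: k_def mult.commute)
    show "slope f 1 t \<le> r - (t - 1) * k / (1 + t)" if "1 < t" for t
    proof (cases "t < 2")
      case True
      have "(t - 1) * k / (1 + t) \<le> (t - 1) * k / 1"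
        using that \<open>0 < k\<close> by (intro divide_left_mono) auto
      then show ?thesis using gap_right[OF assms(1) that True] by (simp add: k_def mult.commute)
    next
      case False
      have "slope f 1 t \<le> slope f 1 2"
        using False slope_le_left[of 1 2 t] by (cases "t = 2") auto
      moreover have "(t - 1) * k / (1 + t) \<le> k" using that \<open>0 < k\<close> by (simp add: divide_le_eq)
      ultimately show ?thesis by (simp add: k_def)
    qed
  qed (use \<open>0 < k\<close> that in auto)
qed

lemma eq_at_zero:
  assumes "\<And>t. 0 < t \<Longrightarrow> f t = g t" "isCont g 0"
  shows "f 0 = g 0"
proof (rule tendsto_unique[OF _ lim0])
  have "(g \<longlongrightarrow> g 0) (at_right 0)"
    using assms(2) unfolding isCont_def by (rule tendsto_within_subset) simp
  then show "(f \<longlongrightarrow> g 0) (at_right 0)"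
    by (rule Lim_transform_eventually)
      (use eventually_at_right_less[of 0] in \<open>eventually_elim, simp add: assms(1)\<close>)
qed simp

text \<open>The degenerate slopes, here and in \<open>id_if_r_one\<close>, force trivial means; this
  is what places the weight of a non-trivial mean strictly inside the unit interval.\<close>

lemma const_if_r_zero:
  assumes "r = 0" "0 \<le> t"
  shows "f t = 1"
proof -
  have right: "f d = 1" if "1 < d" for d
  proof -
    have "slope f 1 d = 0" using slope_le_r[OF that] slope_nonneg[of 1 d] that assms by simp
    then show ?thesis using that by (simp add: slope_def one)
  qed
  have left: "f c = 1" if "0 < c" "c < 1" for c
  proof -
    \<comment> \<open>As \<open>f\<close> is constant on the right of \<open>1\<close>, the last
      slope in \<open>cross\<close> at \<open>c / 2 < c < 1 < 2\<close> vanishes, so one of the two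
      slopes on the left side is \<open>0\<close>; either one gives \<open>f c = 1\<close>.\<close>
    have "slope f (c / 2) 2 * slope f c 1 \<le> slope f (c / 2) c * slope f 1 2"
      using that by (intro cross) auto
    also have "\<dots> = 0" by (simp add: slope_def right one)
    finally have "slope f (c / 2) 2 * slope f c 1 \<le> 0" .
    moreover have "0 \<le> slope f (c / 2) 2 * slope f c 1"
      using that by (intro mult_nonneg_nonneg slope_nonneg) auto
    ultimately have "slope f (c / 2) 2 * slope f c 1 = 0" by (rule antisym)
    then have "slope f (c / 2) 2 = 0 \<or> slope f c 1 = 0" by simp
    then show ?thesis
    proof
      assume "slope f (c / 2) 2 = 0"
      then have "f 2 = f (c / 2)" using slope_eq[of "c / 2" 2 f] that by simp
      then have "f (c / 2) = 1" using right[of 2] by simp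
      then show ?thesis using mono[of "c / 2" c] mono[of c 1] that one by simp
    next
      assume "slope f c 1 = 0"
      then show ?thesis using that by (simp add: slope_def one)
    qed
  qed
  have "f t = 1" if "0 < t" for t
    using left[of t] right[of t] one that by (cases t "1::real" rule: linorder_cases) auto
  moreover from this have "f 0 = 1" by (intro eq_at_zero[where g = "\<lambda>_. 1"]) auto
  ultimately show ?thesis using assms by (cases "t = 0") auto
qed

lemma id_if_r_one:
  assumes "r = 1" "0 \<le> t"
  shows "f t = t"
proof -
  have left: "f a = a" if "0 < a" "a < 1" for a
  proof -
    \<comment> \<open>Concavity on \<open>e < a < 1\<close> together with \<open>f e > 0\<close>; as
      \<open>e\<close> tends to \<open>0\<close> it becomes \<open>a <= f a\<close>, the converse of
      the tangent bound.\<close>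
    have ineq: "(1 - f a) * (a - e) \<le> f a * (1 - a)" if "0 < e" "e < a" for e
    proof -
      have "(1 - f a) / (1 - a) \<le> (f a - f e) / (a - e)"
        using slope_decreasing[of e a 1] that \<open>a < 1\<close> by (simp add: slope_def one)
      also have "\<dots> \<le> f a / (a - e)" using that pos[of e] by (intro divide_right_mono) auto
      finally show ?thesis using that \<open>a < 1\<close> by (simp add: divide_le_eq le_divide_eq split: if_splits)
    qed
    have "((\<lambda>e. (1 - f a) * (a - e)) \<longlongrightarrow> (1 - f a) * (a - 0)) (at_right 0)" by (intro tendsto_intros)
    then have "(1 - f a) * (a - 0) \<le> f a * (1 - a)"
      by (rule tendsto_upperbound)
        (use eventually_at_right_real[OF that(1)] in \<open>eventually_elim, auto intro: ineq\<close>)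
    then have "a \<le> f a" by (simp add: algebra_simps)
    then show ?thesis using le_tangent[of a] assms that by simp
  qed
  have right: "f d = d" if "1 < d" for d
  proof -
    have "(1 - slope f 1 d) * (1 - 1 / 2) \<le> (slope f (1/2) 1 - 1) * (d - 1)"
      using gap_left[of "1/2" d] that assms by simp
    also have "\<dots> = 0" by (simp add: slope_def left one)
    finally have "1 \<le> slope f 1 d" by simp
    then have "d \<le> f d" using that by (simp add: slope_def one le_divide_eq)
    then show ?thesis using le_tangent[of d] assms that by simp
  qed
  have "f t = t" if "0 < t" for t
    using left[of t] right[of t] one that by (cases t "1::real" rule: linorder_cases) auto
  moreover from this have "f 0 = 0" by (intro eq_at_zero[where g = "\<lambda>t. t"]) auto
  ultimately show ?thesis using assms by (cases "t = 0") auto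
qed

end

lemma representing_mean_function:
  assumes "representing_function \<sigma> f"
  shows "mean_function f"
  using assms operator_monotone_mono[of f] operator_monotone_cross[of f]
  by unfold_locales (auto simp: representing_function_def slope_def)

section \<open>Functional calculus for symmetric operators\<close>

text \<open>Spectra are taken among real-linear operators, so the real part of the inner product suffices
  for the spectral theory.\<close>

definition ip :: "'a::complex_hilbert_space \<Rightarrow> 'a \<Rightarrow> real" where
  "ip x y = Re (cinner x y)"

lemma ip_add_left: "ip (x + y) z = ip x z + ip y z"
  by (simp add: ip_def cinner_add_left)

lemma ip_commute: "ip x y = ip y x"
  unfolding ip_def by (subst cinner_commute) simp

lemma ip_scaleR_left: "ip (r *\<^sub>R x) y = r * ip x y"
  by (simp add: ip_def scaleR_scaleC cinner_scaleC_left)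

lemma ip_self: "ip x x = (norm x)\<^sup>2"
  by (simp add: ip_def cinner_self)

lemma ip_add_right: "ip x (y + z) = ip x y + ip x z"
  by (simp add: ip_commute[of x] ip_add_left)

lemma ip_scaleR_right: "ip x (r *\<^sub>R y) = r * ip x y"
  by (simp add: ip_commute[of x] ip_scaleR_left)

lemma ip_minus_left: "ip (- x) y = - ip x y"
  using ip_scaleR_left[of "-1" x y] by simp

lemma ip_minus_right: "ip x (- y) = - ip x y"
  by (simp add: ip_commute[of x] ip_minus_left)

lemma ip_diff_left: "ip (x - y) z = ip x z - ip y z"
  using ip_add_left[of x "- y" z] by (simp add: ip_minus_left)

lemma ip_diff_right: "ip x (y - z) = ip x y - ip x z"
  by (simp add: ip_commute[of x] ip_diff_left)

lemma ip_zero [simp]: "ip 0 y = 0" "ip x 0 = 0"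
  using ip_scaleR_left[of 0] ip_scaleR_right[of _ 0] by auto

lemmas ip_simps = ip_add_left ip_add_right ip_diff_left ip_diff_right ip_minus_left ip_minus_right
  ip_scaleR_left ip_scaleR_right

text \<open>It serves Cauchy-Schwarz and, in \<open>strict_gap\<close>, the optimization over a
  family of affine bounds; forms may vanish, so \<open>c = 0\<close> is included.\<close>

lemma quadratic_nonneg_discrim:
  fixes a b c :: real
  assumes "\<And>t. 0 \<le> a + 2 * b * t + c * t\<^sup>2" "0 \<le> c"
  shows "b\<^sup>2 \<le> a * c"
proof (cases "c = 0")
  case True
  have "b = 0"
  proof (rule ccontr)
    assume "b \<noteq> 0"
    \<comment> \<open>At this argument the polynomial has the value \<open>- 1\<close>.\<close>
    then show False using assms(1)[of "- (a + 1) / (2 * b)"] True by simp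
  qed
  then show ?thesis using True by simp
next
  case False
  then have "c > 0" using assms by simp
  have "0 \<le> a + 2 * b * (- b / c) + c * (- b / c)\<^sup>2" using assms(1) .
  also have "\<dots> = a - b\<^sup>2 / c" using False by (simp add: power2_eq_square field_simps)
  finally show ?thesis using \<open>c > 0\<close> by (simp add: field_simps)
qed

lemma ip_bound: "\<bar>ip x y\<bar> \<le> norm x * norm y"
proof -
  have "0 \<le> (norm x)\<^sup>2 + 2 * ip x y * t + (norm y)\<^sup>2 * t\<^sup>2" for t
  proof -
    have "0 \<le> ip (x + t *\<^sub>R y) (x + t *\<^sub>R y)" by (simp add: ip_self)
    also have "\<dots> = ip x x + 2 * ip x y * t + ip y y * t\<^sup>2"
      by (simp add: ip_simps ip_commute[of y x] power2_eq_square algebra_simps)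
    finally show ?thesis by (simp add: ip_self)
  qed
  from quadratic_nonneg_discrim[OF this] have "(ip x y)\<^sup>2 \<le> (norm x * norm y)\<^sup>2"
    by (simp add: power_mult_distrib)
  then show ?thesis
    using abs_le_square_iff[of "ip x y" "norm x * norm y"] by simp
qed

lemma bounded_bilinear_ip: "bounded_bilinear (ip :: 'a::complex_hilbert_space \<Rightarrow> 'a \<Rightarrow> real)"
proof
  show "\<exists>K. \<forall>a b. norm (ip (a::'a) b) \<le> norm a * norm b * K"
    by (intro exI[of _ 1]) (simp add: ip_bound)
qed (simp_all add: ip_simps)

lemmas tendsto_ip = bounded_bilinear.tendsto[OF bounded_bilinear_ip]

section \<open>Symmetric operators and their quadratic forms\<close>

definition qf :: "'a::complex_hilbert_space op \<Rightarrow> 'a \<Rightarrow> real" where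
  "qf A x = ip (A x) x"

definition sym_op :: "'a::complex_hilbert_space op \<Rightarrow> bool" where
  "sym_op A \<longleftrightarrow> (\<forall>x y. ip (A x) y = ip x (A y))"

lemma sym_opD: "sym_op A \<Longrightarrow> ip (A x) y = ip x (A y)"
  by (simp add: sym_op_def)

lemma sym_op_add: "sym_op A \<Longrightarrow> sym_op B \<Longrightarrow> sym_op (A + B)"
  and sym_op_diff: "sym_op A \<Longrightarrow> sym_op B \<Longrightarrow> sym_op (A - B)"
  and sym_op_scaleR: "sym_op A \<Longrightarrow> sym_op (r *\<^sub>R A)"
  and sym_op_id: "sym_op id_blinfun"
  by (auto simp: sym_op_def blinfun.bilinear_simps ip_simps)

lemma sym_op_scalar: "sym_op (scalar_op t)"
  by (simp add: scalar_op_def sym_op_scaleR sym_op_id)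

lemmas sym_op_intros = sym_op_add sym_op_diff sym_op_scaleR sym_op_id sym_op_scalar

lemma qf_simps:
  "qf (A + B) x = qf A x + qf B x"
  "qf (A - B) x = qf A x - qf B x"
  "qf (r *\<^sub>R A) x = r * qf A x"
  "qf id_blinfun x = (norm x)\<^sup>2"
  "qf (scalar_op t) x = t * (norm x)\<^sup>2"
  by (simp_all add: qf_def blinfun.bilinear_simps ip_simps ip_self scalar_op_def)

lemma qf_scaleR_arg: "qf A (r *\<^sub>R x) = r\<^sup>2 * qf A x"
  by (simp add: qf_def blinfun.bilinear_simps ip_simps power2_eq_square)

lemma qf_bound: "\<bar>qf A x\<bar> \<le> norm A * (norm x)\<^sup>2"
proof -
  have "\<bar>qf A x\<bar> \<le> norm (A x) * norm x" unfolding qf_def by (rule ip_bound)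
  also have "\<dots> \<le> (norm A * norm x) * norm x"
    by (intro mult_right_mono norm_blinfun) simp
  finally show ?thesis by (simp add: power2_eq_square)
qed

lemma tendsto_qf:
  fixes A :: "'a::complex_hilbert_space op"
  assumes "(\<lambda>n. blinfun_apply (An n) x) \<longlonglongrightarrow> A x"
  shows "(\<lambda>n. qf (An n) x) \<longlonglongrightarrow> qf A x"
  unfolding qf_def by (intro tendsto_ip assms tendsto_const)

lemma qf_cauchy_schwarz:
  assumes "sym_op A" "\<And>x. 0 \<le> qf A x"
  shows "(ip (A x) y)\<^sup>2 \<le> qf A x * qf A y"
proof -
  have "0 \<le> qf A x + 2 * ip (A x) y * t + qf A y * t\<^sup>2" for t
  proof -
    have "0 \<le> qf A (x + t *\<^sub>R y)" by (rule assms)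
    also have "\<dots> = qf A x + 2 * ip (A x) y * t + qf A y * t\<^sup>2"
      using sym_opD[OF assms(1), of x y]
      by (simp add: qf_def blinfun.bilinear_simps ip_simps ip_commute[of "A y" x] 
          power2_eq_square algebra_simps)
    finally show ?thesis .
  qed
  from quadratic_nonneg_discrim[OF this assms(2)] show ?thesis .
qed

text \<open>This is \<open>A^2 <= M A\<close>, obtained from Cauchy-Schwarz with
  \<open>y = A x\<close> because square roots of operators are not yet at hand. It converts bounds
  on forms into bounds on vectors.\<close>

lemma norm_sq_le_qf:
  assumes "sym_op A" "\<And>x. 0 \<le> qf A x" "\<And>x. qf A x \<le> M * (norm x)\<^sup>2"
  shows "(norm (A x))\<^sup>2 \<le> M * qf A x"
proof (cases "A x = 0")
  case True
  then show ?thesis by (simp add: qf_def)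
next
  case False
  have "((norm (A x))\<^sup>2)\<^sup>2 \<le> qf A x * qf A (A x)"
    using qf_cauchy_schwarz[OF assms(1,2), of x "A x"] by (simp add: ip_self)
  also have "\<dots> \<le> qf A x * (M * (norm (A x))\<^sup>2)"
    by (intro mult_left_mono assms)
  finally have "(norm (A x))\<^sup>2 * (norm (A x))\<^sup>2 \<le> (M * qf A x) * (norm (A x))\<^sup>2"
    by (simp add: power2_eq_square ac_simps)
  then show ?thesis using False by (subst (asm) mult_le_cancel_right) auto
qed

section \<open>Invertibility and lower bounds\<close>

lemma compose_eq_id_iff: "A o\<^sub>L B = id_blinfun \<longleftrightarrow> (\<forall>x. A (B x) = x)"
proof
  assume "A o\<^sub>L B = id_blinfun"
  then show "\<forall>x. A (B x) = x"
    by (metis blinfun_apply_blinfun_compose id_blinfun.rep_eq id_apply)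
qed (auto intro: blinfun_eqI)

lemma op_invertible_uminus: "op_invertible (- A) \<longleftrightarrow> op_invertible A"
proof -
  have "op_invertible (- A)" if "op_invertible A" for A :: "'a op"
  proof -
    obtain B where "A o\<^sub>L B = id_blinfun" "B o\<^sub>L A = id_blinfun"
      using \<open>op_invertible A\<close> by (auto simp: op_invertible_def)
    then show ?thesis unfolding op_invertible_def
      by (intro exI[of _ "- B"]) (simp add: compose_eq_id_iff blinfun.bilinear_simps)
  qed
  from this[of A] this[of "- A"] show ?thesis by auto
qed

lemma op_invertible_comp:
  assumes "op_invertible A" "op_invertible B"
  shows "op_invertible (A o\<^sub>L B)"
proof -
  obtain A' B' where *: "A o\<^sub>L A' = id_blinfun" "A' o\<^sub>L A = id_blinfun"
     "B o\<^sub>L B' = id_blinfun" "B' o\<^sub>L B = id_blinfun"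
    using assms by (auto simp: op_invertible_def)
  then have "A (A' x) = x" "A' (A x) = x" "B (B' x) = x" "B' (B x) = x" for x
    by (metis blinfun_apply_blinfun_compose id_blinfun.rep_eq id_apply)+
  then show ?thesis unfolding op_invertible_def
    by (intro exI[of _ "B' o\<^sub>L A'"]) (auto intro!: blinfun_eqI)
qed

lemma op_invertible_bounded_below:
  assumes "op_invertible (A :: 'a::complex_hilbert_space op)"
  obtains K where "K > 0" "\<And>x. norm x \<le> K * norm (A x)"
proof -
  obtain B where B: "B o\<^sub>L A = id_blinfun" using assms by (auto simp: op_invertible_def)
  have "norm x \<le> (norm B + 1) * norm (A x)" for x
  proof -
    have "x = B (A x)" by (metis B blinfun_apply_blinfun_compose id_blinfun.rep_eq id_apply)
    then have "norm x \<le> norm B * norm (A x)" using norm_blinfun[of B "A x"] by simp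
    then show ?thesis unfolding distrib_right using norm_ge_zero[of "A x"] by linarith
  qed
  moreover have "norm B + 1 > 0" by (simp add: add_nonneg_pos)
  ultimately show ?thesis using that by blast
qed

lemma op_invertible_bij:
  fixes A :: "'a::complex_hilbert_space op"
  assumes below: "\<And>x. \<delta> * norm x \<le> norm (A x)" and "\<delta> > 0"
    and surj: "\<And>z. \<exists>y. A y = z"
  shows "op_invertible A"
proof -
  define g where "g z = (SOME y. A y = z)" for z
  have Ag: "A (g z) = z" for z unfolding g_def by (rule someI_ex) (rule surj)
  have inj: "x = y" if "A x = A y" for x y
  proof -
    have "\<delta> * norm (x - y) \<le> 0" using below[of "x - y"] that by (simp add: blinfun.bilinear_simps)
    then show ?thesis using \<open>\<delta> > 0\<close> by (simp add: mult_le_0_iff)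
  qed
  have gA: "g (A x) = x" for x by (rule inj) (rule Ag)
  have "bounded_linear g"
  proof (rule bounded_linear_intro)
    show "g (x + y) = g x + g y" for x y by (rule inj) (simp add: Ag blinfun.bilinear_simps)
    show "g (r *\<^sub>R x) = r *\<^sub>R g x" for r x by (rule inj) (simp add: Ag blinfun.bilinear_simps)
    show "norm (g x) \<le> norm x * (1 / \<delta>)" for x
      using below[of "g x"] \<open>\<delta> > 0\<close> by (simp add: Ag field_simps)
  qed
  then show ?thesis unfolding op_invertible_def
    by (intro exI[of _ "Blinfun g"]) (auto intro!: blinfun_eqI simp: bounded_linear_Blinfun_apply Ag gA)
qed

text \<open>Solving \<open>A y = z\<close> means finding a fixed point of the map that sends
  \<open>y\<close> to \<open>S y + z / M\<close>. The form of \<open>S\<close> lies between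
  \<open>0\<close> and \<open>q\<close> times the squared norm, so \<open>norm_sq_le_qf\<close>
  makes the map a contraction with factor \<open>q\<close>.\<close>

lemma op_invertible_qf_pos:
  fixes A :: "'a::complex_hilbert_space op"
  assumes sym: "sym_op A" and below: "\<And>x. \<delta> * (norm x)\<^sup>2 \<le> qf A x" and "\<delta> > 0"
  shows "op_invertible A"
proof (rule op_invertible_bij)
  define M where "M = norm A + \<delta>"
  have M: "M > 0" "\<delta> \<le> M" using \<open>\<delta> > 0\<close> by (auto simp: M_def add_nonneg_pos)
  define S where "S = id_blinfun - (1 / M) *\<^sub>R A"
  have symS: "sym_op S" unfolding S_def by (intro sym_op_intros sym)
  have qS: "qf S x = (norm x)\<^sup>2 - qf A x / M" for x by (simp add: S_def qf_simps)
  have "qf A x \<le> M * (norm x)\<^sup>2" for x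
    using qf_bound[of A x] mult_right_mono[of "norm A" M "(norm x)\<^sup>2"] \<open>\<delta> > 0\<close> by (auto simp: M_def)
  then have pS: "0 \<le> qf S x" for x using M by (simp add: qS field_simps)
  define q where "q = 1 - \<delta> / M"
  have q: "0 \<le> q" "q < 1" using M \<open>\<delta> > 0\<close> by (auto simp: q_def field_simps)
  have uS: "qf S x \<le> q * (norm x)\<^sup>2" for x
    using below[of x] M by (simp add: qS q_def field_simps)
  have nS: "norm (S x) \<le> q * norm x" for x
  proof (rule power2_le_imp_le)
    have "(norm (S x))\<^sup>2 \<le> q * qf S x" by (rule norm_sq_le_qf[OF symS pS uS])
    also have "\<dots> \<le> q * (q * (norm x)\<^sup>2)" by (intro mult_left_mono uS q)
    finally show "(norm (S x))\<^sup>2 \<le> (q * norm x)\<^sup>2" by (simp add: power2_eq_square ac_simps)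
  qed (use q in simp)
  show "\<exists>y. A y = z" for z
  proof -
    have "\<exists>!y. S y + (1 / M) *\<^sub>R z = y"
    proof (rule banach_fix_type[of q])
      show "\<forall>x y. dist (S x + (1 / M) *\<^sub>R z) (S y + (1 / M) *\<^sub>R z) \<le> q * dist x y"
        using nS by (auto simp: dist_norm blinfun.bilinear_simps[symmetric])
    qed (use q in auto)
    then obtain y where "S y + (1 / M) *\<^sub>R z = y" by blast
    then have "(1 / M) *\<^sub>R (z - A y) = 0" 
      by (simp add: S_def blinfun.bilinear_simps algebra_simps)
    then show ?thesis using M by auto
  qed
  show "\<delta> * norm x \<le> norm (A x)" for x
  proof (cases "x = 0")
    case False
    have "\<delta> * norm x * norm x \<le> norm (A x) * norm x"
      using below[of x] ip_bound[of "A x" x] by (simp add: qf_def power2_eq_square)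
    then show ?thesis using False by simp
  qed simp
qed fact

text \<open>Invertibility bounds \<open>norm x\<close> by a multiple of \<open>norm (A x)\<close>,
  whose square \<open>norm_sq_le_qf\<close> bounds by the form.\<close>

lemma op_invertible_imp_qf_bounded_below:
  fixes A :: "'a::complex_hilbert_space op"
  assumes "sym_op A" "\<And>x. 0 \<le> qf A x" "op_invertible A"
  obtains \<delta> where "\<delta> > 0" "\<And>x. \<delta> * (norm x)\<^sup>2 \<le> qf A x"
proof -
  obtain K where K: "K > 0" "\<And>x. norm x \<le> K * norm (A x)"
    using op_invertible_bounded_below[OF assms(3)] by blast
  define M where "M = norm A + 1"
  have M: "M > 0" using norm_ge_zero[of A] by (simp add: M_def add_nonneg_pos)
  have "qf A x \<le> M * (norm x)\<^sup>2" for x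
    using qf_bound[of A x] mult_right_mono[of "norm A" M "(norm x)\<^sup>2"] by (auto simp: M_def)
  note n = norm_sq_le_qf[OF assms(1,2) this]
  have "(1 / (K\<^sup>2 * M)) * (norm x)\<^sup>2 \<le> qf A x" for x
  proof -
    have "(norm x)\<^sup>2 \<le> (K * norm (A x))\<^sup>2" using K by (intro power_mono) auto
    also have "\<dots> \<le> K\<^sup>2 * (M * qf A x)" unfolding power_mult_distrib by (intro mult_left_mono n) simp
    finally show ?thesis using K M by (simp add: field_simps)
  qed
  then show ?thesis using that[of "1 / (K\<^sup>2 * M)"] K M by simp
qed

section \<open>Real polynomials in a symmetric operator\<close>

lemma poly_op_altdef:
  assumes "degree p \<le> N"
  shows "poly_op p X = (\<Sum>i\<le>N. coeff p i *\<^sub>R ((\<lambda>Y. X o\<^sub>L Y) ^^ i) id_blinfun)"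
  unfolding poly_op_def
  by (rule sum.mono_neutral_left) (use assms in \<open>auto simp: coeff_eq_0\<close>)

lemma poly_op_0 [simp]: "poly_op 0 X = 0"
  by (simp add: poly_op_def)

lemma poly_op_pCons: "poly_op (pCons a p) X = a *\<^sub>R id_blinfun + (X o\<^sub>L poly_op p X)"
proof -
  have "poly_op (pCons a p) X = (\<Sum>i\<le>Suc (degree p). coeff (pCons a p) i *\<^sub>R ((\<lambda>Y. X o\<^sub>L Y) ^^ i) id_blinfun)"
    by (rule poly_op_altdef) (simp add: degree_pCons_le)
  also have "\<dots> = a *\<^sub>R id_blinfun + (\<Sum>i\<le>degree p. coeff p i *\<^sub>R (X o\<^sub>L ((\<lambda>Y. X o\<^sub>L Y) ^^ i) id_blinfun))"
    by (subst sum.atMost_Suc_shift) simp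
  also have "\<dots> = a *\<^sub>R id_blinfun + (X o\<^sub>L poly_op p X)"
    unfolding poly_op_def
    by (auto intro!: blinfun_eqI simp: blinfun.bilinear_simps blinfun.sum_left blinfun.sum_right)
  finally show ?thesis .
qed

lemma poly_op_add: "poly_op (p + q) X = poly_op p X + poly_op q X"
proof (induction p q rule: poly_induct2)
  case (pCons a p b q)
  then show ?case
    by (auto intro!: blinfun_eqI simp: poly_op_pCons blinfun.bilinear_simps scaleR_add_left)
qed simp

lemma poly_op_smult: "poly_op (Polynomial.smult c p) X = c *\<^sub>R poly_op p X"
  by (induction p) (auto intro!: blinfun_eqI simp: poly_op_pCons blinfun.bilinear_simps scaleR_add_right)

lemma poly_op_diff: "poly_op (p - q) X = poly_op p X - poly_op q X"
  using poly_op_add[of p "Polynomial.smult (- 1) q" X] by simp (metis poly_op_smult scaleR_minus1_left smult_1_left smult_minus_left)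

lemma poly_op_mult: "poly_op (p * q) X = poly_op p X o\<^sub>L poly_op q X"
  by (induction p)
    (auto intro!: blinfun_eqI simp: poly_op_pCons poly_op_add poly_op_smult blinfun.bilinear_simps)

lemma poly_op_linear: "poly_op [:a, b:] X = a *\<^sub>R id_blinfun + b *\<^sub>R X"
  by (auto intro!: blinfun_eqI simp: poly_op_pCons blinfun.bilinear_simps)

lemma poly_op_const: "poly_op [:a:] X = a *\<^sub>R id_blinfun"
  using poly_op_linear[of a 0] by simp

lemma sym_poly_op:
  assumes "sym_op X"
  shows "sym_op (poly_op p X)"
proof -
  have comm: "X (poly_op q X x) = poly_op q X (X x)" for q x
    by (induction q) (auto simp: poly_op_pCons blinfun.bilinear_simps)
  show ?thesis
  proof (induction p)
    case (pCons a p)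
    have "sym_op (X o\<^sub>L poly_op p X)"
      using assms pCons comm by (simp add: sym_op_def)
    then show ?case by (simp add: poly_op_pCons sym_op_intros)
  qed (simp add: sym_op_def)
qed

lemma poly_map_of_real_pCons:
  "poly (map_poly complex_of_real (pCons a p)) z = of_real a + z * poly (map_poly of_real p) z"
  by (cases "a = 0 \<and> p = 0") (auto simp: map_poly_pCons)

lemma poly_map_of_real_add:
  "poly (map_poly complex_of_real (p + q)) z = poly (map_poly of_real p) z + poly (map_poly of_real q) z"
  by (induction p q rule: poly_induct2) (auto simp: poly_map_of_real_pCons algebra_simps)

lemma poly_map_of_real_smult:
  "poly (map_poly complex_of_real (Polynomial.smult c p)) z = of_real c * poly (map_poly of_real p) z"
  by (induction p) (auto simp: poly_map_of_real_pCons algebra_simps)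

lemma poly_map_of_real_mult:
  "poly (map_poly complex_of_real (p * q)) z = poly (map_poly of_real p) z * poly (map_poly of_real q) z"
  by (induction p) (auto simp: poly_map_of_real_pCons poly_map_of_real_add poly_map_of_real_smult algebra_simps)

lemma poly_map_of_real_of_real: "poly (map_poly complex_of_real p) (of_real t) = of_real (poly p t)"
  by (induction p) (auto simp: poly_map_of_real_pCons)

text \<open>A complex root exists by the fundamental theorem of algebra. If it is not real, the
  remainder modulo the real quadratic with that root is linear with real coefficients and vanishes
  there, hence is \<open>0\<close>. Quadratic factors are kept because only real polynomials are
  applied to operators.\<close>

lemma real_poly_factor:
  fixes q :: "real poly"
  assumes "degree q > 0"
  obtains z q' where "q = [:- z, 1:] * q'"
  | a b q' where "b \<noteq> 0" "q = [:a\<^sup>2 + b\<^sup>2, - 2 * a, 1:] * q'"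
proof -
  define Q where "Q = map_poly complex_of_real q"
  have "degree Q = degree q" unfolding Q_def by (rule degree_map_poly) simp
  then have "\<not> constant (poly Q)" using assms by (simp add: constant_degree)
  then obtain z where z: "poly Q z = 0" using fundamental_theorem_of_algebra by blast
  show thesis
  proof (cases "Im z = 0")
    case True
    then have "z = of_real (Re z)" by (simp add: complex_eq_iff)
    then have "of_real (poly q (Re z)) = (0::complex)"
      using z unfolding Q_def by (metis poly_map_of_real_of_real)
    then have "[:- Re z, 1:] dvd q" by (simp add: poly_eq_0_iff_dvd)
    then show thesis using that(1) by (auto elim: dvdE)
  next
    case False
    define d where "d = [:(Re z)\<^sup>2 + (Im z)\<^sup>2, - 2 * Re z, 1:]"
    define r where "r = q mod d"
    have "degree r < 2"
      using degree_mod_less[of d q] by (auto simp: r_def d_def)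
    then have "r = [:coeff r 0, coeff r 1:]"
      by (intro poly_eqI) (auto simp: coeff_pCons coeff_eq_0 split: nat.split)
    then obtain \<alpha> \<beta> where r: "r = [:\<beta>, \<alpha>:]" by blast
    have dz: "poly (map_poly complex_of_real d) z = 0"
      by (simp add: d_def poly_map_of_real_pCons complex_eq_iff power2_eq_square algebra_simps)
    have "poly (map_poly of_real (d * (q div d) + r)) z = 0" using z by (simp add: Q_def r_def)
    then have "poly (map_poly complex_of_real r) z = 0"
      using dz by (simp add: poly_map_of_real_add poly_map_of_real_mult)
    then have "of_real \<beta> + z * of_real \<alpha> = 0" by (simp add: r poly_map_of_real_pCons)
    then have "\<alpha> = 0" "\<beta> = 0" using False by (auto simp: complex_eq_iff)
    then have "q mod d = 0" using r by (simp add: r_def)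
    then have "q = d * (q div d)" by (metis add.right_neutral mult_div_mod_eq)
    then show thesis using that(2)[of "Im z" "Re z"] False unfolding d_def by blast
  qed
qed

text \<open>If the infimum \<open>m\<close> of the quadratic form of \<open>p(X)\<close> were not a value of \<open>p\<close> on the spectrum of \<open>X\<close>,
  then \<open>p(X) - m\<close> would be a product of invertible factors.\<close>

lemma spectral_nonvanishing_invertible:
  fixes X :: "'a::complex_hilbert_space op"
  assumes sym: "sym_op X"
  shows "q \<noteq> 0 \<Longrightarrow> (\<And>t. t \<in> op_spectrum X \<Longrightarrow> poly q t \<noteq> 0) \<Longrightarrow> op_invertible (poly_op q X)"
proof (induction "degree q" arbitrary: q rule: less_induct)
  case less
  show ?case
  proof (cases "degree q = 0")
    case True
    then obtain c where "q = [:c:]" by (auto elim: degree_eq_zeroE)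
    with less.prems show ?thesis unfolding op_invertible_def
      by (intro exI[of _ "(1 / c) *\<^sub>R id_blinfun"]) 
        (auto simp: poly_op_const compose_eq_id_iff blinfun.bilinear_simps)
  next
    case False
    then have "degree q > 0" by simp
    then show ?thesis
    proof (cases q rule: real_poly_factor)
      case (1 z q')
      then have q': "q' \<noteq> 0" using less.prems by auto
      have "degree q = degree [:- z, 1:] + degree q'" unfolding 1 by (rule degree_mult_eq) (use q' in auto)
      then have "degree q' < degree q" by simp
      moreover have "poly q' t \<noteq> 0" if "t \<in> op_spectrum X" for t
        using less.prems(2)[OF that] 1 by auto
      ultimately have i: "op_invertible (poly_op q' X)" using less.hyps q' by blast
      have "z \<notin> op_spectrum X" using less.prems(2)[of z] 1 by auto
      then have "op_invertible (scalar_op z - X)" by (simp add: op_spectrum_def)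
      moreover have "poly_op [:- z, 1:] X = - (scalar_op z - X)"
        by (simp add: poly_op_linear scalar_op_def)
      ultimately have "op_invertible (poly_op [:- z, 1:] X)" by (simp only: op_invertible_uminus)
      then show ?thesis using i unfolding 1 poly_op_mult by (rule op_invertible_comp)
    next
      case (2 a b q')
      then have q': "q' \<noteq> 0" using less.prems by auto
      have "degree q = degree [:a\<^sup>2 + b\<^sup>2, - 2 * a, 1:] + degree q'"
        unfolding 2 by (rule degree_mult_eq) (use q' in auto)
      then have "degree q' < degree q" by simp
      moreover have "poly q' t \<noteq> 0" if "t \<in> op_spectrum X" for t
        using less.prems(2)[OF that] 2 by auto
      ultimately have i: "op_invertible (poly_op q' X)" using less.hyps q' by blast
      \<comment> \<open>This factor is \<open>(X - a)^2 + b^2\<close>, whose form is at least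
        \<open>b^2\<close> times the squared norm, whatever the spectrum of \<open>X\<close>
        is.\<close>
      have "op_invertible (poly_op [:a\<^sup>2 + b\<^sup>2, - 2 * a, 1:] X)"
      proof (rule op_invertible_qf_pos)
        show "sym_op (poly_op [:a\<^sup>2 + b\<^sup>2, - 2 * a, 1:] X)" by (rule sym_poly_op[OF sym])
        show "b\<^sup>2 * (norm x)\<^sup>2 \<le> qf (poly_op [:a\<^sup>2 + b\<^sup>2, - 2 * a, 1:] X) x" for x
        proof -
          have e: "poly_op [:a\<^sup>2 + b\<^sup>2, - 2 * a, 1:] X x = (a\<^sup>2 + b\<^sup>2) *\<^sub>R x + X (X x) - (2 * a) *\<^sub>R X x"
            by (simp add: poly_op_pCons blinfun.bilinear_simps)
          have "qf (poly_op [:a\<^sup>2 + b\<^sup>2, - 2 * a, 1:] X) x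
              = ip (X x - a *\<^sub>R x) (X x - a *\<^sub>R x) + b\<^sup>2 * (norm x)\<^sup>2"
            unfolding qf_def e ip_self[symmetric] ip_simps sym_opD[OF sym, of "X x" x]
              ip_commute[of x "X x"]
            by (simp add: power2_eq_square algebra_simps)
          then show ?thesis by (simp add: ip_self)
        qed
      qed (use 2 in simp)
      then show ?thesis using i unfolding 2 poly_op_mult by (rule op_invertible_comp)
    qed
  qed
qed

text \<open>\<open>m\<close> is the infimum of the form on the unit sphere. Were
  \<open>Y - m\<close> invertible, its nonnegative form would be bounded below by a positive
  constant, and \<open>m\<close> could be raised.\<close>

lemma scalar_op_minus_not_invertible:
  fixes Y :: "'a::complex_hilbert_space op"
  assumes sym: "sym_op Y" and nz: "\<exists>x::'a. x \<noteq> 0"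
  obtains m where "\<not> op_invertible (Y - scalar_op m)" "\<And>x. m * (norm x)\<^sup>2 \<le> qf Y x"
proof -
  define S where "S = {qf Y x |x. norm x = 1}"
  define m where "m = Inf S"
  have ne: "S \<noteq> {}"
  proof -
    obtain x :: 'a where "x \<noteq> 0" using nz by blast
    then have "norm ((1 / norm x) *\<^sub>R x) = 1" by simp
    then show ?thesis unfolding S_def by blast
  qed
  have bd: "bdd_below S"
  proof (rule bdd_belowI[of _ "- norm Y"])
    fix s assume "s \<in> S"
    then obtain x where "s = qf Y x" "norm x = 1" by (auto simp: S_def)
    then show "- norm Y \<le> s" using qf_bound[of Y x] by simp
  qed
  have lower: "m * (norm x)\<^sup>2 \<le> qf Y x" for x
  proof (cases "x = 0")
    case False
    have "qf Y ((1 / norm x) *\<^sub>R x) \<in> S" using False by (auto simp: S_def)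
    then have "m \<le> qf Y ((1 / norm x) *\<^sub>R x)" unfolding m_def using bd by (rule cInf_lower)
    then show ?thesis using False by (simp add: qf_scaleR_arg power_divide field_simps)
  qed (simp add: qf_def)
  define Z where "Z = Y - scalar_op m"
  have symZ: "sym_op Z" unfolding Z_def by (intro sym_op_intros sym)
  have posZ: "0 \<le> qf Z x" for x using lower[of x] by (simp add: Z_def qf_simps)
  have "\<not> op_invertible Z"
  proof
    assume "op_invertible Z"
    from op_invertible_imp_qf_bounded_below[OF symZ posZ this]
    obtain \<delta> where \<delta>: "\<delta> > 0" "\<And>x. \<delta> * (norm x)\<^sup>2 \<le> qf Z x" by blast
    have "m + \<delta> \<le> Inf S"
    proof (rule cInf_greatest[OF ne])
      fix s assume "s \<in> S"
      then obtain x where "s = qf Y x" "norm x = 1" by (auto simp: S_def)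
      then show "m + \<delta> \<le> s" using \<delta>(2)[of x] by (simp add: Z_def qf_simps)
    qed
    then show False using \<delta> by (simp add: m_def)
  qed
  then show thesis using that lower unfolding Z_def by blast
qed

lemma op_spectrum_nonempty:
  fixes X :: "'a::complex_hilbert_space op"
  assumes "sym_op X" "\<exists>x::'a. x \<noteq> 0"
  shows "op_spectrum X \<noteq> {}"
proof -
  obtain m where "\<not> op_invertible (X - scalar_op m)"
    using scalar_op_minus_not_invertible[OF assms] by blast
  then have "m \<in> op_spectrum X"
    using op_invertible_uminus[of "X - scalar_op m"] by (simp add: op_spectrum_def)
  then show ?thesis by blast
qed

lemma poly_op_nonneg:
  fixes X :: "'a::complex_hilbert_space op"
  assumes sym: "sym_op X" and pos: "\<And>t. t \<in> op_spectrum X \<Longrightarrow> 0 \<le> poly p t"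
  shows "0 \<le> qf (poly_op p X) x"
proof (cases "x = 0")
  case False
  then have nz: "\<exists>x::'a. x \<noteq> 0" by blast
  obtain m where m: "\<not> op_invertible (poly_op p X - scalar_op m)" "\<And>x. m * (norm x)\<^sup>2 \<le> qf (poly_op p X) x"
    using scalar_op_minus_not_invertible[OF sym_poly_op[OF sym] nz] by blast
  have "poly_op (p - [:m:]) X = poly_op p X - scalar_op m"
    by (simp add: poly_op_diff poly_op_const scalar_op_def)
  then have ninv: "\<not> op_invertible (poly_op (p - [:m:]) X)" using m by simp
  have "0 \<le> m"
  proof (rule ccontr)
    assume "\<not> 0 \<le> m"
    then have *: "poly (p - [:m:]) t \<noteq> 0" if "t \<in> op_spectrum X" for t using pos[OF that] by simp
    \<comment> \<open>The zero polynomial would vanish on the spectrum, which is nonempty.\<close>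
    moreover have "p - [:m:] \<noteq> 0" using * op_spectrum_nonempty[OF sym nz] by force
    ultimately show False using spectral_nonvanishing_invertible[OF sym] ninv by blast
  qed
  then have "0 \<le> m * (norm x)\<^sup>2" by simp
  then show ?thesis using m(2)[of x] by linarith
qed (simp add: qf_def)

text \<open>\<open>poly_op_nonneg\<close> is applied to \<open>e^2 - p^2\<close>: by symmetry the
  form of \<open>p(X)^2\<close> at \<open>x\<close> is the squared norm of \<open>p(X) x\<close>.
  Uniform estimates on the spectrum become norm estimates in this way.\<close>

lemma norm_poly_op_le:
  fixes X :: "'a::complex_hilbert_space op"
  assumes sym: "sym_op X" and le: "\<And>t. t \<in> op_spectrum X \<Longrightarrow> \<bar>poly p t\<bar> \<le> e" and "0 \<le> e"
  shows "norm (poly_op p X) \<le> e"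
proof (rule norm_blinfun_bound)
  fix x
  have "0 \<le> qf (poly_op ([:e\<^sup>2:] - p * p) X) x"
  proof (rule poly_op_nonneg[OF sym])
    fix t assume "t \<in> op_spectrum X"
    then show "0 \<le> poly ([:e\<^sup>2:] - p * p) t"
      using le[of t] abs_le_square_iff[of "poly p t" e] \<open>0 \<le> e\<close> by (simp add: power2_eq_square)
  qed
  then have "(norm (poly_op p X x))\<^sup>2 \<le> (e * norm x)\<^sup>2"
    using sym_opD[OF sym_poly_op[OF sym], of p "poly_op p X x" x]
    by (simp add: poly_op_diff poly_op_mult poly_op_const qf_simps) (simp add: qf_def ip_self power_mult_distrib)
  then show "norm (poly_op p X x) \<le> e * norm x"
    by (rule power2_le_imp_le) (use \<open>0 \<le> e\<close> in simp)
qed fact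

section \<open>The continuous functional calculus\<close>

text \<open>The relation inside \<open>cfc\<close> without the definite description, so that it can
  be used before existence and uniqueness are known.\<close>

definition fun_calc :: "'a::complex_hilbert_space op \<Rightarrow> (real \<Rightarrow> real) \<Rightarrow> 'a op \<Rightarrow> bool" where
  "fun_calc X f Y \<longleftrightarrow> (\<exists>p. uniform_limit (op_spectrum X) (\<lambda>n. poly (p n)) f sequentially
     \<and> (\<lambda>n. poly_op (p n) X) \<longlonglongrightarrow> Y)"

text \<open>The difference of the approximating polynomials is uniformly small on the spectrum,
  hence small in norm. Identities of functions on the spectrum thereby become identities of
  operators.\<close>

lemma fun_calc_unique:
  assumes sym: "sym_op X" and "fun_calc X f Y" "fun_calc X g Z"
    and eq: "\<And>t. t \<in> op_spectrum X \<Longrightarrow> f t = g t"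
  shows "Y = Z"
proof -
  obtain p q where p: "uniform_limit (op_spectrum X) (\<lambda>n. poly (p n)) f sequentially"
      "(\<lambda>n. poly_op (p n) X) \<longlonglongrightarrow> Y"
    and q: "uniform_limit (op_spectrum X) (\<lambda>n. poly (q n)) g sequentially"
      "(\<lambda>n. poly_op (q n) X) \<longlonglongrightarrow> Z"
    using assms(1-3) unfolding fun_calc_def by (elim exE conjE)
  have lim: "(\<lambda>n. poly_op (p n - q n) X) \<longlonglongrightarrow> Y - Z"
    unfolding poly_op_diff by (intro tendsto_diff p q)
  have "norm (Y - Z) \<le> e" if "e > 0" for e
  proof (rule tendsto_upperbound[OF tendsto_norm[OF lim]])
    have "\<forall>\<^sub>F n in sequentially. \<forall>t\<in>op_spectrum X. dist (poly (p n) t) (f t) < e / 2"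
      "\<forall>\<^sub>F n in sequentially. \<forall>t\<in>op_spectrum X. dist (poly (q n) t) (g t) < e / 2"
      using uniform_limitD[OF p(1), of "e / 2"] uniform_limitD[OF q(1), of "e / 2"] that by auto
    then show "\<forall>\<^sub>F n in sequentially. norm (poly_op (p n - q n) X) \<le> e"
    proof eventually_elim
      case (elim n)
      show ?case
      proof (rule norm_poly_op_le[OF sym])
        fix t assume "t \<in> op_spectrum X"
        then have "dist (poly (p n) t) (f t) < e / 2" "dist (poly (q n) t) (g t) < e / 2" "f t = g t"
          using elim eq by blast+
        then show "\<bar>poly (p n - q n) t\<bar> \<le> e" unfolding dist_real_def poly_diff by linarith
      qed (use that in simp)
    qed
  qed simp
  then have "norm (Y - Z) \<le> 0" by (rule field_le_epsilon) simp
  then show ?thesis by simp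
qed

lemma cfc_eqI: "sym_op X \<Longrightarrow> fun_calc X f Y \<Longrightarrow> cfc f X = Y"
  unfolding cfc_def fun_calc_def[symmetric]
  by (rule the_equality) (assumption, rule fun_calc_unique[OF _ _ _ refl])

lemma fun_calc_cong:
  assumes "fun_calc X f Y" "\<And>t. t \<in> op_spectrum X \<Longrightarrow> f t = g t"
  shows "fun_calc X g Y"
proof -
  obtain p where p: "uniform_limit (op_spectrum X) (\<lambda>n. poly (p n)) f sequentially"
      "(\<lambda>n. poly_op (p n) X) \<longlonglongrightarrow> Y"
    using assms(1) unfolding fun_calc_def by (elim exE conjE)
  have "uniform_limit (op_spectrum X) (\<lambda>n. poly (p n)) g sequentially"
    using p(1) assms(2) by (subst uniform_limit_cong'[of "op_spectrum X" _ _ g f]) auto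
  then show ?thesis using p(2) unfolding fun_calc_def by (intro exI conjI)
qed

lemma fun_calc_poly: "fun_calc X (poly p) (poly_op p X)"
  unfolding fun_calc_def by (intro exI[of _ "\<lambda>_. p"]) (simp add: uniform_limit_const)

lemma fun_calc_mult:
  assumes "fun_calc X f Y" "fun_calc X g Z" "bounded (f ` op_spectrum X)" "bounded (g ` op_spectrum X)"
  shows "fun_calc X (\<lambda>t. f t * g t) (Y o\<^sub>L Z)"
proof -
  obtain p q where p: "uniform_limit (op_spectrum X) (\<lambda>n. poly (p n)) f sequentially"
      "(\<lambda>n. poly_op (p n) X) \<longlonglongrightarrow> Y"
    and q: "uniform_limit (op_spectrum X) (\<lambda>n. poly (q n)) g sequentially"
      "(\<lambda>n. poly_op (q n) X) \<longlonglongrightarrow> Z"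
    using assms(1-3) unfolding fun_calc_def by (elim exE conjE)
  show ?thesis unfolding fun_calc_def
  proof (intro exI conjI)
    show "uniform_limit (op_spectrum X) (\<lambda>n. poly (p n * q n)) (\<lambda>t. f t * g t) sequentially"
      using uniform_lim_mult[OF p(1) q(1) assms(3,4)] by (simp add: poly_mult [abs_def])
    show "(\<lambda>n. poly_op (p n * q n) X) \<longlonglongrightarrow> (Y o\<^sub>L Z)"
      unfolding poly_op_mult
      by (intro bounded_bilinear.tendsto[OF bounded_bilinear_blinfun_compose] p q)
  qed
qed

lemma sym_op_limit:
  fixes Y :: "'a::complex_hilbert_space op"
  assumes "\<And>n. sym_op (An n)" "An \<longlonglongrightarrow> Y"
  shows "sym_op Y"
  unfolding sym_op_def
proof (intro allI)
  fix x y
  have l: "(\<lambda>n. An n z) \<longlonglongrightarrow> Y z" for z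
    by (intro bounded_bilinear.tendsto[OF bounded_bilinear_blinfun_apply] assms tendsto_const)
  have "(\<lambda>n. ip (An n x) y) \<longlonglongrightarrow> ip (Y x) y" by (intro tendsto_ip l tendsto_const)
  moreover have "(\<lambda>n. ip (An n x) y) \<longlonglongrightarrow> ip x (Y y)"
    using sym_opD[OF assms(1)] by (simp add: tendsto_ip l)
  ultimately show "ip (Y x) y = ip x (Y y)" by (rule LIMSEQ_unique)
qed

lemma fun_calc_sym: "sym_op X \<Longrightarrow> fun_calc X f Y \<Longrightarrow> sym_op Y"
  unfolding fun_calc_def by (auto intro: sym_op_limit sym_poly_op)

lemma fun_calc_le_linear:
  fixes X :: "'a::complex_hilbert_space op"
  assumes sym: "sym_op X" and "fun_calc X f Y" and le: "\<And>t. t \<in> op_spectrum X \<Longrightarrow> f t \<le> a + b * t"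
  shows "qf Y x \<le> a * (norm x)\<^sup>2 + b * qf X x"
proof -
  obtain p where p: "uniform_limit (op_spectrum X) (\<lambda>n. poly (p n)) f sequentially"
      "(\<lambda>n. poly_op (p n) X) \<longlonglongrightarrow> Y"
    using assms(1-3) unfolding fun_calc_def by (elim exE conjE)
  have lim: "(\<lambda>n. qf (poly_op (p n) X) x) \<longlonglongrightarrow> qf Y x"
    by (intro tendsto_qf bounded_bilinear.tendsto[OF bounded_bilinear_blinfun_apply] p tendsto_const)
  \<comment> \<open>The slack \<open>e\<close> absorbs the error of the approximating polynomials,
    which need not stay below the affine function themselves.\<close>
  have "qf Y x \<le> a * (norm x)\<^sup>2 + b * qf X x + e * (norm x)\<^sup>2" if "e > 0" for e
  proof (rule tendsto_upperbound[OF lim])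
    have "\<forall>\<^sub>F n in sequentially. \<forall>t\<in>op_spectrum X. dist (poly (p n) t) (f t) < e"
      using uniform_limitD[OF p(1) that] .
    then show "\<forall>\<^sub>F n in sequentially. qf (poly_op (p n) X) x \<le> a * (norm x)\<^sup>2 + b * qf X x + e * (norm x)\<^sup>2"
    proof eventually_elim
      case (elim n)
      have "0 \<le> qf (poly_op ([:a + e, b:] - p n) X) x"
      proof (rule poly_op_nonneg[OF sym])
        fix t assume "t \<in> op_spectrum X"
        then show "0 \<le> poly ([:a + e, b:] - p n) t"
          using elim[rule_format, of t] le[of t] by (simp add: dist_real_def algebra_simps abs_less_iff)
      qed
      then show ?case by (simp add: poly_op_diff poly_op_linear qf_simps algebra_simps)
    qed
  qed simp
  then have "qf Y x - (a * (norm x)\<^sup>2 + b * qf X x) \<le> e * (norm x)\<^sup>2" if "e > 0" for e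
    using that by force
  note * = this
  have "qf Y x - (a * (norm x)\<^sup>2 + b * qf X x) \<le> 0"
  proof (rule field_le_epsilon)
    fix e :: real assume "e > 0"
    define n where "n = (norm x)\<^sup>2 + 1"
    have n: "n > 0" "(norm x)\<^sup>2 \<le> n" by (auto simp: n_def add_nonneg_pos)
    have "e / n * (norm x)\<^sup>2 \<le> e" using n \<open>e > 0\<close> by (simp add: field_simps)
    then show "qf Y x - (a * (norm x)\<^sup>2 + b * qf X x) \<le> 0 + e" using *[of "e / n"] n \<open>e > 0\<close> by simp
  qed
  then show ?thesis by simp
qed

lemma op_spectrum_subset:
  fixes X :: "'a::complex_hilbert_space op"
  assumes sym: "sym_op X" and "\<And>x. \<delta> * (norm x)\<^sup>2 \<le> qf X x" and "\<And>x. qf X x \<le> M * (norm x)\<^sup>2"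
  shows "op_spectrum X \<subseteq> {\<delta>..M}"
proof
  fix t assume t: "t \<in> op_spectrum X"
  have "\<not> t < \<delta>"
  proof
    assume "t < \<delta>"
    have "op_invertible (X - scalar_op t)"
      by (rule op_invertible_qf_pos[where \<delta> = "\<delta> - t"])
        (use assms \<open>t < \<delta>\<close> in \<open>auto intro!: sym_op_intros simp: qf_simps algebra_simps\<close>)
    then show False using t op_invertible_uminus[of "X - scalar_op t"] by (simp add: op_spectrum_def)
  qed
  moreover have "\<not> M < t"
  proof
    assume "M < t"
    have "op_invertible (scalar_op t - X)"
      by (rule op_invertible_qf_pos[where \<delta> = "t - M"])
        (use assms \<open>M < t\<close> in \<open>auto intro!: sym_op_intros simp: qf_simps algebra_simps\<close>)
    then show False using t by (simp add: op_spectrum_def)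
  qed
  ultimately show "t \<in> {\<delta>..M}" by simp
qed

lemma fun_calc_exists:
  fixes X :: "'a::complex_hilbert_space op"
  assumes sym: "sym_op X" and sub: "op_spectrum X \<subseteq> {\<delta>..M}" and cont: "continuous_on {\<delta>..M} f"
  obtains Y where "fun_calc X f Y"
proof -
  have "\<exists>p. \<forall>t\<in>{\<delta>..M}. \<bar>f t - poly p t\<bar> < 1 / real (Suc n)" for n
  proof -
    obtain g where g: "real_polynomial_function g" "\<And>t. t \<in> {\<delta>..M} \<Longrightarrow> \<bar>f t - g t\<bar> < 1 / real (Suc n)"
      by (rule Stone_Weierstrass_real_polynomial_function[OF compact_Icc cont, of "1 / real (Suc n)"])
        (simp, rule that)
    obtain a m where am: "g = (\<lambda>x. \<Sum>i\<le>m. a i * x ^ i)"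
      using g(1) unfolding real_polynomial_function_iff_sum by (elim exE)
    have "g t = poly (\<Sum>i\<le>m. Polynomial.monom (a i) i) t" for t
      unfolding am by (simp add: poly_sum poly_monom)
    then have "\<forall>t\<in>{\<delta>..M}. \<bar>f t - poly (\<Sum>i\<le>m. Polynomial.monom (a i) i) t\<bar> < 1 / real (Suc n)"
      using g(2) by metis
    then show ?thesis by (rule exI)
  qed
  then have "\<exists>p. \<forall>n. \<forall>t\<in>{\<delta>..M}. \<bar>f t - poly (p n) t\<bar> < 1 / real (Suc n)" by (intro choice) blast
  then obtain p where p: "\<And>n t. t \<in> {\<delta>..M} \<Longrightarrow> \<bar>f t - poly (p n) t\<bar> < 1 / real (Suc n)" by blast
  have ul: "uniform_limit (op_spectrum X) (\<lambda>n. poly (p n)) f sequentially"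
    unfolding uniform_limit_iff
  proof (intro allI impI)
    fix e :: real assume "e > 0"
    then have "\<forall>\<^sub>F n in sequentially. 1 / real (Suc n) < e"
      using order_tendstoD(2)[OF LIMSEQ_inverse_real_of_nat, of e] by (simp add: inverse_eq_divide)
    then show "\<forall>\<^sub>F n in sequentially. \<forall>t\<in>op_spectrum X. dist (poly (p n) t) (f t) < e"
    proof eventually_elim
      case (elim n)
      show ?case
      proof
        fix t assume "t \<in> op_spectrum X"
        then have "\<bar>f t - poly (p n) t\<bar> < 1 / real (Suc n)" using sub by (intro p) auto
        then show "dist (poly (p n) t) (f t) < e" using elim by (simp add: dist_real_def)
      qed
    qed
  qed
  have "Cauchy (\<lambda>n. poly_op (p n) X)"
  proof (rule CauchyI)
    fix e :: real assume "e > 0"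
    then have "\<forall>\<^sub>F n in sequentially. \<forall>t\<in>op_spectrum X. dist (poly (p n) t) (f t) < e / 3"
      by (intro uniform_limitD[OF ul]) simp
    then obtain N where N: "\<And>n t. n \<ge> N \<Longrightarrow> t \<in> op_spectrum X \<Longrightarrow> dist (poly (p n) t) (f t) < e / 3"
      by (auto simp: eventually_sequentially)
    have "norm (poly_op (p m) X - poly_op (p n) X) < e" if "m \<ge> N" "n \<ge> N" for m n
    proof -
      have "norm (poly_op (p m - p n) X) \<le> 2 * e / 3"
      proof (rule norm_poly_op_le[OF sym])
        fix t assume "t \<in> op_spectrum X"
        then show "\<bar>poly (p m - p n) t\<bar> \<le> 2 * e / 3"
          using N[OF that(1), of t] N[OF that(2), of t] unfolding dist_real_def poly_diff by linarith
      qed (use \<open>e > 0\<close> in simp)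
      then show ?thesis using \<open>e > 0\<close> by (simp add: poly_op_diff)
    qed
    then show "\<exists>M. \<forall>m\<ge>M. \<forall>n\<ge>M. norm (poly_op (p m) X - poly_op (p n) X) < e" by blast
  qed
  then obtain Y where "(\<lambda>n. poly_op (p n) X) \<longlonglongrightarrow> Y"
    using Cauchy_convergent convergent_def by blast
  then show thesis using ul by (intro that) (auto simp: fun_calc_def)
qed

section \<open>Positive operators and means\<close>

lemma cinner_scaleC_right: "cinner x (c *\<^sub>C y) = cnj c * cinner x y"
  by (subst (1 2) cinner_commute) (simp add: cinner_scaleC_left)

lemma Im_cinner: "Im (cinner x y) = ip x (\<i> *\<^sub>C y)"
  by (simp add: ip_def cinner_scaleC_right)

lemma ip_imaginary: "ip (\<i> *\<^sub>C x) y = - ip x (\<i> *\<^sub>C y)"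
  by (simp add: ip_def cinner_scaleC_right cinner_scaleC_left)

lemma norm_scaleC: "norm (c *\<^sub>C x) = cmod c * norm x"
proof -
  have "complex_of_real ((norm (c *\<^sub>C x))\<^sup>2) = complex_of_real ((cmod c * norm x)\<^sup>2)"
    unfolding cinner_self[symmetric] cinner_scaleC_left cinner_scaleC_right
    unfolding cinner_self power_mult_distrib of_real_mult complex_norm_square[of c] by simp
  then have "(norm (c *\<^sub>C x))\<^sup>2 = (cmod c * norm x)\<^sup>2" unfolding of_real_eq_iff .
  then show ?thesis by (rule power2_eq_imp_eq) simp_all
qed

lemma bounded_linear_scaleC: "bounded_linear (\<lambda>x. c *\<^sub>C x)"
proof (rule bounded_linear_intro)
  show "c *\<^sub>C r *\<^sub>R x = r *\<^sub>R c *\<^sub>C x" for r x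
    by (simp add: scaleR_scaleC scaleC_scaleC mult.commute)
  show "norm (c *\<^sub>C x) \<le> norm x * cmod c" for x
    by (simp add: norm_scaleC mult.commute)
qed (simp add: scaleC_add_right)

lemmas scaleC_linear = linear_add[OF bounded_linear.linear[OF bounded_linear_scaleC]]
  linear_diff[OF bounded_linear.linear[OF bounded_linear_scaleC]]
  linear_scale[OF bounded_linear.linear[OF bounded_linear_scaleC]]

text \<open>Self-adjointness written through \<open>ip\<close>: by \<open>Im_cinner\<close> the
  second condition says that \<open>cinner (A x) x\<close> is real. Unlike \<open>pos_op\<close>,
  this class is closed under differences, which the order requires.\<close>

definition herm_op :: "'a::complex_hilbert_space op \<Rightarrow> bool" where
  "herm_op A \<longleftrightarrow> (\<forall>c x. A (c *\<^sub>C x) = c *\<^sub>C A x) \<and> (\<forall>x. ip (A x) (\<i> *\<^sub>C x) = 0)"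

lemma pos_op_iff: "A \<in> pos_op \<longleftrightarrow> herm_op A \<and> (\<forall>x. 0 \<le> qf A x)"
  unfolding pos_op_def herm_op_def mem_Collect_eq complex_nonneg_Reals_iff Im_cinner qf_def
  by (auto simp: ip_def)

lemma pos_op_herm: "A \<in> pos_op \<Longrightarrow> herm_op A"
  and pos_op_nonneg: "A \<in> pos_op \<Longrightarrow> 0 \<le> qf A x"
  by (simp_all add: pos_op_iff)

lemma herm_op_add: "herm_op A \<Longrightarrow> herm_op B \<Longrightarrow> herm_op (A + B)"
  and herm_op_diff: "herm_op A \<Longrightarrow> herm_op B \<Longrightarrow> herm_op (A - B)"
  and herm_op_scaleR: "herm_op A \<Longrightarrow> herm_op (t *\<^sub>R A)"
  by (auto simp: herm_op_def plus_blinfun.rep_eq minus_blinfun.rep_eq scaleR_blinfun.rep_eq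
      ip_simps scaleC_linear)

lemma herm_op_scalar: "herm_op (scalar_op t)"
proof -
  have "ip x (\<i> *\<^sub>C x) = 0" for x :: 'a
    using ip_imaginary[of x x] ip_commute[of x "\<i> *\<^sub>C x"] by simp
  then show ?thesis
    by (simp add: herm_op_def scalar_op_def scaleR_blinfun.rep_eq ip_simps scaleC_linear)
qed

lemmas herm_op_intros = herm_op_add herm_op_diff herm_op_scaleR herm_op_scalar

text \<open>Polarization: at \<open>x + \<i> *\<^sub>C y\<close> the condition leaves only cross
  terms, which complex linearity turns into \<open>ip (A y) x - ip (A x) y\<close>.\<close>

lemma herm_op_sym:
  assumes "herm_op A"
  shows "sym_op A"
  unfolding sym_op_def
proof (intro allI)
  fix x y
  have lin: "A (\<i> *\<^sub>C z) = \<i> *\<^sub>C A z" and zero: "ip (A z) (\<i> *\<^sub>C z) = 0" for z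
    using assms by (auto simp: herm_op_def)
  have ii: "\<i> *\<^sub>C \<i> *\<^sub>C z = - z" for z :: 'a
    using scaleR_scaleC[of "-1" z] by (simp add: scaleC_scaleC)
  have "0 = ip (A (x + \<i> *\<^sub>C y)) (\<i> *\<^sub>C (x + \<i> *\<^sub>C y))" by (rule zero[symmetric])
  also have "\<dots> = ip (\<i> *\<^sub>C A y) (\<i> *\<^sub>C x) - ip (A x) y"
    using zero[of x] zero[of "\<i> *\<^sub>C y"]
    by (simp add: blinfun.add_right scaleC_add_right ip_simps lin ii)
  also have "ip (\<i> *\<^sub>C A y) (\<i> *\<^sub>C x) = ip (A y) x"
    by (simp add: ip_imaginary ii ip_simps)
  finally show "ip (A x) y = ip x (A y)" by (simp add: ip_commute)
qed

lemmas pos_op_sym = herm_op_sym[OF pos_op_herm]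

lemma op_le_qf: "A \<preceq> B \<Longrightarrow> qf A x \<le> qf B x"
  unfolding op_le_def using pos_op_nonneg[of "B - A" x] by (simp add: qf_simps)

lemma op_leI: "herm_op A \<Longrightarrow> herm_op B \<Longrightarrow> (\<And>x. qf A x \<le> qf B x) \<Longrightarrow> A \<preceq> B"
  unfolding op_le_def pos_op_iff by (simp add: herm_op_diff qf_simps)

lemma herm_op_limit:
  fixes S :: "'a::complex_hilbert_space op" and T :: "nat \<Rightarrow> 'a op"
  assumes herm: "\<And>n. herm_op (T n)" and lim: "\<And>x. (\<lambda>n. T n x) \<longlonglongrightarrow> S x"
  shows "herm_op S"
  unfolding herm_op_def
proof (intro conjI allI)
  fix c x
  have "(\<lambda>n. c *\<^sub>C T n x) \<longlonglongrightarrow> c *\<^sub>C S x"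
    by (rule bounded_linear.tendsto[OF bounded_linear_scaleC lim])
  moreover have "(\<lambda>n. c *\<^sub>C T n x) = (\<lambda>n. T n (c *\<^sub>C x))"
    using herm by (simp add: herm_op_def)
  ultimately show "S (c *\<^sub>C x) = c *\<^sub>C S x" using lim[of "c *\<^sub>C x"] LIMSEQ_unique by metis
next
  fix x
  have "(\<lambda>n. ip (T n x) (\<i> *\<^sub>C x)) \<longlonglongrightarrow> ip (S x) (\<i> *\<^sub>C x)"
    by (intro tendsto_ip lim tendsto_const)
  moreover have "(\<lambda>n. ip (T n x) (\<i> *\<^sub>C x)) = (\<lambda>n. 0)"
    using herm by (simp add: herm_op_def)
  ultimately show "ip (S x) (\<i> *\<^sub>C x) = 0" by (simp add: LIMSEQ_const_iff)
qed

text \<open>\<open>norm_sq_le_qf\<close>, applied to \<open>T m - T n\<close>, bounds the squared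
  distance of the vectors by the decrease of the forms. The forms are monotone and bounded, so the
  vectors form a Cauchy sequence and the limit is strong, not merely weak.\<close>

lemma decreasing_pos_op_converges:
  fixes T :: "nat \<Rightarrow> 'a::complex_hilbert_space op"
  assumes pos: "\<And>n. T n \<in> pos_op" and dec: "\<And>n x. qf (T (Suc n)) x \<le> qf (T n) x"
  obtains S where "S \<in> pos_op" "T \<down> S"
proof -
  have anti: "qf (T n) x \<le> qf (T m) x" if "m \<le> n" for m n x
    using that dec by (rule lift_Suc_antimono_le[where f = "\<lambda>n. qf (T n) x", rotated])
  define M where "M = norm (T 0)"
  have upper: "qf (T n) x \<le> M * (norm x)\<^sup>2" for n x
    using anti[of 0 n x] qf_bound[of "T 0" x] by (simp add: M_def)
  have herm: "herm_op (T n)" for n using pos by (rule pos_op_herm)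
  have diff: "(norm (T m x - T n x))\<^sup>2 \<le> M * (qf (T m) x - qf (T n) x)" if "m \<le> n" for m n x
  proof -
    have "(norm ((T m - T n) x))\<^sup>2 \<le> M * qf (T m - T n) x"
    proof (rule norm_sq_le_qf)
      show "sym_op (T m - T n)" by (intro herm_op_sym herm_op_intros herm)
      show "0 \<le> qf (T m - T n) x" for x using anti[OF that] by (simp add: qf_simps)
      show "qf (T m - T n) x \<le> M * (norm x)\<^sup>2" for x
        using upper[of m x] pos_op_nonneg[OF pos, of n x] by (simp add: qf_simps)
    qed
    then show ?thesis by (simp add: qf_simps minus_blinfun.rep_eq)
  qed
  have "convergent (\<lambda>n. T n x)" for x
  proof -
    have "convergent (\<lambda>n. qf (T n) x)"
      by (rule Bseq_monoseq_convergent[OF BseqI'[of _ "M * (norm x)\<^sup>2"]])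
        (use upper pos_op_nonneg[OF pos] in \<open>auto simp: monoseq_def anti\<close>)
    then have cau: "Cauchy (\<lambda>n. qf (T n) x)" by (rule convergent_Cauchy)
    have "Cauchy (\<lambda>n. T n x)"
    proof (rule CauchyI')
      fix e :: real assume "e > 0"
      \<comment> \<open>\<open>M\<close> is a norm and may be \<open>0\<close>, hence the
        denominator \<open>M + 1\<close>.\<close>
      define d where "d = e\<^sup>2 / (M + 1)"
      have M: "0 \<le> M" by (simp add: M_def)
      then have "d > 0" using \<open>e > 0\<close> by (simp add: d_def)
      then obtain N where N: "\<And>m n. N \<le> m \<Longrightarrow> N \<le> n \<Longrightarrow> norm (qf (T m) x - qf (T n) x) < d"
        using CauchyD[OF cau] by blast
      have "dist (T m x) (T n x) < e" if "N \<le> m" "m < n" for m n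
      proof -
        have "(norm (T m x - T n x))\<^sup>2 \<le> M * (qf (T m) x - qf (T n) x)" using that by (intro diff) simp
        also have "\<dots> \<le> M * d" using N[of m n] that M by (intro mult_left_mono) auto
        also have "\<dots> < (M + 1) * d" using \<open>d > 0\<close> by simp
        also have "\<dots> = e\<^sup>2" using M by (simp add: d_def)
        finally show ?thesis unfolding dist_norm by (rule power2_less_imp_less) (use \<open>e > 0\<close> in simp)
      qed
      then show "\<exists>N. \<forall>m\<ge>N. \<forall>n>m. dist (T m x) (T n x) < e" by blast
    qed
    then show ?thesis by (rule Cauchy_convergent)
  qed
  then have lim: "(\<lambda>n. T n x) \<longlonglongrightarrow> lim (\<lambda>n. T n x)" for x by (simp add: convergent_LIMSEQ_iff)
  have bounded: "norm (T n x) \<le> M * norm x" for n x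
  proof (rule power2_le_imp_le)
    have "(norm (T n x))\<^sup>2 \<le> M * qf (T n) x"
      by (rule norm_sq_le_qf[OF pos_op_sym[OF pos] pos_op_nonneg[OF pos] upper])
    also have "\<dots> \<le> M * (M * (norm x)\<^sup>2)" by (intro mult_left_mono upper) (simp add: M_def)
    finally show "(norm (T n x))\<^sup>2 \<le> (M * norm x)\<^sup>2" by (simp add: power2_eq_square ac_simps)
  qed (simp add: M_def)
  have "bounded_linear (\<lambda>x. lim (\<lambda>n. T n x))"
  proof (rule bounded_linear_intro)
    fix x y
    have "(\<lambda>n. T n (x + y)) \<longlonglongrightarrow> lim (\<lambda>n. T n x) + lim (\<lambda>n. T n y)"
      unfolding blinfun.add_right by (intro tendsto_add lim)
    then show "lim (\<lambda>n. T n (x + y)) = lim (\<lambda>n. T n x) + lim (\<lambda>n. T n y)" by (rule limI)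
  next
    fix t :: real and x
    have "(\<lambda>n. T n (t *\<^sub>R x)) \<longlonglongrightarrow> t *\<^sub>R lim (\<lambda>n. T n x)"
      unfolding blinfun.scaleR_right by (intro tendsto_scaleR tendsto_const lim)
    then show "lim (\<lambda>n. T n (t *\<^sub>R x)) = t *\<^sub>R lim (\<lambda>n. T n x)" by (rule limI)
  next
    fix x
    show "norm (lim (\<lambda>n. T n x)) \<le> norm x * M"
      by (rule tendsto_upperbound[OF tendsto_norm[OF lim]])
        (use bounded in \<open>auto simp: mult.commute\<close>)
  qed
  then have S: "(\<lambda>n. T n x) \<longlonglongrightarrow> Blinfun (\<lambda>x. lim (\<lambda>n. T n x)) x" for x
    by (simp add: bounded_linear_Blinfun_apply lim)
  have "0 \<le> qf (Blinfun (\<lambda>x. lim (\<lambda>n. T n x))) x" for x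
    by (rule tendsto_lowerbound[OF tendsto_qf[OF S]]) (auto simp: pos_op_nonneg[OF pos])
  then have "Blinfun (\<lambda>x. lim (\<lambda>n. T n x)) \<in> pos_op"
    unfolding pos_op_iff using herm_op_limit[OF herm S] by simp
  moreover have "T \<down> Blinfun (\<lambda>x. lim (\<lambda>n. T n x))"
    unfolding decreases_to_def using S by (auto intro!: op_leI herm anti)
  ultimately show thesis by (rule that)
qed

text \<open>Polarization recovers \<open>ip\<close> from the forms, and \<open>Im_cinner\<close>
  expresses the imaginary part by \<open>ip\<close> as well, so the forms determine the weak
  limit.\<close>

lemma converges_weaklyI:
  assumes "\<And>n. herm_op (T n)" "herm_op S" and lim: "\<And>x. (\<lambda>n. qf (T n) x) \<longlonglongrightarrow> qf S x"
  shows "converges_weakly T S"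
  unfolding converges_weakly_def tendsto_complex_iff
proof (intro allI)
  have polar: "ip (A x) y = (qf A (x + y) - qf A (x - y)) / 4" if "herm_op A" for A :: "'a op" and x y
    using sym_opD[OF herm_op_sym[OF that], of y x] ip_commute[of y "A x"]
    by (simp add: qf_def blinfun.add_right blinfun.diff_right ip_simps)
  have "(\<lambda>n. ip (T n x) y) \<longlonglongrightarrow> ip (S x) y" for x y
    unfolding polar[OF assms(1)] polar[OF assms(2)] by (intro tendsto_intros lim) simp
  then show "((\<lambda>n. Re (cinner (T n x) y)) \<longlonglongrightarrow> Re (cinner (S x) y)) \<and>
      ((\<lambda>n. Im (cinner (T n x) y)) \<longlonglongrightarrow> Im (cinner (S x) y))" for x y
    unfolding Im_cinner unfolding ip_def by blast
qed

lemma scalar_op_apply: "scalar_op t x = t *\<^sub>R x"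
  by (simp add: scalar_op_def scaleR_blinfun.rep_eq)

lemma scalar_op_pos: "0 \<le> t \<Longrightarrow> scalar_op t \<in> pos_op"
  by (simp add: pos_op_iff herm_op_scalar qf_simps)

lemma pos_op_add: "A \<in> pos_op \<Longrightarrow> B \<in> pos_op \<Longrightarrow> A + B \<in> pos_op"
  by (simp add: pos_op_iff herm_op_add qf_simps)

lemma pos_op_scaleR: "0 \<le> t \<Longrightarrow> A \<in> pos_op \<Longrightarrow> t *\<^sub>R A \<in> pos_op"
  by (simp add: pos_op_iff herm_op_scaleR qf_simps)

section \<open>Affine bounds for means through their representing functions\<close>

text \<open>\<open>R\<close> is the square root of \<open>A\<close>, \<open>X\<close> is
  \<open>B\<close> conjugated by the inverse root, and \<open>Y\<close> is the image of
  \<open>X\<close> under \<open>f\<close>. The relations between the roots come from identities of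
  scalar functions on the spectrum of \<open>A\<close>, which is bounded away from
  \<open>0\<close>.\<close>

lemma mean_representation:
  fixes A B :: "'a::complex_hilbert_space op"
  assumes rep: "representing_function \<sigma> f" and A: "A \<in> pos_op" and B: "B \<in> pos_op"
    and inv: "op_invertible A"
  obtains R X Y where "sym_op R" "sym_op X" "op_spectrum X \<subseteq> {0..}"
    "R o\<^sub>L R = A" "R o\<^sub>L X o\<^sub>L R = B" "fun_calc X f Y" "\<sigma> A B = R o\<^sub>L Y o\<^sub>L R"
proof -
  interpret mean_function f using rep by (rule representing_mean_function)
  have symA: "sym_op A" and symB: "sym_op B" using A B by (auto intro: pos_op_sym)
  obtain \<delta> where \<delta>: "\<delta> > 0" "\<And>x. \<delta> * (norm x)\<^sup>2 \<le> qf A x"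
    using op_invertible_imp_qf_bounded_below[OF symA pos_op_nonneg[OF A] inv] by blast
  have subA: "op_spectrum A \<subseteq> {\<delta>..norm A}"
    using op_spectrum_subset[OF symA \<delta>(2), of "norm A"] qf_bound[of A] by (simp add: abs_le_iff)
  have c1: "continuous_on {\<delta>..norm A} sqrt" by (intro continuous_intros)
  have c2: "continuous_on {\<delta>..norm A} (\<lambda>t. 1 / sqrt t)" by (intro continuous_intros) (use \<delta> in auto)
  obtain R where R: "fun_calc A sqrt R" using fun_calc_exists[OF symA subA c1] .
  obtain R' where R': "fun_calc A (\<lambda>t. 1 / sqrt t) R'" using fun_calc_exists[OF symA subA c2] .
  have bd: "bounded (sqrt ` op_spectrum A)" "bounded ((\<lambda>t. 1 / sqrt t) ` op_spectrum A)"
    using bounded_subset[OF compact_imp_bounded[OF compact_continuous_image[OF c1 compact_Icc]] image_mono[OF subA]]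
      bounded_subset[OF compact_imp_bounded[OF compact_continuous_image[OF c2 compact_Icc]] image_mono[OF subA]]
    by simp_all
  have one: "fun_calc A (\<lambda>t. 1) id_blinfun"
    using fun_calc_cong[OF fun_calc_poly[of A "[:1:]"], of "\<lambda>t. 1"] by (simp add: poly_op_const)
  have ident: "fun_calc A (\<lambda>t. t) A"
    using fun_calc_cong[OF fun_calc_poly[of A "[:0, 1:]"], of "\<lambda>t. t"] by (simp add: poly_op_linear)
  have spec: "0 < t" if "t \<in> op_spectrum A" for t using that subA \<delta> by fastforce
  have RR: "R o\<^sub>L R = A"
    by (rule fun_calc_unique[OF symA fun_calc_mult[OF R R bd(1) bd(1)] ident])
      (use spec in \<open>force simp: less_imp_le\<close>)
  have RR': "R o\<^sub>L R' = id_blinfun"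
    by (rule fun_calc_unique[OF symA fun_calc_mult[OF R R' bd] one]) (use spec in force)
  have R'R: "R' o\<^sub>L R = id_blinfun"
    by (rule fun_calc_unique[OF symA fun_calc_mult[OF R' R bd(2,1)] one]) (use spec in force)
  have symR: "sym_op R" and symR': "sym_op R'"
    using fun_calc_sym[OF symA] R R' by auto
  define X where "X = R' o\<^sub>L B o\<^sub>L R'"
  have symX: "sym_op X" using symR' symB by (simp add: sym_op_def X_def)
  have "0 \<le> qf X x" for x
    using pos_op_nonneg[OF B, of "R' x"] sym_opD[OF symR', of "B (R' x)" x] by (simp add: X_def qf_def)
  then have specX: "op_spectrum X \<subseteq> {0..norm X}"
    using op_spectrum_subset[OF symX, of 0 "norm X"] qf_bound[of X] by (simp add: abs_le_iff)
  \<comment> \<open>\<open>B\<close> may be singular, so the spectrum of \<open>X\<close> may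
    contain \<open>0\<close>; continuity of \<open>f\<close> at \<open>0\<close> enters
    here.\<close>
  have "continuous_on {0..norm X} f"
    using continuous_on_nonneg by (rule continuous_on_subset) simp
  then obtain Y where Y: "fun_calc X f Y" using fun_calc_exists[OF symX specX] by blast
  have "\<sigma> A B = R o\<^sub>L Y o\<^sub>L R"
    using rep A B inv cfc_eqI[OF symA R] cfc_eqI[OF symA R'] cfc_eqI[OF symX Y]
    by (simp add: representing_function_def Let_def X_def)
  moreover have "R o\<^sub>L X o\<^sub>L R = B"
    using RR' R'R by (intro blinfun_eqI) (simp add: X_def compose_eq_id_iff)
  moreover have "op_spectrum X \<subseteq> {0..}" using specX by auto
  ultimately show thesis using symR symX RR Y by (intro that)
qed

lemma mean_le_linear_invertible:
  fixes A B :: "'a::complex_hilbert_space op"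
  assumes rep: "representing_function \<sigma> f" and A: "A \<in> pos_op" and B: "B \<in> pos_op"
    and inv: "op_invertible A" and le: "\<And>t. 0 \<le> t \<Longrightarrow> f t \<le> a + b * t"
  shows "qf (\<sigma> A B) x \<le> a * qf A x + b * qf B x"
proof -
  obtain R X Y where *: "sym_op R" "sym_op X" "op_spectrum X \<subseteq> {0..}"
    "R o\<^sub>L R = A" "R o\<^sub>L X o\<^sub>L R = B" "fun_calc X f Y" "\<sigma> A B = R o\<^sub>L Y o\<^sub>L R"
    using mean_representation[OF rep A B inv] .
  have "qf Y (R x) \<le> a * (norm (R x))\<^sup>2 + b * qf X (R x)"
    by (rule fun_calc_le_linear[OF *(2,6)]) (use le *(3) in auto)
  moreover have "qf (R o\<^sub>L Z o\<^sub>L R) x = qf Z (R x)" for Z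
    using sym_opD[OF *(1), of "Z (R x)" x] by (simp add: qf_def)
  moreover have "qf A x = (norm (R x))\<^sup>2"
    using sym_opD[OF *(1), of "R x" x] by (simp add: *(4)[symmetric] qf_def ip_self)
  ultimately show ?thesis using *(5,7) by metis
qed

lemma mean_eq_linear_invertible:
  fixes A B :: "'a::complex_hilbert_space op"
  assumes rep: "representing_function \<sigma> f" and A: "A \<in> pos_op" and B: "B \<in> pos_op"
    and inv: "op_invertible A" and eq: "\<And>t. 0 \<le> t \<Longrightarrow> f t = a + b * t"
  shows "\<sigma> A B = a *\<^sub>R A + b *\<^sub>R B"
proof -
  obtain R X Y where *: "sym_op R" "sym_op X" "op_spectrum X \<subseteq> {0..}"
    "R o\<^sub>L R = A" "R o\<^sub>L X o\<^sub>L R = B" "fun_calc X f Y" "\<sigma> A B = R o\<^sub>L Y o\<^sub>L R"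
    using mean_representation[OF rep A B inv] .
  have "Y = a *\<^sub>R id_blinfun + b *\<^sub>R X"
    unfolding poly_op_linear[symmetric]
    by (rule fun_calc_unique[OF *(2,6) fun_calc_poly]) (use eq *(3) in \<open>auto simp: mult.commute\<close>)
  then have "R o\<^sub>L Y o\<^sub>L R = a *\<^sub>R (R o\<^sub>L R) + b *\<^sub>R (R o\<^sub>L X o\<^sub>L R)"
    by (intro blinfun_eqI) (simp add: blinfun.bilinear_simps)
  then show ?thesis using *(4,5,7) by simp
qed

lemma decreases_toD: "T \<down> A \<Longrightarrow> (\<lambda>n. blinfun_apply (T n) x) \<longlonglongrightarrow> A x"
  unfolding decreases_to_def by simp

lemma decreases_to_add_scalar:
  assumes "A \<in> pos_op"
  shows "(\<lambda>n. A + scalar_op (1 / real (Suc n))) \<down> A"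
  unfolding decreases_to_def
proof (intro conjI allI impI)
  fix m n :: nat assume "m \<le> n"
  then show "A + scalar_op (1 / real (Suc n)) \<preceq> A + scalar_op (1 / real (Suc m))"
    using assms by (intro op_leI herm_op_intros pos_op_herm)
      (auto simp: qf_simps intro!: mult_right_mono divide_left_mono)
next
  fix x
  have "(\<lambda>n. A x + inverse (real (Suc n)) *\<^sub>R x) \<longlonglongrightarrow> A x + 0 *\<^sub>R x"
    by (intro tendsto_intros LIMSEQ_inverse_real_of_nat)
  then show "(\<lambda>n. (A + scalar_op (1 / real (Suc n))) x) \<longlonglongrightarrow> A x"
    by (simp add: blinfun.add_left scalar_op_apply inverse_eq_divide)
qed

lemma add_scalar_invertible: "A \<in> pos_op \<Longrightarrow> 0 < t \<Longrightarrow> op_invertible (A + scalar_op t)"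
  by (rule op_invertible_qf_pos[where \<delta> = t])
    (auto simp: qf_simps pos_op_nonneg intro!: pos_op_sym pos_op_add scalar_op_pos)

text \<open>The shift makes the first argument invertible, so that the representation applies;
  downward continuity then carries its consequences to all positive operators.\<close>

lemma mean_limit:
  assumes "operator_mean \<sigma>" "A \<in> pos_op" "B \<in> pos_op"
  shows "(\<lambda>n. \<sigma> (A + scalar_op (1 / real (Suc n))) (B + scalar_op (1 / real (Suc n))) x) \<longlonglongrightarrow> \<sigma> A B x"
proof -
  have pos: "C + scalar_op (1 / real (Suc n)) \<in> pos_op" if "C \<in> pos_op" for C :: "'a op" and n
    using that by (intro pos_op_add scalar_op_pos) auto
  have "\<forall>An Bn. \<forall>A\<in>pos_op. \<forall>B\<in>pos_op. (\<forall>n. An n \<in> pos_op \<and> Bn n \<in> pos_op) \<longrightarrow>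
       An \<down> A \<longrightarrow> Bn \<down> B \<longrightarrow> (\<lambda>n. \<sigma> (An n) (Bn n)) \<down> \<sigma> A B"
    using assms(1) unfolding operator_mean_def by (elim conjE)
  then have "(\<lambda>n. \<sigma> (A + scalar_op (1 / real (Suc n))) (B + scalar_op (1 / real (Suc n)))) \<down> \<sigma> A B"
    using assms(2,3) pos decreases_to_add_scalar[OF assms(2)] decreases_to_add_scalar[OF assms(3)]
    by (elim allE ballE impE; simp)
  then show ?thesis unfolding decreases_to_def by blast
qed

lemma mean_le_linear:
  fixes A B :: "'a::complex_hilbert_space op"
  assumes mean: "operator_mean \<sigma>" and rep: "representing_function \<sigma> f" and A: "A \<in> pos_op" and B: "B \<in> pos_op"
    and le: "\<And>t. 0 \<le> t \<Longrightarrow> f t \<le> a + b * t"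
  shows "qf (\<sigma> A B) x \<le> a * qf A x + b * qf B x"
proof (rule tendsto_le)
  let ?A = "\<lambda>n. A + scalar_op (1 / real (Suc n))"
  let ?B = "\<lambda>n. B + scalar_op (1 / real (Suc n))"
  show "(\<lambda>n. qf (\<sigma> (?A n) (?B n)) x) \<longlonglongrightarrow> qf (\<sigma> A B) x"
    by (rule tendsto_qf[OF mean_limit[OF mean A B]])
  show "(\<lambda>n. a * qf (?A n) x + b * qf (?B n) x) \<longlonglongrightarrow> a * qf A x + b * qf B x"
    by (intro tendsto_add tendsto_mult tendsto_const tendsto_qf decreases_toD decreases_to_add_scalar A B)
  show "\<forall>\<^sub>F n in sequentially. qf (\<sigma> (?A n) (?B n)) x \<le> a * qf (?A n) x + b * qf (?B n) x"
    using A B le by (intro always_eventually allI mean_le_linear_invertible[OF rep]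
        pos_op_add scalar_op_pos add_scalar_invertible) auto
qed simp

lemma mean_eq_linear:
  fixes A B :: "'a::complex_hilbert_space op"
  assumes mean: "operator_mean \<sigma>" and rep: "representing_function \<sigma> f" and A: "A \<in> pos_op" and B: "B \<in> pos_op"
    and eq: "\<And>t. 0 \<le> t \<Longrightarrow> f t = a + b * t"
  shows "\<sigma> A B = a *\<^sub>R A + b *\<^sub>R B"
proof (rule blinfun_eqI)
  fix x
  let ?A = "\<lambda>n. A + scalar_op (1 / real (Suc n))"
  let ?B = "\<lambda>n. B + scalar_op (1 / real (Suc n))"
  have "\<sigma> (?A n) (?B n) = a *\<^sub>R ?A n + b *\<^sub>R ?B n" for n
    using A B eq by (intro mean_eq_linear_invertible[OF rep]
        pos_op_add scalar_op_pos add_scalar_invertible) auto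
  then have "\<sigma> (?A n) (?B n) x = a *\<^sub>R ?A n x + b *\<^sub>R ?B n x" for n
    by (simp add: plus_blinfun.rep_eq scaleR_blinfun.rep_eq)
  moreover have "(\<lambda>n. a *\<^sub>R ?A n x + b *\<^sub>R ?B n x) \<longlonglongrightarrow> a *\<^sub>R A x + b *\<^sub>R B x"
    by (intro tendsto_add tendsto_scaleR tendsto_const decreases_toD decreases_to_add_scalar A B)
  ultimately have "\<sigma> A B x = a *\<^sub>R A x + b *\<^sub>R B x"
    using mean_limit[OF mean A B, of x] by (simp add: LIMSEQ_unique)
  then show "\<sigma> A B x = (a *\<^sub>R A + b *\<^sub>R B) x"
    by (simp add: plus_blinfun.rep_eq scaleR_blinfun.rep_eq)
qed

lemma fun_calc_scalar:
  "fun_calc (scalar_op t :: 'a::complex_hilbert_space op) f (scalar_op (f t))"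
proof -
  have "op_spectrum (scalar_op t :: 'a op) \<subseteq> {t..t}"
    by (rule op_spectrum_subset[OF sym_op_scalar]) (simp_all add: qf_simps)
  then have "fun_calc (scalar_op t :: 'a op) f (poly_op [:f t:] (scalar_op t))"
    by (intro fun_calc_cong[OF fun_calc_poly]) auto
  then show ?thesis by (simp add: poly_op_const scalar_op_def)
qed

lemma mean_scalar:
  fixes \<sigma> :: "'a::complex_hilbert_space op \<Rightarrow> 'a op \<Rightarrow> 'a op"
  assumes rep: "representing_function \<sigma> f" and "0 < a" "0 \<le> b"
  shows "\<sigma> (scalar_op a) (scalar_op b) = scalar_op (a * f (b / a))"
proof -
  have cfc: "cfc g (scalar_op t) = (scalar_op (g t) :: 'a op)" for g t
    by (rule cfc_eqI[OF sym_op_scalar fun_calc_scalar])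
  have comp: "scalar_op s o\<^sub>L scalar_op t = (scalar_op (s * t) :: 'a op)" for s t
    by (rule blinfun_eqI) (simp add: scalar_op_apply)
  have "op_invertible (scalar_op a :: 'a op)"
    by (rule op_invertible_qf_pos[OF sym_op_scalar, of a]) (simp_all add: qf_simps \<open>0 < a\<close>)
  moreover have sq: "sqrt a * c * sqrt a = a * c" "1 / sqrt a * b * (1 / sqrt a) = b / a" for c using \<open>0 < a\<close>
    by (simp_all add: mult.commute mult.left_commute)
  moreover have "\<forall>A\<in>pos_op. \<forall>B\<in>pos_op. op_invertible A \<longrightarrow>
      \<sigma> A B = cfc sqrt A o\<^sub>L cfc f (cfc (\<lambda>t. 1 / sqrt t) A o\<^sub>L B o\<^sub>L cfc (\<lambda>t. 1 / sqrt t) A) o\<^sub>L cfc sqrt A"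
    using rep unfolding representing_function_def Let_def by (elim conjE)
  moreover have "scalar_op a \<in> pos_op" "scalar_op b \<in> pos_op" using assms by (auto intro: scalar_op_pos)
  ultimately have "\<sigma> (scalar_op a) (scalar_op b) = cfc sqrt (scalar_op a) o\<^sub>L
      cfc f (cfc (\<lambda>t. 1 / sqrt t) (scalar_op a) o\<^sub>L scalar_op b o\<^sub>L cfc (\<lambda>t. 1 / sqrt t) (scalar_op a))
      o\<^sub>L cfc sqrt (scalar_op a)" by blast
  then show ?thesis by (simp only: cfc comp sq)
qed


lemma scalar_op_eq_iff:
  assumes "\<exists>x::'a::complex_hilbert_space. x \<noteq> 0"
  shows "(scalar_op s :: 'a op) = scalar_op t \<longleftrightarrow> s = t"
proof
  assume eq: "(scalar_op s :: 'a op) = scalar_op t"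
  obtain x :: 'a where "x \<noteq> 0" using assms by blast
  moreover have "s *\<^sub>R x = t *\<^sub>R x" using eq by (metis scalar_op_apply)
  ultimately show "s = t" by simp
qed simp

section \<open>Weight, tangent bound and gap of a mean\<close>

locale weighted_mean =
  fixes \<sigma> :: "'a::complex_hilbert_space op \<Rightarrow> 'a op \<Rightarrow> 'a op" and w :: real
  assumes nonzero: "\<exists>x::'a. x \<noteq> 0"
    and mean: "operator_mean \<sigma>"
    and repr: "\<exists>f. representing_function \<sigma> f"
    and nontriv: "nontrivial_mean \<sigma>"
    and w_def: "w = weight \<sigma>"
begin

text \<open>The same choice as in \<open>weight\<close>, so that \<open>w\<close> is the derivative
  of this very function.\<close>

definition f :: "real \<Rightarrow> real" where
  "f = (SOME f. representing_function \<sigma> f)"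

lemma rep: "representing_function \<sigma> f"
  unfolding f_def using repr by (rule someI_ex)

sublocale mean_function f
  using rep by (rule representing_mean_function)

lemma w_eq: "w = r"
  unfolding w_def weight_def f_def[symmetric] by (rule DERIV_imp_deriv[OF deriv_one])

lemma deriv_w: "(f has_real_derivative w) (at 1)"
  using deriv_one by (simp add: w_eq)

lemma w_pos: "0 < w"
proof (rule ccontr)
  assume "\<not> 0 < w"
  then have "f t = 1 + 0 * t" if "0 \<le> t" for t
    using const_if_r_zero[OF _ that] r_nonneg by (simp add: w_eq)
  from mean_eq_linear[OF mean rep _ _ this] show False
    using nontriv unfolding nontrivial_mean_def by simp
qed

lemma w_less_one: "w < 1"
proof (rule ccontr)
  assume "\<not> w < 1"
  then have "f t = 0 + 1 * t" if "0 \<le> t" for t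
    using id_if_r_one[OF _ that] r_le_one by (simp add: w_eq)
  from mean_eq_linear[OF mean rep _ _ this] show False
    using nontriv unfolding nontrivial_mean_def by simp
qed

lemma pos_op_mean: "A \<in> pos_op \<Longrightarrow> B \<in> pos_op \<Longrightarrow> \<sigma> A B \<in> pos_op"
  using mean unfolding operator_mean_def by simp

lemma scalar: "0 < a \<Longrightarrow> 0 \<le> b \<Longrightarrow> \<sigma> (scalar_op a) (scalar_op b) = scalar_op (a * f (b / a))"
  by (rule mean_scalar[OF rep])

lemma le_arithmetic:
  assumes "A \<in> pos_op" "B \<in> pos_op"
  shows "qf (\<sigma> A B) x \<le> (1 - w) * qf A x + w * qf B x"
  using mean_le_linear[OF mean rep assms, of "1 - w" w x] le_tangent
  by (simp add: w_eq algebra_simps)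

text \<open>The constant \<open>s\<close> in \<open>arithmetic_mean\<close> is not tied to the
  weight by definition. Scalar arguments identify \<open>f\<close> with the line of slope
  \<open>s\<close> through \<open>1\<close>, and differentiation at \<open>1\<close> gives
  \<open>s = w\<close>.\<close>

lemma eq_arithmetic:
  assumes "arithmetic_mean \<sigma>" "A \<in> pos_op" "B \<in> pos_op"
  shows "\<sigma> A B = (1 - w) *\<^sub>R A + w *\<^sub>R B"
proof -
  obtain s where s: "\<And>A B. A \<in> pos_op \<Longrightarrow> B \<in> pos_op \<Longrightarrow> \<sigma> A B = (1 - s) *\<^sub>R A + s *\<^sub>R B"
    using assms(1) unfolding arithmetic_mean_def by blast
  have f: "f t = 1 + s * (t - 1)" if "0 \<le> t" for t
  proof -
    have "scalar_op (1 * f (t / 1)) = \<sigma> (scalar_op 1) (scalar_op t)" using that by (intro scalar[symmetric]) auto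
    also have "\<dots> = (1 - s) *\<^sub>R scalar_op 1 + s *\<^sub>R scalar_op t"
      using that by (intro s scalar_op_pos) auto
    also have "\<dots> = scalar_op ((1 - s) * 1 + s * t)"
      by (simp add: scalar_op_def scaleR_add_left)
    finally show ?thesis unfolding scalar_op_eq_iff[OF nonzero] by (simp add: algebra_simps)
  qed
  have "((\<lambda>t. 1 + s * (t - 1)) has_real_derivative s) (at 1)"
    by (auto intro!: derivative_eq_intros)
  then have "(f has_real_derivative s) (at 1)"
  proof (rule has_field_derivative_transform_within_open)
    show "1 + s * (t - 1) = f t" if "t \<in> {0<..}" for t using f[of t] that by simp
  qed auto
  then have "s = w" using deriv_w by (rule DERIV_unique)
  then show ?thesis using s assms by simp
qed

text \<open>By the arithmetic-geometric mean inequality, \<open>(t - 1)\<^sup>2 / (1 + t) \<ge> 2 s (t - 1) - s\<^sup>2 (1 + t)\<close>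
  for all \<open>s\<close>, so the quadratic gap of the representing function yields a family of affine
  majorants; optimizing over \<open>s\<close> gives the quadratic gap of the mean.\<close>

lemma strict_gap:
  assumes "strictly_concave \<sigma>"
  shows "\<exists>k>0. \<forall>A\<in>pos_op. \<forall>B\<in>pos_op. \<forall>x.
    k * (qf B x - qf A x)\<^sup>2 \<le> (qf A x + qf B x) * ((1 - w) * qf A x + w * qf B x - qf (\<sigma> A B) x)"
proof -
  have "f 2 \<noteq> 1 + w"
  proof
    assume "f 2 = 1 + w"
    moreover have "\<sigma> (scalar_op 1) (scalar_op 2) = scalar_op (1 * f (2 / 1))" by (intro scalar) auto
    ultimately have "\<sigma> (scalar_op 1) (scalar_op 2) = scalar_op ((1 - w) * 1 + w * 2)" by (simp add: add.commute)
    then have "(1::real) = 2"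
      using assms unfolding strictly_concave_def w_def[symmetric]
      by (metis zero_le_numeral zero_le_one)
    then show False by simp
  qed
  then have "f 2 < 1 + r" using le_tangent[of 2] by (simp add: w_eq)
  then obtain k where k: "0 < k" "\<And>t. 0 \<le> t \<Longrightarrow> f t \<le> 1 + r * (t - 1) - k * ((t - 1)\<^sup>2 / (1 + t))"
    using quadratic_gap w_pos w_eq by metis
  show ?thesis
  proof (intro exI[of _ k] conjI ballI allI k(1))
    fix A B :: "'a op" and x
    assume AB: "A \<in> pos_op" "B \<in> pos_op"
    define a b where "a = qf A x" and "b = qf B x"
    define D where "D = (1 - w) * a + w * b - qf (\<sigma> A B) x"
    \<comment> \<open>Each \<open>s\<close> gives one affine bound, hence one value of a quadratic
      polynomial in \<open>s\<close>; its discriminant takes the best \<open>s\<close> and covers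
      \<open>a + b = 0\<close> as well.\<close>
    have "0 \<le> D + 2 * (- (k * (b - a))) * s + (k * (a + b)) * s\<^sup>2" for s
    proof -
      have le: "f t \<le> (1 - w + 2 * k * s + k * s\<^sup>2) + (w - 2 * k * s + k * s\<^sup>2) * t" if "0 \<le> t" for t
      proof -
        have "0 \<le> ((t - 1) - s * (1 + t))\<^sup>2 / (1 + t)" using that by simp
        also have "\<dots> = (t - 1)\<^sup>2 / (1 + t) - (2 * s * (t - 1) - s\<^sup>2 * (1 + t))"
          using that by (simp add: field_simps power2_eq_square)
        finally have "k * (2 * s * (t - 1) - s\<^sup>2 * (1 + t)) \<le> k * ((t - 1)\<^sup>2 / (1 + t))"
          using k(1) by (intro mult_left_mono) auto
        then have "f t \<le> 1 + w * (t - 1) - k * (2 * s * (t - 1) - s\<^sup>2 * (1 + t))"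
          using k(2)[OF that] by (simp add: w_eq)
        then show ?thesis by (simp add: algebra_simps)
      qed
      show ?thesis
        using mean_le_linear[OF mean rep AB le, of x]
        by (simp add: D_def a_def b_def algebra_simps)
    qed
    moreover have "0 \<le> k * (a + b)" using k(1) AB by (simp add: a_def b_def pos_op_nonneg)
    ultimately have "(- (k * (b - a)))\<^sup>2 \<le> D * (k * (a + b))" by (rule quadratic_nonneg_discrim)
    then have "k * (k * (b - a)\<^sup>2) \<le> k * ((a + b) * D)" by (simp add: power2_eq_square ac_simps)
    then show "k * (qf B x - qf A x)\<^sup>2 \<le> (qf A x + qf B x) * ((1 - w) * qf A x + w * qf B x - qf (\<sigma> A B) x)"
      using k(1) by (simp add: a_def b_def D_def)
  qed
qed

end

section \<open>Iteration of three means\<close>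

lemma square_bound_null:
  fixes u v D :: "nat \<Rightarrow> real"
  assumes "0 < k" and bound: "\<And>n. k * (v n - u n)\<^sup>2 \<le> (u n + v n) * D n"
    and "\<And>n. u n + v n \<le> K" "\<And>n. 0 \<le> D n" and D: "D \<longlonglongrightarrow> 0"
  shows "(\<lambda>n. v n - u n) \<longlonglongrightarrow> 0"
proof -
  have "(v n - u n)\<^sup>2 \<le> K / k * D n" for n
  proof -
    have "k * (v n - u n)\<^sup>2 \<le> K * D n"
      using bound[of n] mult_right_mono[OF assms(3,4), of n n] by linarith
    then have "(v n - u n)\<^sup>2 * k \<le> K * D n" by (simp only: mult.commute)
    then have "(v n - u n)\<^sup>2 \<le> K * D n / k" by (simp only: pos_le_divide_eq[OF \<open>0 < k\<close>])
    then show ?thesis by simp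
  qed
  note le = this
  have null: "(\<lambda>n. K / k * D n) \<longlonglongrightarrow> 0" by (rule tendsto_mult_right_zero[OF D])
  have "(\<lambda>n. (v n - u n)\<^sup>2) \<longlonglongrightarrow> 0"
    by (rule tendsto_sandwich[OF _ _ tendsto_const null]) (simp, rule always_eventually, rule allI, rule le)
  then show ?thesis by (simp add: power_tendsto_0_iff)
qed

lemma weighted_decrements_null:
  fixes D :: "nat \<Rightarrow> real"
  assumes "0 < p" "\<And>n. 0 \<le> D n" "\<And>n. p * D n \<le> V n - V (Suc n)" "V \<longlonglongrightarrow> L"
  shows "D \<longlonglongrightarrow> 0"
proof (rule tendsto_sandwich[OF _ _ tendsto_const])
  have "(\<lambda>n. (V n - V (Suc n)) / p) \<longlonglongrightarrow> (L - L) / p"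
    using assms(1,4) by (intro tendsto_intros LIMSEQ_Suc) auto
  then show "(\<lambda>n. (V n - V (Suc n)) / p) \<longlonglongrightarrow> 0" by simp
  have "D n \<le> (V n - V (Suc n)) / p" for n
    using assms(3)[of n] by (simp only: pos_le_divide_eq[OF assms(1)] mult.commute)
  then show "\<forall>\<^sub>F n in sequentially. D n \<le> (V n - V (Suc n)) / p" by simp
qed (use assms in simp)

section \<open>Sums weighted by a stationary vector\<close>

text \<open>Stationarity regroups the coefficients of \<open>a\<close>, \<open>b\<close> and
  \<open>c\<close> in the weighted sum of the three arithmetic means. The primed numbers are
  arbitrary, so the identity applies to squares too.\<close>

lemma stationary_sum:
  fixes p\<^sub>1 p\<^sub>2 p\<^sub>3 :: real
  assumes st: "p\<^sub>1 = p\<^sub>2 * w\<^sub>2 + p\<^sub>3 * (1 - w\<^sub>3)" "p\<^sub>2 = p\<^sub>1 * (1 - w\<^sub>1) + p\<^sub>3 * w\<^sub>3"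
    "p\<^sub>3 = p\<^sub>1 * w\<^sub>1 + p\<^sub>2 * (1 - w\<^sub>2)"
  shows "p\<^sub>1 * ((1 - w\<^sub>1) * b + w\<^sub>1 * c - a') + p\<^sub>2 * ((1 - w\<^sub>2) * c + w\<^sub>2 * a - b') + p\<^sub>3 * ((1 - w\<^sub>3) * a + w\<^sub>3 * b - c')
    = (p\<^sub>1 * a + p\<^sub>2 * b + p\<^sub>3 * c) - (p\<^sub>1 * a' + p\<^sub>2 * b' + p\<^sub>3 * c')"
proof -
  have "p\<^sub>1 * a = (p\<^sub>2 * w\<^sub>2 + p\<^sub>3 * (1 - w\<^sub>3)) * a" "p\<^sub>2 * b = (p\<^sub>1 * (1 - w\<^sub>1) + p\<^sub>3 * w\<^sub>3) * b"
    "p\<^sub>3 * c = (p\<^sub>1 * w\<^sub>1 + p\<^sub>2 * (1 - w\<^sub>2)) * c"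
    by (rule arg_cong[where f = "\<lambda>t. t * _"], rule st)+
  then show ?thesis by (simp only: left_diff_distrib right_diff_distrib distrib_left distrib_right mult.assoc)
qed

text \<open>Each term is the variance of a two-point distribution, the mean of the squares minus the
  square of the mean; \<open>stationary_sum\<close> adds them up.\<close>

lemma stationary_square_sum:
  fixes p\<^sub>1 p\<^sub>2 p\<^sub>3 :: real
  assumes st: "p\<^sub>1 = p\<^sub>2 * w\<^sub>2 + p\<^sub>3 * (1 - w\<^sub>3)" "p\<^sub>2 = p\<^sub>1 * (1 - w\<^sub>1) + p\<^sub>3 * w\<^sub>3"
    "p\<^sub>3 = p\<^sub>1 * w\<^sub>1 + p\<^sub>2 * (1 - w\<^sub>2)"
  shows "p\<^sub>1 * (w\<^sub>1 * (1 - w\<^sub>1)) * (c - b)\<^sup>2 + p\<^sub>2 * (w\<^sub>2 * (1 - w\<^sub>2)) * (a - c)\<^sup>2 + p\<^sub>3 * (w\<^sub>3 * (1 - w\<^sub>3)) * (b - a)\<^sup>2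
    = (p\<^sub>1 * a\<^sup>2 + p\<^sub>2 * b\<^sup>2 + p\<^sub>3 * c\<^sup>2) - (p\<^sub>1 * ((1 - w\<^sub>1) * b + w\<^sub>1 * c)\<^sup>2
      + p\<^sub>2 * ((1 - w\<^sub>2) * c + w\<^sub>2 * a)\<^sup>2 + p\<^sub>3 * ((1 - w\<^sub>3) * a + w\<^sub>3 * b)\<^sup>2)"
proof -
  have "w * (1 - w) * (z - y)\<^sup>2 = (1 - w) * y\<^sup>2 + w * z\<^sup>2 - ((1 - w) * y + w * z)\<^sup>2" for w y z :: real
    by (simp add: power2_eq_square algebra_simps)
  then show ?thesis
    unfolding mult.assoc[of "p\<^sub>1"] mult.assoc[of "p\<^sub>2"] mult.assoc[of "p\<^sub>3"]
    by (simp only: stationary_sum[OF st])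
qed

locale three_means =
  m1: weighted_mean \<sigma>\<^sub>1 w\<^sub>1 + m2: weighted_mean \<sigma>\<^sub>2 w\<^sub>2 + m3: weighted_mean \<sigma>\<^sub>3 w\<^sub>3
  for \<sigma>\<^sub>1 \<sigma>\<^sub>2 \<sigma>\<^sub>3 :: "'a::complex_hilbert_space op \<Rightarrow> 'a op \<Rightarrow> 'a op" and w\<^sub>1 w\<^sub>2 w\<^sub>3 :: real
begin

text \<open>The vector is fixed, acting from the left, by the stochastic matrix with rows
  \<open>(0, 1 - w\<^sub>1, w\<^sub>1)\<close>, \<open>(w\<^sub>2, 0, 1 - w\<^sub>2)\<close> and
  \<open>(1 - w\<^sub>3, w\<^sub>3, 0)\<close>, one row for each mean.\<close>

definition stationary :: "real \<Rightarrow> real \<Rightarrow> real \<Rightarrow> bool" where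
  "stationary p\<^sub>1 p\<^sub>2 p\<^sub>3 \<longleftrightarrow>
    p\<^sub>1 = p\<^sub>2 * w\<^sub>2 + p\<^sub>3 * (1 - w\<^sub>3) \<and> p\<^sub>2 = p\<^sub>1 * (1 - w\<^sub>1) + p\<^sub>3 * w\<^sub>3 \<and> p\<^sub>3 = p\<^sub>1 * w\<^sub>1 + p\<^sub>2 * (1 - w\<^sub>2)"

definition iterates :: "(nat \<Rightarrow> 'a op) \<Rightarrow> (nat \<Rightarrow> 'a op) \<Rightarrow> (nat \<Rightarrow> 'a op) \<Rightarrow> bool" where
  "iterates A B C \<longleftrightarrow> A 0 \<in> pos_op \<and> B 0 \<in> pos_op \<and> C 0 \<in> pos_op \<and>
    (\<forall>n. A (Suc n) = \<sigma>\<^sub>1 (B n) (C n) \<and> B (Suc n) = \<sigma>\<^sub>2 (C n) (A n) \<and> C (Suc n) = \<sigma>\<^sub>3 (A n) (B n))"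

lemma iterates_pos:
  assumes "iterates A B C"
  shows "A n \<in> pos_op" "B n \<in> pos_op" "C n \<in> pos_op"
proof -
  have "A n \<in> pos_op \<and> B n \<in> pos_op \<and> C n \<in> pos_op"
  proof (induction n)
    case 0
    then show ?case using assms by (simp add: iterates_def)
  next
    case (Suc n)
    then show ?case
      using assms m1.pos_op_mean m2.pos_op_mean m3.pos_op_mean by (simp add: iterates_def)
  qed
  then show "A n \<in> pos_op" "B n \<in> pos_op" "C n \<in> pos_op" by auto
qed

lemma iterates_Suc:
  assumes "iterates A B C"
  shows "A (Suc n) = \<sigma>\<^sub>1 (B n) (C n)" "B (Suc n) = \<sigma>\<^sub>2 (C n) (A n)" "C (Suc n) = \<sigma>\<^sub>3 (A n) (B n)"
  using assms by (simp_all add: iterates_def)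

section \<open>Convergence of the three sequences\<close>

lemma stationary_converges:
  assumes p: "0 < p\<^sub>1" "0 < p\<^sub>2" "0 < p\<^sub>3" "p\<^sub>1 + p\<^sub>2 + p\<^sub>3 = 1" "stationary p\<^sub>1 p\<^sub>2 p\<^sub>3"
    and dichotomy:
      "(arithmetic_mean \<sigma>\<^sub>1 \<and> arithmetic_mean \<sigma>\<^sub>2 \<and> arithmetic_mean \<sigma>\<^sub>3) \<or>
       (strictly_concave \<sigma>\<^sub>1 \<and> strictly_concave \<sigma>\<^sub>2) \<or>
       (strictly_concave \<sigma>\<^sub>1 \<and> strictly_concave \<sigma>\<^sub>3) \<or>
       (strictly_concave \<sigma>\<^sub>2 \<and> strictly_concave \<sigma>\<^sub>3)"
    and it: "iterates A B C"
  shows "\<exists>S\<in>pos_op. converges_weakly A S \<and> converges_weakly B S \<and> converges_weakly C S \<and>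
    (\<lambda>n. p\<^sub>1 *\<^sub>R A n + p\<^sub>2 *\<^sub>R B n + p\<^sub>3 *\<^sub>R C n) \<down> S"
proof -
  note pos = iterates_pos[OF it] and step = iterates_Suc[OF it]
  have st: "p\<^sub>1 = p\<^sub>2 * w\<^sub>2 + p\<^sub>3 * (1 - w\<^sub>3)" "p\<^sub>2 = p\<^sub>1 * (1 - w\<^sub>1) + p\<^sub>3 * w\<^sub>3"
    "p\<^sub>3 = p\<^sub>1 * w\<^sub>1 + p\<^sub>2 * (1 - w\<^sub>2)"
    using p(5) unfolding stationary_def by blast+
  define T where "T n = p\<^sub>1 *\<^sub>R A n + p\<^sub>2 *\<^sub>R B n + p\<^sub>3 *\<^sub>R C n" for n
  define a b c where "a x n = qf (A n) x" and "b x n = qf (B n) x" and "c x n = qf (C n) x" for x n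
  have nn: "0 \<le> a x n" "0 \<le> b x n" "0 \<le> c x n" for x n
    by (simp_all add: a_def b_def c_def pos pos_op_nonneg)
  have qT: "qf (T n) x = p\<^sub>1 * a x n + p\<^sub>2 * b x n + p\<^sub>3 * c x n" for n x
    by (simp add: T_def a_def b_def c_def qf_simps)
  define D1 D2 D3 where "D1 x n = (1 - w\<^sub>1) * b x n + w\<^sub>1 * c x n - a x (Suc n)"
    and "D2 x n = (1 - w\<^sub>2) * c x n + w\<^sub>2 * a x n - b x (Suc n)"
    and "D3 x n = (1 - w\<^sub>3) * a x n + w\<^sub>3 * b x n - c x (Suc n)" for x n
  have D: "0 \<le> D1 x n" "0 \<le> D2 x n" "0 \<le> D3 x n" for x n
    using m1.le_arithmetic[OF pos(2,3), of n n x] m2.le_arithmetic[OF pos(3,1), of n n x]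
      m3.le_arithmetic[OF pos(1,2), of n n x]
    by (simp_all add: D1_def D2_def D3_def a_def b_def c_def step)
  have dec: "p\<^sub>1 * D1 x n + p\<^sub>2 * D2 x n + p\<^sub>3 * D3 x n = qf (T n) x - qf (T (Suc n)) x" for x n
    unfolding qT D1_def D2_def D3_def by (rule stationary_sum[OF st])
  have Tpos: "T n \<in> pos_op" for n
    unfolding T_def using p pos by (intro pos_op_add pos_op_scaleR) auto
  have pD: "0 \<le> p\<^sub>1 * D1 x n" "0 \<le> p\<^sub>2 * D2 x n" "0 \<le> p\<^sub>3 * D3 x n" for x n
    using p(1-3) D[of x n] by (auto intro: mult_nonneg_nonneg less_imp_le)
  have Tdec: "qf (T (Suc n)) x \<le> qf (T n) x" for n x
  proof -
    have "0 \<le> p\<^sub>1 * D1 x n + p\<^sub>2 * D2 x n + p\<^sub>3 * D3 x n" by (intro add_nonneg_nonneg pD)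
    then show ?thesis unfolding dec by simp
  qed
  obtain S where S: "S \<in> pos_op" "T \<down> S"
    by (rule decreasing_pos_op_converges[of T, OF Tpos Tdec]) (rule that)
  have qlim: "(\<lambda>n. qf (T n) x) \<longlonglongrightarrow> qf S x" for x
    by (intro tendsto_qf decreases_toD S)
  have Dlim: "D1 x \<longlonglongrightarrow> 0" "D2 x \<longlonglongrightarrow> 0" "D3 x \<longlonglongrightarrow> 0" for x
  proof -
    have le: "p\<^sub>1 * D1 x n \<le> qf (T n) x - qf (T (Suc n)) x" "p\<^sub>2 * D2 x n \<le> qf (T n) x - qf (T (Suc n)) x"
      "p\<^sub>3 * D3 x n \<le> qf (T n) x - qf (T (Suc n)) x" for n
      using dec[of x n] pD[of x n] by linarith+
    show "D1 x \<longlonglongrightarrow> 0" by (rule weighted_decrements_null[OF p(1) D(1) le(1) qlim])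
    show "D2 x \<longlonglongrightarrow> 0" by (rule weighted_decrements_null[OF p(2) D(2) le(2) qlim])
    show "D3 x \<longlonglongrightarrow> 0" by (rule weighted_decrements_null[OF p(3) D(3) le(3) qlim])
  qed
  have anti: "qf (T n) x \<le> qf (T 0) x" for n x
    by (rule lift_Suc_antimono_le[where f = "\<lambda>n. qf (T n) x"]) (simp_all add: Tdec)
  \<comment> \<open>Each form is at most the initial weighted sum divided by its own positive
    weight.\<close>
  define K where "K x = qf (T 0) x / p\<^sub>1 + qf (T 0) x / p\<^sub>2 + qf (T 0) x / p\<^sub>3" for x
  have bd: "a x n + b x n + c x n \<le> K x" for x n
  proof -
    have "0 \<le> p\<^sub>1 * a x n" "0 \<le> p\<^sub>2 * b x n" "0 \<le> p\<^sub>3 * c x n" using nn p by simp_all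
    then have "p\<^sub>1 * a x n \<le> qf (T 0) x" "p\<^sub>2 * b x n \<le> qf (T 0) x" "p\<^sub>3 * c x n \<le> qf (T 0) x"
      using anti[of n x] qT[of n x] by linarith+
    then show ?thesis using p unfolding K_def
      by (intro add_mono) (simp_all add: le_divide_eq mult.commute)
  qed
  have s1: "(\<lambda>n. c x n - b x n) \<longlonglongrightarrow> 0" if sc: "strictly_concave \<sigma>\<^sub>1" for x
  proof -
    obtain k where k: "0 < k" "\<forall>A\<in>pos_op. \<forall>B\<in>pos_op. \<forall>x.
        k * (qf B x - qf A x)\<^sup>2 \<le> (qf A x + qf B x) * ((1 - w\<^sub>1) * qf A x + w\<^sub>1 * qf B x - qf (\<sigma>\<^sub>1 A B) x)"
      using m1.strict_gap[OF sc] by blast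
    show ?thesis
    proof (rule square_bound_null[OF k(1) _ _ D(1) Dlim(1)])
      show "k * (c x n - b x n)\<^sup>2 \<le> (b x n + c x n) * D1 x n" for n
        using k(2)[rule_format, OF pos(2)[of n] pos(3)[of n], of x] by (simp add: a_def b_def c_def D1_def step)
      show "b x n + c x n \<le> K x" for n using bd[of x n] nn[of x n] by linarith
    qed
  qed
  have s2: "(\<lambda>n. a x n - c x n) \<longlonglongrightarrow> 0" if sc: "strictly_concave \<sigma>\<^sub>2" for x
  proof -
    obtain k where k: "0 < k" "\<forall>A\<in>pos_op. \<forall>B\<in>pos_op. \<forall>x.
        k * (qf B x - qf A x)\<^sup>2 \<le> (qf A x + qf B x) * ((1 - w\<^sub>2) * qf A x + w\<^sub>2 * qf B x - qf (\<sigma>\<^sub>2 A B) x)"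
      using m2.strict_gap[OF sc] by blast
    show ?thesis
    proof (rule square_bound_null[OF k(1) _ _ D(2) Dlim(2)])
      show "k * (a x n - c x n)\<^sup>2 \<le> (c x n + a x n) * D2 x n" for n
        using k(2)[rule_format, OF pos(3)[of n] pos(1)[of n], of x] by (simp add: a_def b_def c_def D2_def step)
      show "c x n + a x n \<le> K x" for n using bd[of x n] nn[of x n] by linarith
    qed
  qed
  have s3: "(\<lambda>n. b x n - a x n) \<longlonglongrightarrow> 0" if sc: "strictly_concave \<sigma>\<^sub>3" for x
  proof -
    obtain k where k: "0 < k" "\<forall>A\<in>pos_op. \<forall>B\<in>pos_op. \<forall>x.
        k * (qf B x - qf A x)\<^sup>2 \<le> (qf A x + qf B x) * ((1 - w\<^sub>3) * qf A x + w\<^sub>3 * qf B x - qf (\<sigma>\<^sub>3 A B) x)"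
      using m3.strict_gap[OF sc] by blast
    show ?thesis
    proof (rule square_bound_null[OF k(1) _ _ D(3) Dlim(3)])
      show "k * (b x n - a x n)\<^sup>2 \<le> (a x n + b x n) * D3 x n" for n
        using k(2)[rule_format, OF pos(1)[of n] pos(2)[of n], of x] by (simp add: a_def b_def c_def D3_def step)
      show "a x n + b x n \<le> K x" for n using bd[of x n] nn[of x n] by linarith
    qed
  qed
  have ar: "(\<lambda>n. c x n - b x n) \<longlonglongrightarrow> 0 \<and> (\<lambda>n. a x n - c x n) \<longlonglongrightarrow> 0"
    if am: "arithmetic_mean \<sigma>\<^sub>1" "arithmetic_mean \<sigma>\<^sub>2" "arithmetic_mean \<sigma>\<^sub>3" for x
  proof -
    have rec: "a x (Suc n) = (1 - w\<^sub>1) * b x n + w\<^sub>1 * c x n" "b x (Suc n) = (1 - w\<^sub>2) * c x n + w\<^sub>2 * a x n"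
      "c x (Suc n) = (1 - w\<^sub>3) * a x n + w\<^sub>3 * b x n" for n
      using m1.eq_arithmetic[OF am(1) pos(2,3)] m2.eq_arithmetic[OF am(2) pos(3,1)]
        m3.eq_arithmetic[OF am(3) pos(1,2)]
      by (simp_all add: a_def b_def c_def step qf_simps)
    define V where "V n = p\<^sub>1 * (a x n)\<^sup>2 + p\<^sub>2 * (b x n)\<^sup>2 + p\<^sub>3 * (c x n)\<^sup>2" for n
    define E1 E2 E3 where "E1 n = p\<^sub>1 * (w\<^sub>1 * (1 - w\<^sub>1)) * (c x n - b x n)\<^sup>2"
      and "E2 n = p\<^sub>2 * (w\<^sub>2 * (1 - w\<^sub>2)) * (a x n - c x n)\<^sup>2"
      and "E3 n = p\<^sub>3 * (w\<^sub>3 * (1 - w\<^sub>3)) * (b x n - a x n)\<^sup>2" for n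
    have w: "0 < w\<^sub>1 * (1 - w\<^sub>1)" "0 < w\<^sub>2 * (1 - w\<^sub>2)" "0 < w\<^sub>3 * (1 - w\<^sub>3)"
      using m1.w_pos m1.w_less_one m2.w_pos m2.w_less_one m3.w_pos m3.w_less_one by simp_all
    have E: "0 \<le> E1 n" "0 \<le> E2 n" "0 \<le> E3 n" for n
      using p w by (simp_all add: E1_def E2_def E3_def)
    have Vdec: "E1 n + E2 n + E3 n = V n - V (Suc n)" for n
      unfolding E1_def E2_def E3_def V_def rec by (rule stationary_square_sum[OF st])
    have "convergent V"
    proof (rule Bseq_monoseq_convergent)
      have "V (Suc n) \<le> V n" for n using Vdec[of n] E[of n] by linarith
      then have dV: "decseq V" by (rule decseq_SucI)
      then show "monoseq V" by (rule decseq_imp_monoseq)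
      have "0 \<le> V n" for n using p by (simp add: V_def)
      then show "Bseq V" using decseqD[OF dV, of 0] by (intro BseqI'[of _ "V 0"]) simp
    qed
    then obtain L where L: "V \<longlonglongrightarrow> L" by (auto simp: convergent_def)
    have le: "E1 n \<le> V n - V (Suc n)" "E2 n \<le> V n - V (Suc n)" for n using Vdec[of n] E[of n] by linarith+
    have "(\<lambda>n. (c x n - b x n)\<^sup>2) \<longlonglongrightarrow> 0"
      by (rule weighted_decrements_null[OF mult_pos_pos[OF p(1) w(1)] zero_le_power2 le(1)[unfolded E1_def] L])
    moreover have "(\<lambda>n. (a x n - c x n)\<^sup>2) \<longlonglongrightarrow> 0"
      by (rule weighted_decrements_null[OF mult_pos_pos[OF p(2) w(2)] zero_le_power2 le(2)[unfolded E2_def] L])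
    ultimately show ?thesis by (simp add: power_tendsto_0_iff)
  qed
  have lim1: "(\<lambda>n. c x n - b x n) \<longlonglongrightarrow> 0" and lim2: "(\<lambda>n. a x n - c x n) \<longlonglongrightarrow> 0" for x
  proof -
    have swap: "(\<lambda>n. v n) \<longlonglongrightarrow> 0"
      if "(\<lambda>n. u n) \<longlonglongrightarrow> 0" "(\<lambda>n. z n) \<longlonglongrightarrow> 0" "\<And>n. v n = - (u n + z n)" for u v z :: "nat \<Rightarrow> real"
      using tendsto_minus[OF tendsto_add[OF that(1,2)]] by (simp only: that(3) add_0_left minus_zero)
    have "(\<lambda>n. c x n - b x n) \<longlonglongrightarrow> 0 \<and> (\<lambda>n. a x n - c x n) \<longlonglongrightarrow> 0"
      using dichotomy
    proof (elim disjE conjE)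
      assume "strictly_concave \<sigma>\<^sub>1" "strictly_concave \<sigma>\<^sub>3"
      then have *: "(\<lambda>n. c x n - b x n) \<longlonglongrightarrow> 0" "(\<lambda>n. b x n - a x n) \<longlonglongrightarrow> 0" using s1 s3 by blast+
      have "(\<lambda>n. a x n - c x n) \<longlonglongrightarrow> 0" by (rule swap[OF *]) linarith
      with * show ?thesis by blast
    next
      assume "strictly_concave \<sigma>\<^sub>2" "strictly_concave \<sigma>\<^sub>3"
      then have *: "(\<lambda>n. a x n - c x n) \<longlonglongrightarrow> 0" "(\<lambda>n. b x n - a x n) \<longlonglongrightarrow> 0" using s2 s3 by blast+
      have "(\<lambda>n. c x n - b x n) \<longlonglongrightarrow> 0" by (rule swap[OF *]) linarith
      with * show ?thesis by blast
    next
      assume "strictly_concave \<sigma>\<^sub>1" "strictly_concave \<sigma>\<^sub>2"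
      then show ?thesis using s1 s2 by blast
    next
      assume "arithmetic_mean \<sigma>\<^sub>1" "arithmetic_mean \<sigma>\<^sub>2" "arithmetic_mean \<sigma>\<^sub>3"
      then show ?thesis by (rule ar)
    qed
    then show "(\<lambda>n. c x n - b x n) \<longlonglongrightarrow> 0" "(\<lambda>n. a x n - c x n) \<longlonglongrightarrow> 0" by auto
  qed
  have p1: "p\<^sub>1 = 1 - p\<^sub>2 - p\<^sub>3" using p(4) by simp
  have la: "(\<lambda>n. a x n) \<longlonglongrightarrow> qf S x" for x
  proof -
    \<comment> \<open>As the weights sum to \<open>1\<close>, the substitutions
      \<open>b = c - (c - b)\<close> and \<open>c = a - (a - c)\<close> turn the weighted sum into
      \<open>a\<close> minus multiples of the two null differences.\<close>
    have "(\<lambda>n. qf (T n) x + p\<^sub>2 * (c x n - b x n) + (p\<^sub>2 + p\<^sub>3) * (a x n - c x n)) \<longlonglongrightarrow>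
        qf S x + p\<^sub>2 * 0 + (p\<^sub>2 + p\<^sub>3) * 0"
      by (intro tendsto_intros qlim lim1 lim2)
    moreover have "qf (T n) x + p\<^sub>2 * (c x n - b x n) + (p\<^sub>2 + p\<^sub>3) * (a x n - c x n) = a x n" for n
      unfolding qT p1 by (simp add: algebra_simps)
    ultimately show ?thesis by simp
  qed
  have lc: "(\<lambda>n. c x n) \<longlonglongrightarrow> qf S x" for x
    using tendsto_diff[OF la[of x] lim2[of x]] by simp
  have lb: "(\<lambda>n. b x n) \<longlonglongrightarrow> qf S x" for x
    using tendsto_diff[OF lc[of x] lim1[of x]] by simp
  have "converges_weakly A S" "converges_weakly B S" "converges_weakly C S"
    using la lb lc unfolding a_def b_def c_def
    by (auto intro!: converges_weaklyI pos_op_herm pos S)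
  then show ?thesis using S unfolding T_def by blast
qed

section \<open>Uniqueness of the probability vector\<close>

text \<open>The hypothesis is tested on scalar triples. At equal scalars both sides coincide, so
  their difference has a local minimum there in each variable, and its derivatives, computed from
  the weights, vanish.\<close>

lemma stationary_necessary:
  assumes dec: "\<And>A B C. iterates A B C \<Longrightarrow>
    p\<^sub>1 *\<^sub>R A (Suc 0) + p\<^sub>2 *\<^sub>R B (Suc 0) + p\<^sub>3 *\<^sub>R C (Suc 0) \<preceq> p\<^sub>1 *\<^sub>R A 0 + p\<^sub>2 *\<^sub>R B 0 + p\<^sub>3 *\<^sub>R C 0"
  shows "stationary p\<^sub>1 p\<^sub>2 p\<^sub>3"
proof -
  have ineq: "p\<^sub>1 * (b * m1.f (c / b)) + p\<^sub>2 * (c * m2.f (a / c)) + p\<^sub>3 * (a * m3.f (b / a))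
      \<le> p\<^sub>1 * a + p\<^sub>2 * b + p\<^sub>3 * c" if abc: "0 < a" "0 < b" "0 < c" for a b c
  proof -
    \<comment> \<open>The hypothesis speaks of whole sequences, so the scalar triple is extended to
      a full orbit.\<close>
    define F where "F = (\<lambda>(A, B, C). (\<sigma>\<^sub>1 B C, \<sigma>\<^sub>2 C A, \<sigma>\<^sub>3 A B))"
    define X where "X n = (F ^^ n) (scalar_op a, scalar_op b, scalar_op c)" for n
    define A B C where "A n = fst (X n)" and "B n = fst (snd (X n))" and "C n = snd (snd (X n))" for n
    have X0: "A 0 = scalar_op a" "B 0 = scalar_op b" "C 0 = scalar_op c"
      by (simp_all add: A_def B_def C_def X_def)
    have step: "A (Suc n) = \<sigma>\<^sub>1 (B n) (C n)" "B (Suc n) = \<sigma>\<^sub>2 (C n) (A n)" "C (Suc n) = \<sigma>\<^sub>3 (A n) (B n)" for n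
      by (simp_all add: A_def B_def C_def X_def F_def case_prod_beta)
    have "iterates A B C"
      using abc unfolding iterates_def by (simp add: X0 step scalar_op_pos less_imp_le)
    from dec[OF this] have "p\<^sub>1 *\<^sub>R scalar_op (b * m1.f (c / b)) + p\<^sub>2 *\<^sub>R scalar_op (c * m2.f (a / c))
        + p\<^sub>3 *\<^sub>R scalar_op (a * m3.f (b / a)) \<preceq> p\<^sub>1 *\<^sub>R scalar_op a + p\<^sub>2 *\<^sub>R scalar_op b + p\<^sub>3 *\<^sub>R (scalar_op c :: 'a op)"
      unfolding step X0 using abc by (simp only: m1.scalar m2.scalar m3.scalar less_imp_le)
    note le = op_le_qf[OF this, unfolded qf_simps]
    obtain x :: 'a where "x \<noteq> 0" using m1.nonzero by blast
    have "(p\<^sub>1 * (b * m1.f (c / b)) + p\<^sub>2 * (c * m2.f (a / c)) + p\<^sub>3 * (a * m3.f (b / a))) * (norm x)\<^sup>2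
        \<le> (p\<^sub>1 * a + p\<^sub>2 * b + p\<^sub>3 * c) * (norm x)\<^sup>2"
      using le[of x] by (simp only: distrib_right mult.assoc)
    then show ?thesis using \<open>x \<noteq> 0\<close> by simp
  qed
  \<comment> \<open>\<open>t * g (1 / t)\<close> belongs to the mean with its arguments exchanged;
    its slope at \<open>1\<close> is the complementary weight.\<close>
  have inv: "((\<lambda>t. t * g (1 / t)) has_real_derivative (1 - d)) (at 1)"
    if "(g has_real_derivative d) (at 1)" "g 1 = 1" for g :: "real \<Rightarrow> real" and d
  proof -
    have "((\<lambda>t. 1 / t) has_real_derivative (- 1)) (at (1::real))"
      by (auto intro!: derivative_eq_intros)
    moreover have "(g has_real_derivative d) (at (1 / 1))" using that by simp
    ultimately have "((\<lambda>t. g (1 / t)) has_real_derivative (d * (- 1))) (at 1)"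
      by (intro DERIV_chain2[of g d "\<lambda>t. 1 / t" 1 "- 1" UNIV])
    from DERIV_mult[OF DERIV_ident this] show ?thesis using that(2) by simp
  qed
  \<comment> \<open>This is meant for \<open>ineq\<close> with one scalar equal to \<open>t\<close>
    and the others to \<open>1\<close>; the difference \<open>\<phi>\<close> of the two sides is
    \<open>0\<close> at \<open>t = 1\<close> and nonnegative for positive \<open>t\<close>.\<close>
  have crit: "l = u * d + v * (1 - e)"
    if g: "(g has_real_derivative d) (at 1)" and h: "(h has_real_derivative e) (at 1)"
      and one: "g 1 = 1" "h 1 = 1"
      and le: "\<And>t. 0 < t \<Longrightarrow> u * g t + v * (t * h (1 / t)) + (l - u - v) \<le> l * t"
    for g h :: "real \<Rightarrow> real" and d e u v l
  proof -
    define \<phi> where "\<phi> t = l * t - (u * g t + v * (t * h (1 / t)) + (l - u - v))" for t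
    have "(\<phi> has_real_derivative (l - (u * d + v * (1 - e)))) (at 1)"
      unfolding \<phi>_def
      using DERIV_diff[OF DERIV_cmult[OF DERIV_ident, of l]
          DERIV_add[OF DERIV_add[OF DERIV_cmult[OF g, of u] DERIV_cmult[OF inv[OF h one(2)], of v]]
            DERIV_const[of "l - u - v"]]]
      by simp
    moreover have "\<phi> 1 \<le> \<phi> t" if "\<bar>1 - t\<bar> < 1" for t
      using le[of t] that by (simp add: \<phi>_def one)
    ultimately have "l - (u * d + v * (1 - e)) = 0"
      by (intro DERIV_local_min[of \<phi> "l - (u * d + v * (1 - e))" 1 1]) auto
    then show ?thesis by simp
  qed
  have 1: "p\<^sub>1 = p\<^sub>2 * w\<^sub>2 + p\<^sub>3 * (1 - w\<^sub>3)"
  proof (rule crit[OF m2.deriv_w m3.deriv_w m2.one m3.one])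
    show "p\<^sub>2 * m2.f t + p\<^sub>3 * (t * m3.f (1 / t)) + (p\<^sub>1 - p\<^sub>2 - p\<^sub>3) \<le> p\<^sub>1 * t" if "0 < t" for t
      using ineq[of t 1 1] that by (simp add: m1.one)
  qed
  have 2: "p\<^sub>2 = p\<^sub>3 * w\<^sub>3 + p\<^sub>1 * (1 - w\<^sub>1)"
  proof (rule crit[OF m3.deriv_w m1.deriv_w m3.one m1.one])
    show "p\<^sub>3 * m3.f t + p\<^sub>1 * (t * m1.f (1 / t)) + (p\<^sub>2 - p\<^sub>3 - p\<^sub>1) \<le> p\<^sub>2 * t" if "0 < t" for t
      using ineq[of 1 t 1] that by (simp add: m2.one)
  qed
  \<comment> \<open>The rows of the transition matrix sum to \<open>1\<close>, so the third equation
    follows from the other two.\<close>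
  have "p\<^sub>3 = p\<^sub>1 * w\<^sub>1 + p\<^sub>2 * (1 - w\<^sub>2)"
    using 1 2 unfolding right_diff_distrib by linarith
  then show ?thesis unfolding stationary_def using 1 2 by (intro conjI) linarith+
qed

text \<open>\<open>W\<^sub>1\<close>, \<open>W\<^sub>2\<close> and \<open>W\<^sub>3\<close> are the
  principal minors of size two of the identity minus the transition matrix, and the vector of these
  minors spans its left kernel. Their positivity makes the normalized solution a positive
  probability vector.\<close>

lemma stationary_iff:
  assumes "W\<^sub>1 = 1 - w\<^sub>3 * (1 - w\<^sub>2)" "W\<^sub>2 = 1 - w\<^sub>1 * (1 - w\<^sub>3)" "W\<^sub>3 = 1 - w\<^sub>2 * (1 - w\<^sub>1)"
    and W: "0 < W\<^sub>1" "0 < W\<^sub>2" "0 < W\<^sub>3"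
  shows "p\<^sub>1 + p\<^sub>2 + p\<^sub>3 = 1 \<and> stationary p\<^sub>1 p\<^sub>2 p\<^sub>3 \<longleftrightarrow>
    p\<^sub>1 = W\<^sub>1 / (W\<^sub>1 + W\<^sub>2 + W\<^sub>3) \<and> p\<^sub>2 = W\<^sub>2 / (W\<^sub>1 + W\<^sub>2 + W\<^sub>3) \<and> p\<^sub>3 = W\<^sub>3 / (W\<^sub>1 + W\<^sub>2 + W\<^sub>3)"
    (is "?L \<longleftrightarrow> ?R")
proof
  assume ?R
  define c where "c = 1 / (W\<^sub>1 + W\<^sub>2 + W\<^sub>3)"
  have p: "p\<^sub>1 = c * W\<^sub>1" "p\<^sub>2 = c * W\<^sub>2" "p\<^sub>3 = c * W\<^sub>3" using \<open>?R\<close> by (simp_all add: c_def)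
  have "c * (W\<^sub>1 + W\<^sub>2 + W\<^sub>3) = 1" using W by (simp add: c_def)
  then have "p\<^sub>1 + p\<^sub>2 + p\<^sub>3 = 1" unfolding p by (simp add: distrib_left)
  moreover have "W\<^sub>1 = W\<^sub>2 * w\<^sub>2 + W\<^sub>3 * (1 - w\<^sub>3)" "W\<^sub>2 = W\<^sub>1 * (1 - w\<^sub>1) + W\<^sub>3 * w\<^sub>3"
    "W\<^sub>3 = W\<^sub>1 * w\<^sub>1 + W\<^sub>2 * (1 - w\<^sub>2)"
    unfolding assms(1-3) by (simp_all add: algebra_simps)
  then have "c * W\<^sub>1 = c * (W\<^sub>2 * w\<^sub>2 + W\<^sub>3 * (1 - w\<^sub>3))" "c * W\<^sub>2 = c * (W\<^sub>1 * (1 - w\<^sub>1) + W\<^sub>3 * w\<^sub>3)"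
    "c * W\<^sub>3 = c * (W\<^sub>1 * w\<^sub>1 + W\<^sub>2 * (1 - w\<^sub>2))"
    by (metis (no_types))+
  then have "stationary p\<^sub>1 p\<^sub>2 p\<^sub>3"
    unfolding stationary_def p mult.assoc distrib_left[symmetric] by blast
  ultimately show ?L by blast
next
  assume ?L
  then have sum: "p\<^sub>1 + p\<^sub>2 + p\<^sub>3 = 1" and st: "stationary p\<^sub>1 p\<^sub>2 p\<^sub>3" by auto
  have st: "p\<^sub>1 = p\<^sub>2 * w\<^sub>2 + p\<^sub>3 * (1 - w\<^sub>3)" "p\<^sub>2 = p\<^sub>1 * (1 - w\<^sub>1) + p\<^sub>3 * w\<^sub>3"
    "p\<^sub>3 = p\<^sub>1 * w\<^sub>1 + p\<^sub>2 * (1 - w\<^sub>2)"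
    using st unfolding stationary_def by blast+
  \<comment> \<open>Eliminating \<open>p\<^sub>3\<close> leaves
    \<open>p\<^sub>1 * W\<^sub>2 = p\<^sub>2 * W\<^sub>1\<close>; eliminating
    \<open>p\<^sub>2\<close> afterwards gives the other proportion.\<close>
  have "p\<^sub>1 = p\<^sub>2 * w\<^sub>2 + (p\<^sub>1 * w\<^sub>1 + p\<^sub>2 * (1 - w\<^sub>2)) * (1 - w\<^sub>3)" using st(1,3) by (metis (no_types))
  moreover have "p\<^sub>1 * W\<^sub>2 - p\<^sub>2 * W\<^sub>1 = p\<^sub>1 - (p\<^sub>2 * w\<^sub>2 + (p\<^sub>1 * w\<^sub>1 + p\<^sub>2 * (1 - w\<^sub>2)) * (1 - w\<^sub>3))"
    unfolding assms(1-3) by (simp add: algebra_simps)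
  ultimately have 2: "p\<^sub>1 * W\<^sub>2 = p\<^sub>2 * W\<^sub>1" by linarith
  have "p\<^sub>1 = (p\<^sub>1 * (1 - w\<^sub>1) + p\<^sub>3 * w\<^sub>3) * w\<^sub>2 + p\<^sub>3 * (1 - w\<^sub>3)" using st(1,2) by (metis (no_types))
  moreover have "p\<^sub>1 * W\<^sub>3 - p\<^sub>3 * W\<^sub>1 = p\<^sub>1 - ((p\<^sub>1 * (1 - w\<^sub>1) + p\<^sub>3 * w\<^sub>3) * w\<^sub>2 + p\<^sub>3 * (1 - w\<^sub>3))"
    unfolding assms(1-3) by (simp add: algebra_simps)
  ultimately have 3: "p\<^sub>1 * W\<^sub>3 = p\<^sub>3 * W\<^sub>1" by linarith
  have "p\<^sub>1 * (W\<^sub>1 + W\<^sub>2 + W\<^sub>3) = (p\<^sub>1 + p\<^sub>2 + p\<^sub>3) * W\<^sub>1"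
    using 2 3 by (simp only: distrib_left distrib_right)
  then have 1: "p\<^sub>1 * (W\<^sub>1 + W\<^sub>2 + W\<^sub>3) = W\<^sub>1" using sum by simp
  have nz: "W\<^sub>1 + W\<^sub>2 + W\<^sub>3 \<noteq> 0" "W\<^sub>1 \<noteq> 0" using W by auto
  have p1: "p\<^sub>1 = W\<^sub>1 / (W\<^sub>1 + W\<^sub>2 + W\<^sub>3)" unfolding nonzero_eq_divide_eq[OF nz(1)] by (rule 1)
  have "p\<^sub>2 * W\<^sub>1 = W\<^sub>2 / (W\<^sub>1 + W\<^sub>2 + W\<^sub>3) * W\<^sub>1" unfolding 2[symmetric] p1 by simp
  moreover have "p\<^sub>3 * W\<^sub>1 = W\<^sub>3 / (W\<^sub>1 + W\<^sub>2 + W\<^sub>3) * W\<^sub>1" unfolding 3[symmetric] p1 by simp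
  ultimately show ?R using p1 nz(2) by (simp only: mult_right_cancel simp_thms)
qed

end

theorem theorem4p1:
  fixes \<sigma>\<^sub>1 \<sigma>\<^sub>2 \<sigma>\<^sub>3 :: "'a::complex_hilbert_space op \<Rightarrow> 'a op \<Rightarrow> 'a op"
  assumes nonzero_space: "\<exists>x::'a. x \<noteq> 0"
    and means: "operator_mean \<sigma>\<^sub>1" "operator_mean \<sigma>\<^sub>2" "operator_mean \<sigma>\<^sub>3"
    and kubo_ando: "\<exists>f. representing_function \<sigma>\<^sub>1 f" "\<exists>f. representing_function \<sigma>\<^sub>2 f"
      "\<exists>f. representing_function \<sigma>\<^sub>3 f"
    and nontrivial: "nontrivial_mean \<sigma>\<^sub>1" "nontrivial_mean \<sigma>\<^sub>2" "nontrivial_mean \<sigma>\<^sub>3"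
    and dichotomy:
      "(arithmetic_mean \<sigma>\<^sub>1 \<and> arithmetic_mean \<sigma>\<^sub>2 \<and> arithmetic_mean \<sigma>\<^sub>3) \<or>
       (strictly_concave \<sigma>\<^sub>1 \<and> strictly_concave \<sigma>\<^sub>2) \<or>
       (strictly_concave \<sigma>\<^sub>1 \<and> strictly_concave \<sigma>\<^sub>3) \<or>
       (strictly_concave \<sigma>\<^sub>2 \<and> strictly_concave \<sigma>\<^sub>3)"
  shows "\<exists>!p::real \<times> real \<times> real. case p of (p\<^sub>1, p\<^sub>2, p\<^sub>3) \<Rightarrow>
    p\<^sub>1 \<in> {0<..<1} \<and> p\<^sub>2 \<in> {0<..<1} \<and> p\<^sub>3 \<in> {0<..<1} \<and> p\<^sub>1 + p\<^sub>2 + p\<^sub>3 = 1 \<and>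
    (\<forall>A B C :: nat \<Rightarrow> 'a op.
       A 0 \<in> pos_op \<and> B 0 \<in> pos_op \<and> C 0 \<in> pos_op \<and>
       (\<forall>n. A (Suc n) = \<sigma>\<^sub>1 (B n) (C n) \<and> B (Suc n) = \<sigma>\<^sub>2 (C n) (A n) \<and> C (Suc n) = \<sigma>\<^sub>3 (A n) (B n)) \<longrightarrow>
       (\<exists>S\<in>pos_op. converges_weakly A S \<and> converges_weakly B S \<and> converges_weakly C S \<and>
          (\<lambda>n. p\<^sub>1 *\<^sub>R A n + p\<^sub>2 *\<^sub>R B n + p\<^sub>3 *\<^sub>R C n) \<down> S))"
proof -
  interpret three_means \<sigma>\<^sub>1 \<sigma>\<^sub>2 \<sigma>\<^sub>3 "weight \<sigma>\<^sub>1" "weight \<sigma>\<^sub>2" "weight \<sigma>\<^sub>3"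
    using nonzero_space means kubo_ando nontrivial by unfold_locales auto
  define W\<^sub>1 W\<^sub>2 W\<^sub>3 where "W\<^sub>1 = 1 - weight \<sigma>\<^sub>3 * (1 - weight \<sigma>\<^sub>2)"
    and "W\<^sub>2 = 1 - weight \<sigma>\<^sub>1 * (1 - weight \<sigma>\<^sub>3)" and "W\<^sub>3 = 1 - weight \<sigma>\<^sub>2 * (1 - weight \<sigma>\<^sub>1)"
  have less: "s * (1 - t) < 1" if "0 < s" "s < 1" "0 < t" "t < 1" for s t :: real
    using mult_strict_mono[of s 1 "1 - t" 1] that by simp
  have W: "0 < W\<^sub>1" "0 < W\<^sub>2" "0 < W\<^sub>3"
    using less m1.w_pos m1.w_less_one m2.w_pos m2.w_less_one m3.w_pos m3.w_less_one
    by (simp_all add: W\<^sub>1_def W\<^sub>2_def W\<^sub>3_def)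
  note iff = stationary_iff[OF W\<^sub>1_def W\<^sub>2_def W\<^sub>3_def W]
  define p\<^sub>1 p\<^sub>2 p\<^sub>3 where "p\<^sub>1 = W\<^sub>1 / (W\<^sub>1 + W\<^sub>2 + W\<^sub>3)" and "p\<^sub>2 = W\<^sub>2 / (W\<^sub>1 + W\<^sub>2 + W\<^sub>3)"
    and "p\<^sub>3 = W\<^sub>3 / (W\<^sub>1 + W\<^sub>2 + W\<^sub>3)"
  have p: "0 < p\<^sub>1" "0 < p\<^sub>2" "0 < p\<^sub>3" "p\<^sub>1 + p\<^sub>2 + p\<^sub>3 = 1" "stationary p\<^sub>1 p\<^sub>2 p\<^sub>3"
    using iff[of p\<^sub>1 p\<^sub>2 p\<^sub>3] W by (simp_all add: p\<^sub>1_def p\<^sub>2_def p\<^sub>3_def)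
  show ?thesis
  proof (rule ex1I[of _ "(p\<^sub>1, p\<^sub>2, p\<^sub>3)"], unfold prod.case, intro conjI allI impI)
    show "p\<^sub>1 \<in> {0<..<1}" "p\<^sub>2 \<in> {0<..<1}" "p\<^sub>3 \<in> {0<..<1}" "p\<^sub>1 + p\<^sub>2 + p\<^sub>3 = 1" using p(1-4) by auto
    fix A B C :: "nat \<Rightarrow> 'a op"
    assume "A 0 \<in> pos_op \<and> B 0 \<in> pos_op \<and> C 0 \<in> pos_op \<and>
       (\<forall>n. A (Suc n) = \<sigma>\<^sub>1 (B n) (C n) \<and> B (Suc n) = \<sigma>\<^sub>2 (C n) (A n) \<and> C (Suc n) = \<sigma>\<^sub>3 (A n) (B n))"
    then have "iterates A B C" by (unfold iterates_def)
    then show "\<exists>S\<in>pos_op. converges_weakly A S \<and> converges_weakly B S \<and> converges_weakly C S \<and>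
        (\<lambda>n. p\<^sub>1 *\<^sub>R A n + p\<^sub>2 *\<^sub>R B n + p\<^sub>3 *\<^sub>R C n) \<down> S"
      by (rule stationary_converges[OF p dichotomy])
  next
    fix q :: "real \<times> real \<times> real"
    obtain q\<^sub>1 q\<^sub>2 q\<^sub>3 where q: "q = (q\<^sub>1, q\<^sub>2, q\<^sub>3)" by (rule prod_cases3)
    assume *: "case q of (p\<^sub>1, p\<^sub>2, p\<^sub>3) \<Rightarrow>
      p\<^sub>1 \<in> {0<..<1} \<and> p\<^sub>2 \<in> {0<..<1} \<and> p\<^sub>3 \<in> {0<..<1} \<and> p\<^sub>1 + p\<^sub>2 + p\<^sub>3 = 1 \<and>
      (\<forall>A B C :: nat \<Rightarrow> 'a op.
         A 0 \<in> pos_op \<and> B 0 \<in> pos_op \<and> C 0 \<in> pos_op \<and>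
         (\<forall>n. A (Suc n) = \<sigma>\<^sub>1 (B n) (C n) \<and> B (Suc n) = \<sigma>\<^sub>2 (C n) (A n) \<and> C (Suc n) = \<sigma>\<^sub>3 (A n) (B n)) \<longrightarrow>
         (\<exists>S\<in>pos_op. converges_weakly A S \<and> converges_weakly B S \<and> converges_weakly C S \<and>
            (\<lambda>n. p\<^sub>1 *\<^sub>R A n + p\<^sub>2 *\<^sub>R B n + p\<^sub>3 *\<^sub>R C n) \<down> S))"
    have conv: "\<exists>S. (\<lambda>n. q\<^sub>1 *\<^sub>R A n + q\<^sub>2 *\<^sub>R B n + q\<^sub>3 *\<^sub>R C n) \<down> S" if "iterates A B C" for A B C
      using * that unfolding q prod.case iterates_def[symmetric] by blast
    \<comment> \<open>A decreasing weighted sum decreases in the first step, from every initial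
      triple, so any admissible vector is stationary and \<open>iff\<close> identifies it.\<close>
    have "stationary q\<^sub>1 q\<^sub>2 q\<^sub>3"
    proof (rule stationary_necessary)
      fix A B C assume "iterates A B C"
      from conv[OF this] show "q\<^sub>1 *\<^sub>R A (Suc 0) + q\<^sub>2 *\<^sub>R B (Suc 0) + q\<^sub>3 *\<^sub>R C (Suc 0)
          \<preceq> q\<^sub>1 *\<^sub>R A 0 + q\<^sub>2 *\<^sub>R B 0 + q\<^sub>3 *\<^sub>R C 0"
        unfolding decreases_to_def by blast
    qed
    moreover have "q\<^sub>1 + q\<^sub>2 + q\<^sub>3 = 1" using * by (simp add: q)
    ultimately show "q = (p\<^sub>1, p\<^sub>2, p\<^sub>3)"
      using iff[of q\<^sub>1 q\<^sub>2 q\<^sub>3] by (simp add: q p\<^sub>1_def p\<^sub>2_def p\<^sub>3_def)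
  qed
qed

end
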